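(* Let $X$ be a simplicial complex on $[n]$. Let $\mathbf c=\mathbf a-b$ belong to degree $0$, where $\mathbf a\in\mathbb N^{n+1}$ has support $a$, $b\subseteq[n]$ is disjoint from $a$, and degree $0$ means $\deg\mathbf a=\#b$ with $\deg$ denoting the sum of entries. Fix a vertex $v\in[n]$. (i) Localization with respect to $v$ maps $T^i_{\mathbf a-b}(X)\subseteq T^i_{A_X,0}$ into the graded summand $T^i_{(\mathbf a\setminus v)-(b\setminus v)}(\mathrm{lk}(v,X))\subseteq T^i_{D_+(x_v)}$ ($i=1,2$), where $\mathbf a\setminus v$ means cancellation of the $v$-entry of $\mathbf a$. (ii) The map of (i) is induced from $\psi_{a-b}(v):N_{(a\setminus v)-(b\setminus v)}(\mathrm{lk}(v,X))\to N_{a-b}(X)$ defined by $\psi_{a-b}(v)(g)=g\cup(\{v\}\setminus b)$. This map is compatible with the $\widetilde N$ level, i.e. it maps $\widetilde N_{(a\setminus v)-(b\setminus v)}(\mathrm{lk}(v,X))$ into $\widetilde N_{a-b}(X)$. (iii) If $v\in a$, then the localization map $T^i_{\mathbf a-b}(X)\to T^i_{(\mathbf a\setminus v)-b}(\mathrm{lk}(v,X))$ is an isomorphism.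
   Context: Let $[n]=\{0,\dots,n\}$ and $P=\mathbb C[x_0,\dots,x_n]$. A simplicial complex $X$ on $[n]$ is a family of subsets of $[n]$ closed under taking subsets, with $\emptyset\in X$. Subsets of $[n]$ are identified with their characteristic vectors. Put $I_X=\langle \mathbf x^p : p\notin X\rangle$ and $A_X=P/I_X$, $\mathbb P(X)=\mathrm{Proj}\,A_X$. $\mathrm{lk}(v,X)=\{g\in X : v\notin g,\ g\cup\{v\}\in X\}$ (void if $\{v\}\notin X$; then its ring and $T^i$ are zero). For $A=P/I$: $T^1_A$ is the cokernel of $\mathrm{Der}_{\mathbb C}(P,P)\to\mathrm{Hom}_P(I,A)$. If $0\to R\to P^m\xrightarrow{j}P\to A\to0$ is exact and $R_0=\langle j(f)e-j(e)f\rangle\subseteq R$, then $T^2_A$ is the cokernel of $\mathrm{Hom}_P(P^m,A)\to\mathrm{Hom}_A(R/R_0,A)$. For Stanley-Reisner rings these are graded by integer exponent vectors; $T^i_{\mathbf c}(X)$ is the degree $\mathbf c$ part of $T^i_{A_X}$, and $T^i_{A_X,0}$ is the degree $0$ part for the usual $\mathbb Z$-grading. For disjoint $a,b$ and a complex $Y$: $N_{a-b}(Y)=\{f\in Y : a\subseteq f,\ f\cap b=\emptyset,\ f\cup b\notin Y\}$, $\widetilde N_{a-b}(Y)=\{f\in N_{a-b}(Y): f\cup b'\notin Y\text{ for some proper subset }b'\subsetneq b\}$. Localization: the affine chart $D_+(x_v)\subseteq\mathbb P(X)$ has coordinate ring $((A_X)_{x_v})_0\cong A_{\mathrm{lk}(v,X)}$,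 and $T^i_{D_+(x_v)}$ is $T^i$ of this ring. The localization map $T^i_{A_X,0}\to T^i_{D_+(x_v)}$ is obtained by dehomogenizing (setting $x_v=1$), i.e. it is the degree $0$ part of $T^i_{A_X}\to T^i_{(A_X)_{x_v}}$ using $(A_X)_{x_v}\cong A_{\mathrm{lk}(v,X)}[x_v^{\pm1}]$. "Induced" in (ii) refers to the isomorphisms $T^i_{\mathbf a-b}(Y)\simeq H^{i-1}(\langle N_{a-b}(Y)\rangle,\langle\widetilde N_{a-b}(Y)\rangle,\mathbb C)$ (with reduced cohomology if $\#b=1$), or on the combinatorial level to the pull-back of functions on $N_{a-b}$, respectively on $\{(f,g)\in N_{a-b}^2: f\cup g\in Y\}$: a class in $T^1_{\mathbf a-b}(Y)$ is represented by $\lambda:N_{a-b}(Y)\to\mathbb C$ vanishing on $\widetilde N_{a-b}(Y)$ with $\lambda(f)=\lambda(g)$ if $f\cup g\in Y$ (it sends $\mathbf x^p$, $p\notin Y$, to $\lambda((p\cup a)\setminus b)\mathbf x^{p+\mathbf a-b}$ if $(p\cup a)\setminus b\in Y$ and to $0$ otherwise), and a class in $T^2_{\mathbf a-b}(Y)$ by an antisymmetric function $\lambda(f,g)$ (it sends the relation $\mathbf x^{q\setminus p}e_p-\mathbf x^{p\setminus q}e_q$ to $\lambda((p\cup a)\setminus b,(q\cup a)\setminus b)\,\mathbf x^{(p\cup q)+\mathbf a-b}$ if $(p\cup q\cup a)\setminus b\in Y$ and to $0$ otherwise). Here, for $Z\subseteq Y$, $\langle Z\rangle$ is the union of the relatively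 open simplices of the non-empty $f\in Z$ in $|Y|$ if $\emptyset\notin Z$, and the cone over this union if $\emptyset\in Z$. *)

theory Defs
  imports Complex_Main "HOL-Algebra.QuotRing" "HOL-Algebra.Module" "HOL-Library.Poly_Mapping"
begin

section \<open>Polynomials\<close>

text \<open>A monomial is its exponent vector. The ring \<open>\<complex>[x\<^sub>i : i \<in> V]\<close> is the
  subring of those polynomials in variables indexed by \<^typ>\<open>nat\<close> that involve
  only the variables in \<open>V\<close>.\<close>

type_synonym mono = "nat \<Rightarrow>\<^sub>0 nat"
type_synonym mpoly = "mono \<Rightarrow>\<^sub>0 complex"

definition poly_ring :: "nat set \<Rightarrow> mpoly ring" where
  "poly_ring V = \<lparr>carrier = {F. \<forall>m\<in>Poly_Mapping.keys F. Poly_Mapping.keys m \<subseteq> V},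
     monoid.mult = (*), one = 1, zero = 0, add = (+)\<rparr>"

definition Const :: "complex \<Rightarrow> mpoly" where
  "Const k = Poly_Mapping.single 0 k"

definition chi :: "nat set \<Rightarrow> mono" where
  "chi p = (\<Sum>i\<in>p. Poly_Mapping.single i 1)"

definition sqfree :: "nat set \<Rightarrow> mpoly" where
  "sqfree p = Poly_Mapping.single (chi p) 1"

definition total_degree :: "mono \<Rightarrow> nat" where
  "total_degree m = (\<Sum>i\<in>Poly_Mapping.keys m. Poly_Mapping.lookup m i)"

definition multideg :: "mono \<Rightarrow> (nat \<Rightarrow>\<^sub>0 int)" where
  "multideg m = Poly_Mapping.map int m"

text \<open>The monomial with a given integer exponent vector, read as \<open>0\<close> if some exponent
  is negative: such a degree contains no polynomial except \<open>0\<close>. This occurs below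
  where \<open>b\<close> is not contained in the support of the argument.\<close>

definition xpow :: "(nat \<Rightarrow>\<^sub>0 int) \<Rightarrow> mpoly" where
  "xpow e = (if \<forall>i. 0 \<le> Poly_Mapping.lookup e i
             then Poly_Mapping.single (Poly_Mapping.map nat e) 1 else 0)"


section \<open>Modules\<close>

text \<open>The fields \<^const>\<open>monoid.mult\<close> and \<^const>\<open>monoid.one\<close> of a module record play no role.\<close>

definition mod_hom ::
  "('r, 'x) ring_scheme \<Rightarrow> ('r, 'm, 'y) module_scheme \<Rightarrow> ('r, 'n, 'z) module_scheme \<Rightarrow> ('m \<Rightarrow> 'n) set"
where
  "mod_hom R M N = {\<phi> \<in> carrier M \<rightarrow>\<^sub>E carrier N.
     (\<forall>x\<in>carrier M. \<forall>y\<in>carrier M. \<phi> (x \<oplus>\<^bsub>M\<^esub> y) = \<phi> x \<oplus>\<^bsub>N\<^esub> \<phi> y) \<and>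
     (\<forall>r\<in>carrier R. \<forall>x\<in>carrier M. \<phi> (r \<odot>\<^bsub>M\<^esub> x) = r \<odot>\<^bsub>N\<^esub> \<phi> x)}"

definition hom_module ::
  "('r, 'x) ring_scheme \<Rightarrow> ('r, 'm, 'y) module_scheme \<Rightarrow> ('r, 'n, 'z) module_scheme \<Rightarrow> ('r, 'm \<Rightarrow> 'n) module"
where
  "hom_module R M N = \<lparr>carrier = mod_hom R M N, monoid.mult = undefined, one = undefined,
     zero = (\<lambda>x\<in>carrier M. \<zero>\<^bsub>N\<^esub>),
     add = (\<lambda>\<phi> \<chi>. \<lambda>x\<in>carrier M. \<phi> x \<oplus>\<^bsub>N\<^esub> \<chi> x),
     smult = (\<lambda>r \<phi>. \<lambda>x\<in>carrier M. r \<odot>\<^bsub>N\<^esub> \<phi> x)\<rparr>"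

definition quot_module :: "('r, 'm, 'y) module_scheme \<Rightarrow> 'm set \<Rightarrow> ('r, 'm set) module" where
  "quot_module M S = \<lparr>carrier = a_rcosets\<^bsub>M\<^esub> S, monoid.mult = undefined, one = undefined,
     zero = S, add = set_add M, smult = (\<lambda>r C. \<Union>x\<in>C. S +>\<^bsub>M\<^esub> (r \<odot>\<^bsub>M\<^esub> x))\<rparr>"

definition ideal_module :: "('r, 'x) ring_scheme \<Rightarrow> 'r set \<Rightarrow> ('r, 'r) module" where
  "ideal_module R I = \<lparr>carrier = I, monoid.mult = undefined, one = undefined,
     zero = \<zero>\<^bsub>R\<^esub>, add = add R, smult = monoid.mult R\<rparr>"

text \<open>\<open>R/I\<close> as an \<open>R\<close>-module.\<close>

definition quot_ring_module :: "('r, 'x) ring_scheme \<Rightarrow> 'r set \<Rightarrow> ('r, 'r set) module" where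
  "quot_ring_module R I = \<lparr>carrier = carrier (R Quot I), monoid.mult = undefined, one = undefined,
     zero = \<zero>\<^bsub>R Quot I\<^esub>, add = add (R Quot I),
     smult = (\<lambda>r C. (I +>\<^bsub>R\<^esub> r) \<otimes>\<^bsub>R Quot I\<^esub> C)\<rparr>"

text \<open>The free module with basis \<open>e\<^sub>p\<close> (that is, \<open>Poly_Mapping.single p 1\<close>), \<open>p \<in> J\<close>.\<close>

definition free_module :: "nat set \<Rightarrow> 'j set \<Rightarrow> (mpoly, 'j \<Rightarrow>\<^sub>0 mpoly) module" where
  "free_module V J = \<lparr>carrier = {r. Poly_Mapping.keys r \<subseteq> J \<and>
                                 (\<forall>p. Poly_Mapping.lookup r p \<in> carrier (poly_ring V))},
     monoid.mult = undefined, one = undefined, zero = 0, add = (+),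
     smult = (\<lambda>F r. Poly_Mapping.map ((*) F) r)\<rparr>"


section \<open>Cotangent modules\<close>

definition derivations :: "nat set \<Rightarrow> (mpoly \<Rightarrow> mpoly) set" where
  "derivations V = {D \<in> carrier (poly_ring V) \<rightarrow>\<^sub>E carrier (poly_ring V).
     (\<forall>F\<in>carrier (poly_ring V). \<forall>G\<in>carrier (poly_ring V). D (F + G) = D F + D G) \<and>
     (\<forall>k. \<forall>F\<in>carrier (poly_ring V). D (Const k * F) = Const k * D F) \<and>
     (\<forall>F\<in>carrier (poly_ring V). \<forall>G\<in>carrier (poly_ring V). D (F * G) = F * D G + G * D F)}"

definition Hom1 :: "nat set \<Rightarrow> mpoly set \<Rightarrow> (mpoly, mpoly \<Rightarrow> mpoly set) module" where
  "Hom1 V I = hom_module (poly_ring V) (ideal_module (poly_ring V) I) (quot_ring_module (poly_ring V) I)"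

definition T1 :: "nat set \<Rightarrow> mpoly set \<Rightarrow> (mpoly, (mpoly \<Rightarrow> mpoly set) set) module" where
  "T1 V I = quot_module (Hom1 V I) {\<lambda>F\<in>I. I +>\<^bsub>poly_ring V\<^esub> D F | D. D \<in> derivations V}"

text \<open>A presentation of \<open>I = \<langle>g p : p \<in> J\<rangle>\<close>: \<open>present g\<close> is \<open>j : P\<^sup>J \<rightarrow> P\<close>, \<open>e\<^sub>p \<mapsto> g p\<close>;
  \<open>relations\<close> is \<open>R\<close> and \<open>koszul\<close> is \<open>R\<^sub>0\<close>.\<close>

definition present :: "('j \<Rightarrow> mpoly) \<Rightarrow> ('j \<Rightarrow>\<^sub>0 mpoly) \<Rightarrow> mpoly" where
  "present g r = (\<Sum>p\<in>Poly_Mapping.keys r. Poly_Mapping.lookup r p * g p)"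

definition relations :: "nat set \<Rightarrow> 'j set \<Rightarrow> ('j \<Rightarrow> mpoly) \<Rightarrow> ('j \<Rightarrow>\<^sub>0 mpoly) set" where
  "relations V J g = {r \<in> carrier (free_module V J). present g r = 0}"

definition koszul :: "nat set \<Rightarrow> 'j set \<Rightarrow> ('j \<Rightarrow> mpoly) \<Rightarrow> ('j \<Rightarrow>\<^sub>0 mpoly) set" where
  "koszul V J g = (\<lambda>S. submodule S (poly_ring V) (free_module V J)) hull
     {present g f \<odot>\<^bsub>free_module V J\<^esub> e - present g e \<odot>\<^bsub>free_module V J\<^esub> f | e f.
        e \<in> carrier (free_module V J) \<and> f \<in> carrier (free_module V J)}"

definition rel_module :: "nat set \<Rightarrow> 'j set \<Rightarrow> ('j \<Rightarrow> mpoly) \<Rightarrow> (mpoly, ('j \<Rightarrow>\<^sub>0 mpoly) set) module" where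
  "rel_module V J g = quot_module ((free_module V J)\<lparr>carrier := relations V J g\<rparr>) (koszul V J g)"

text \<open>For \<open>A = P/I\<close>, the \<open>A\<close>-linear maps \<open>R/R\<^sub>0 \<rightarrow> A\<close> are the \<open>P\<close>-linear ones, because
  \<open>P \<rightarrow> A\<close> is onto.\<close>

definition Hom2 :: "nat set \<Rightarrow> 'j set \<Rightarrow> ('j \<Rightarrow> mpoly) \<Rightarrow>
    (mpoly, ('j \<Rightarrow>\<^sub>0 mpoly) set \<Rightarrow> mpoly set) module" where
  "Hom2 V J g = hom_module (poly_ring V) (rel_module V J g)
     (quot_ring_module (poly_ring V) (genideal (poly_ring V) (g ` J)))"

text \<open>A homomorphism \<open>h : P\<^sup>J \<rightarrow> A\<close> vanishes on \<open>R\<^sub>0\<close>, hence is constant on every coset \<open>C\<close> of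
  \<open>R\<^sub>0\<close>. Its values are cosets of \<open>I\<close>, so the union over \<open>C\<close> is the common value.\<close>

definition T2 :: "nat set \<Rightarrow> 'j set \<Rightarrow> ('j \<Rightarrow> mpoly) \<Rightarrow>
    (mpoly, (('j \<Rightarrow>\<^sub>0 mpoly) set \<Rightarrow> mpoly set) set) module" where
  "T2 V J g = quot_module (Hom2 V J g)
     {\<lambda>C\<in>carrier (rel_module V J g). \<Union>r\<in>C. h r | h.
        h \<in> mod_hom (poly_ring V) (free_module V J)
              (quot_ring_module (poly_ring V) (genideal (poly_ring V) (g ` J)))}"


section \<open>Stanley-Reisner rings\<close>

definition simplicial_complex :: "nat set \<Rightarrow> nat set set \<Rightarrow> bool" where
  "simplicial_complex V X \<longleftrightarrow> {} \<in> X \<and> (\<forall>f\<in>X. f \<subseteq> V) \<and> (\<forall>f\<in>X. \<forall>g. g \<subseteq> f \<longrightarrow> g \<in> X)"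

text \<open>The link is a complex on the vertex set without \<open>v\<close>. It is the void family if
  \<open>{v} \<notin> X\<close>; then \<open>{}\<close> is a nonface, so the ideal below is the unit ideal.\<close>

definition link :: "nat \<Rightarrow> nat set set \<Rightarrow> nat set set" where
  "link v X = {g \<in> X. v \<notin> g \<and> insert v g \<in> X}"

definition nonfaces :: "nat set \<Rightarrow> nat set set \<Rightarrow> nat set set" where
  "nonfaces V X = {p. p \<subseteq> V \<and> p \<notin> X}"

definition sr_ideal :: "nat set \<Rightarrow> nat set set \<Rightarrow> mpoly set" where
  "sr_ideal V X = genideal (poly_ring V) (sqfree ` nonfaces V X)"

abbreviation sr_T1 :: "nat set \<Rightarrow> nat set set \<Rightarrow> (mpoly, (mpoly \<Rightarrow> mpoly set) set) module" where
  "sr_T1 V X \<equiv> T1 V (sr_ideal V X)"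

abbreviation sr_T2 :: "nat set \<Rightarrow> nat set set \<Rightarrow>
    (mpoly, ((nat set \<Rightarrow>\<^sub>0 mpoly) set \<Rightarrow> mpoly set) set) module" where
  "sr_T2 V X \<equiv> T2 V (nonfaces V X) sqfree"

abbreviation sr_koszul :: "nat set \<Rightarrow> nat set set \<Rightarrow> (nat set \<Rightarrow>\<^sub>0 mpoly) set" where
  "sr_koszul V X \<equiv> koszul V (nonfaces V X) sqfree"

abbreviation sr_relations :: "nat set \<Rightarrow> nat set set \<Rightarrow> (nat set \<Rightarrow>\<^sub>0 mpoly) set" where
  "sr_relations V X \<equiv> relations V (nonfaces V X) sqfree"


section \<open>Gradings\<close>

text \<open>A grading is given by an additive function \<open>w\<close> on monomials: \<^const>\<open>multideg\<close> for
  the grading by exponent vectors, \<open>int \<circ> total_degree\<close> for the usual one. The basis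
  element \<open>e\<^sub>p\<close> of the free module has the degree of \<open>x\<^sup>p\<close>.\<close>

definition homog :: "(mono \<Rightarrow> 'g) \<Rightarrow> 'g \<Rightarrow> mpoly \<Rightarrow> bool" where
  "homog w d F \<longleftrightarrow> (\<forall>m\<in>Poly_Mapping.keys F. w m = d)"

definition homog_rel :: "(mono \<Rightarrow> 'g) \<Rightarrow> 'g \<Rightarrow> (nat set \<Rightarrow>\<^sub>0 mpoly) \<Rightarrow> bool" where
  "homog_rel w d r \<longleftrightarrow>
     (\<forall>p\<in>Poly_Mapping.keys r. \<forall>m\<in>Poly_Mapping.keys (Poly_Mapping.lookup r p). w (m + chi p) = d)"

definition sr_ring_part :: "nat set \<Rightarrow> nat set set \<Rightarrow> (mono \<Rightarrow> 'g) \<Rightarrow> 'g \<Rightarrow> mpoly set set" where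
  "sr_ring_part V X w d = {sr_ideal V X +>\<^bsub>poly_ring V\<^esub> F | F. F \<in> carrier (poly_ring V) \<and> homog w d F}"

definition T1_part :: "nat set \<Rightarrow> nat set set \<Rightarrow> (mono \<Rightarrow> 'g::plus) \<Rightarrow> 'g \<Rightarrow>
    (mpoly \<Rightarrow> mpoly set) set set" where
  "T1_part V X w c = {t \<in> carrier (sr_T1 V X). \<exists>\<phi>\<in>t. \<forall>d. \<forall>F\<in>sr_ideal V X.
     homog w d F \<longrightarrow> \<phi> F \<in> sr_ring_part V X w (d + c)}"

definition T2_part :: "nat set \<Rightarrow> nat set set \<Rightarrow> (mono \<Rightarrow> 'g::plus) \<Rightarrow> 'g \<Rightarrow>
    ((nat set \<Rightarrow>\<^sub>0 mpoly) set \<Rightarrow> mpoly set) set set" where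
  "T2_part V X w c = {t \<in> carrier (sr_T2 V X). \<exists>\<phi>\<in>t. \<forall>d. \<forall>r\<in>sr_relations V X.
     homog_rel w d r \<longrightarrow>
       \<phi> (sr_koszul V X +>\<^bsub>free_module V (nonfaces V X)\<^esub> r) \<in> sr_ring_part V X w (d + c)}"

definition T1_ab :: "nat set \<Rightarrow> nat set set \<Rightarrow> mono \<Rightarrow> nat set \<Rightarrow> (mpoly \<Rightarrow> mpoly set) set set" where
  "T1_ab V X a b = T1_part V X multideg (multideg a - multideg (chi b))"

definition T2_ab :: "nat set \<Rightarrow> nat set set \<Rightarrow> mono \<Rightarrow> nat set \<Rightarrow>
    ((nat set \<Rightarrow>\<^sub>0 mpoly) set \<Rightarrow> mpoly set) set set" where
  "T2_ab V X a b = T2_part V X multideg (multideg a - multideg (chi b))"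

definition T1_0 :: "nat set \<Rightarrow> nat set set \<Rightarrow> (mpoly \<Rightarrow> mpoly set) set set" where
  "T1_0 V X = T1_part V X (int \<circ> total_degree) 0"

definition T2_0 :: "nat set \<Rightarrow> nat set set \<Rightarrow> ((nat set \<Rightarrow>\<^sub>0 mpoly) set \<Rightarrow> mpoly set) set set" where
  "T2_0 V X = T2_part V X (int \<circ> total_degree) 0"

definition clinear_iso :: "(mpoly, 's, 'x) module_scheme \<Rightarrow> (mpoly, 't, 'y) module_scheme \<Rightarrow>
    's set \<Rightarrow> 't set \<Rightarrow> ('s \<Rightarrow> 't) \<Rightarrow> bool" where
  "clinear_iso M M' S S' f \<longleftrightarrow> bij_betw f S S' \<and>
     (\<forall>s\<in>S. \<forall>t\<in>S. f (s \<oplus>\<^bsub>M\<^esub> t) = f s \<oplus>\<^bsub>M'\<^esub> f t) \<and>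
     (\<forall>k. \<forall>s\<in>S. f (Const k \<odot>\<^bsub>M\<^esub> s) = Const k \<odot>\<^bsub>M'\<^esub> f s)"


section \<open>Localization\<close>

text \<open>\<open>deh v\<close> sets \<open>x\<^sub>v = 1\<close>. It maps the ideal of \<open>X\<close> onto that of \<open>link v X\<close>; hence
  it induces the map of the Stanley-Reisner rings, and the image of a coset
  under \<open>deh v\<close> is precisely the coset of the dehomogenized polynomial.\<close>

definition drop_var :: "nat \<Rightarrow> mono \<Rightarrow> mono" where
  "drop_var v m = Poly_Mapping.update v 0 m"

definition deh :: "nat \<Rightarrow> mpoly \<Rightarrow> mpoly" where
  "deh v F = (\<Sum>m\<in>Poly_Mapping.keys F. Poly_Mapping.single (drop_var v m) (Poly_Mapping.lookup F m))"

text \<open>The localization of \<open>\<phi> : I \<rightarrow> A\<close> sends \<open>F|\<^bsub>x_v=1\<^esub>\<close> to \<open>\<phi>(F)|\<^bsub>x_v=1\<^esub>\<close>. The value does not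
  depend on \<open>F\<close>: an element of \<open>I\<close> that vanishes at \<open>x\<^sub>v = 1\<close> is \<open>(x\<^sub>v - 1) G\<close> with \<open>G \<in> I\<close>.
  So the union below is over equal cosets.\<close>

definition loc1_hom :: "nat set \<Rightarrow> nat set set \<Rightarrow> nat \<Rightarrow> (mpoly \<Rightarrow> mpoly set) \<Rightarrow> mpoly \<Rightarrow> mpoly set" where
  "loc1_hom V X v \<phi> = (\<lambda>h\<in>sr_ideal (V - {v}) (link v X).
     \<Union>F\<in>{F \<in> sr_ideal V X. deh v F = h}. deh v ` \<phi> F)"

text \<open>After inverting \<open>x\<^sub>v\<close> the ideal of \<open>X\<close> is generated by the \<open>x\<^sup>p\<close> with \<open>v \<in> p \<notin> X\<close>.
  Setting \<open>x\<^sub>v = 1\<close> turns these, bijectively, into the generators \<open>x\<^bsup>p - v\<^esup>\<close>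
  of the ideal of \<open>link v X\<close>, and relations \<open>\<Sum> F\<^sub>p e\<^sub>p\<close> between them into relations
  \<open>\<Sum> F\<^sub>p|\<^bsub>x_v=1\<^esub> e\<^bsub>p-v\<^esub>\<close>. The localization of \<open>\<phi> : R/R\<^sub>0 \<rightarrow> A\<close> sends the class of the latter to
  \<open>\<phi>\<close> of the former at \<open>x\<^sub>v = 1\<close>; again this is independent of the choices.\<close>

definition deh_rel :: "nat \<Rightarrow> (nat set \<Rightarrow>\<^sub>0 mpoly) \<Rightarrow> (nat set \<Rightarrow>\<^sub>0 mpoly)" where
  "deh_rel v r = (\<Sum>p\<in>Poly_Mapping.keys r.
     Poly_Mapping.single (p - {v}) (deh v (Poly_Mapping.lookup r p)))"

definition loc2_hom :: "nat set \<Rightarrow> nat set set \<Rightarrow> nat \<Rightarrow>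
    ((nat set \<Rightarrow>\<^sub>0 mpoly) set \<Rightarrow> mpoly set) \<Rightarrow> (nat set \<Rightarrow>\<^sub>0 mpoly) set \<Rightarrow> mpoly set" where
  "loc2_hom V X v \<phi> =
     (\<lambda>C\<in>carrier (rel_module (V - {v}) (nonfaces (V - {v}) (link v X)) sqfree).
        \<Union>r\<in>{r \<in> sr_relations V X. (\<forall>p\<in>Poly_Mapping.keys r. v \<in> p) \<and> deh_rel v r \<in> C}.
          deh v ` \<phi> (sr_koszul V X +>\<^bsub>free_module V (nonfaces V X)\<^esub> r))"

text \<open>The maps on cokernels. All representatives of a class \<open>t\<close> give the same class, so these
  are again unions of equal cosets. The ring of the chart \<open>D\<^sub>+(x\<^sub>v)\<close> is the
  Stanley-Reisner ring of \<open>link v X\<close> in the variables other than \<open>x\<^sub>v\<close>.\<close>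

definition loc1 :: "nat set \<Rightarrow> nat set set \<Rightarrow> nat \<Rightarrow> (mpoly \<Rightarrow> mpoly set) set \<Rightarrow> (mpoly \<Rightarrow> mpoly set) set" where
  "loc1 V X v t = (\<Union>\<phi>\<in>t. \<zero>\<^bsub>sr_T1 (V - {v}) (link v X)\<^esub>
     +>\<^bsub>Hom1 (V - {v}) (sr_ideal (V - {v}) (link v X))\<^esub> loc1_hom V X v \<phi>)"

definition loc2 :: "nat set \<Rightarrow> nat set set \<Rightarrow> nat \<Rightarrow>
    ((nat set \<Rightarrow>\<^sub>0 mpoly) set \<Rightarrow> mpoly set) set \<Rightarrow> ((nat set \<Rightarrow>\<^sub>0 mpoly) set \<Rightarrow> mpoly set) set" where
  "loc2 V X v t = (\<Union>\<phi>\<in>t. \<zero>\<^bsub>sr_T2 (V - {v}) (link v X)\<^esub>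
     +>\<^bsub>Hom2 (V - {v}) (nonfaces (V - {v}) (link v X)) sqfree\<^esub> loc2_hom V X v \<phi>)"


section \<open>Combinatorial description\<close>

definition N :: "nat set \<Rightarrow> nat set \<Rightarrow> nat set set \<Rightarrow> nat set set" where
  "N a b Y = {f \<in> Y. a \<subseteq> f \<and> f \<inter> b = {} \<and> f \<union> b \<notin> Y}"

definition N_tilde :: "nat set \<Rightarrow> nat set \<Rightarrow> nat set set \<Rightarrow> nat set set" where
  "N_tilde a b Y = {f \<in> N a b Y. \<exists>b'. b' \<subset> b \<and> f \<union> b' \<notin> Y}"

definition N_pairs :: "nat set \<Rightarrow> nat set \<Rightarrow> nat set set \<Rightarrow> (nat set \<times> nat set) set" where
  "N_pairs a b Y = {(f, g). f \<in> N a b Y \<and> g \<in> N a b Y \<and> f \<union> g \<in> Y}"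

definition psi :: "nat set \<Rightarrow> nat \<Rightarrow> nat set \<Rightarrow> nat set" where
  "psi b v g = g \<union> ({v} - b)"

definition represents1 :: "nat set \<Rightarrow> nat set set \<Rightarrow> mono \<Rightarrow> nat set \<Rightarrow>
    (nat set \<Rightarrow> complex) \<Rightarrow> (mpoly \<Rightarrow> mpoly set) set \<Rightarrow> bool" where
  "represents1 V Y a b \<mu> t \<longleftrightarrow>
     (\<forall>f\<in>N_tilde (Poly_Mapping.keys a) b Y. \<mu> f = 0) \<and>
     (\<forall>(f, g)\<in>N_pairs (Poly_Mapping.keys a) b Y. \<mu> f = \<mu> g) \<and>
     t \<in> carrier (sr_T1 V Y) \<and>
     (\<exists>\<phi>\<in>t. \<forall>p\<in>nonfaces V Y. \<phi> (sqfree p) = sr_ideal V Y +>\<^bsub>poly_ring V\<^esub>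
        (if (p \<union> Poly_Mapping.keys a) - b \<in> Y
         then Const (\<mu> ((p \<union> Poly_Mapping.keys a) - b)) *
              xpow (multideg (chi p) + multideg a - multideg (chi b))
         else 0))"

text \<open>The relation \<open>x\<^bsup>q-p\<^esup> e\<^sub>p - x\<^bsup>p-q\<^esup> e\<^sub>q\<close>.\<close>

definition taylor :: "nat set \<Rightarrow> nat set \<Rightarrow> (nat set \<Rightarrow>\<^sub>0 mpoly)" where
  "taylor p q = Poly_Mapping.single p (sqfree (q - p)) - Poly_Mapping.single q (sqfree (p - q))"

definition represents2 :: "nat set \<Rightarrow> nat set set \<Rightarrow> mono \<Rightarrow> nat set \<Rightarrow>
    (nat set \<times> nat set \<Rightarrow> complex) \<Rightarrow> ((nat set \<Rightarrow>\<^sub>0 mpoly) set \<Rightarrow> mpoly set) set \<Rightarrow> bool" where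
  "represents2 V Y a b \<mu> t \<longleftrightarrow>
     (\<forall>(f, g)\<in>N_pairs (Poly_Mapping.keys a) b Y. \<mu> (f, g) = - \<mu> (g, f)) \<and>
     t \<in> carrier (sr_T2 V Y) \<and>
     (\<exists>\<phi>\<in>t. \<forall>p\<in>nonfaces V Y. \<forall>q\<in>nonfaces V Y.
        \<phi> (sr_koszul V Y +>\<^bsub>free_module V (nonfaces V Y)\<^esub> taylor p q) =
        sr_ideal V Y +>\<^bsub>poly_ring V\<^esub>
        (if (p \<union> q \<union> Poly_Mapping.keys a) - b \<in> Y
         then Const (\<mu> ((p \<union> Poly_Mapping.keys a) - b, (q \<union> Poly_Mapping.keys a) - b)) *
              xpow (multideg (chi (p \<union> q)) + multideg a - multideg (chi b))
         else 0))"

end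

theory Submission
  imports Defs
begin

text \<open>
The Stanley-Reisner ring \<open>A\<^sub>X\<close> has the monomials with support in \<open>X\<close> as a basis. So a homomorphism
\<open>M \<rightarrow> A\<^sub>X\<close>, where \<open>M\<close> is the ideal or the module of relations modulo the Koszul relations, is the same as an
additive map \<open>\<Phi>\<close> from \<open>M\<close> to polynomials in normal form that is linear up to reduction to the normal form
(\<open>nf_hom\<close>). Both cotangent modules are
cokernels of maps into such modules of homomorphisms, and everything is computed with
these maps \<open>\<Phi>\<close>.

Localization at \<open>v\<close> sends \<open>\<Phi>\<close> to \<open>h \<mapsto> \<Phi>(x\<^sub>v h)|\<^bsub>x_v=1\<^esub>\<close> on the ideal of the link, and similarly on
relations, with \<open>e\<^sub>p \<mapsto> e\<^bsub>p \<union> v\<^esub>\<close> in place of the multiplication by \<open>x\<^sub>v\<close> (\<open>loc1_hom_hm\<close>, \<open>loc2_hom_hm2\<close>).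
It maps derivations to derivations and coboundaries to coboundaries, and a homogeneous map of degree
\<open>a - b\<close> to one whose degree lacks the entry at \<open>v\<close>. This proves (i).

A homogeneous homomorphism of degree \<open>a - b\<close> sends \<open>x\<^sup>p\<close> to a multiple of one
monomial, with a coefficient that depends on the face \<open>(p \<union> a) - b\<close> only. The same holds for the relation of
\<open>p\<close> and \<open>q\<close>, after subtraction of a coboundary (\<open>ex_represents1\<close>, \<open>ex_represents2\<close>). Localization
evaluates on the generators \<open>p \<union> v\<close>, where \<open>p\<close> is a nonface of the link; on the faces \<open>(p \<union> a) - b\<close>
this is the map \<open>psi\<close>. This proves (ii).

For (iii), let \<open>e\<close> be the entry of \<open>a\<close> at \<open>v\<close>. If \<open>e > 0\<close>, then multiplication by \<open>x\<^sub>v\<^sup>e\<close> maps the ideal of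
the link into the ideal of \<open>X\<close>. So a homomorphism \<open>\<Phi>'\<close> over the link extends to
\<open>\<Sum>\<^sub>k x\<^sub>v\<^sup>k F\<^sub>k \<mapsto> \<Sum>\<^sub>k x\<^sub>v\<^bsup>k + e\<^esup> \<Phi>'(F\<^sub>k)\<close> over \<open>X\<close>. The localization of the extension is \<open>\<Phi>'\<close> (\<open>loc_ext\<close>). Conversely, the degree
determines the exponents of \<open>x\<^sub>v\<close> in all values of a homogeneous \<open>\<Phi>\<close>, and they are positive. So \<open>\<Phi>\<close> is
the extension of its localization on the ideal (\<open>ext_loc1\<close>), and differs from it by a
coboundary on the relations (\<open>ext_loc2\<close>). As extension also preserves derivations and coboundaries, the localization maps are bijective.
\<close>

section \<open>Polynomials and normal forms\<close>

abbreviation lookup where "lookup \<equiv> Poly_Mapping.lookup"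
abbreviation keys where "keys \<equiv> Poly_Mapping.keys"
abbreviation single where "single \<equiv> Poly_Mapping.single"

text \<open>The additive extension of a map given on the pieces \<open>single m c\<close>. Dehomogenization, normal
  forms, coefficients of powers of \<open>x\<^sub>v\<close> and all maps between free modules below have this shape, so
  that an identity between them needs to be checked on such pieces only (\<open>additive_eqI\<close>).\<close>

definition linext :: "('i \<Rightarrow> 'c::zero \<Rightarrow> 'b::comm_monoid_add) \<Rightarrow> ('i \<Rightarrow>\<^sub>0 'c) \<Rightarrow> 'b" where
  "linext f F = (\<Sum>m\<in>keys F. f m (lookup F m))"

lemma linext_zero [simp]: "linext f 0 = 0"
  by (simp add: linext_def)

lemma linext_single: "f m 0 = 0 \<Longrightarrow> linext f (single m c) = f m c"
  by (simp add: linext_def)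

lemma linext_add:
  assumes "\<And>m. f m 0 = 0" "\<And>m c d. f m (c + d) = f m c + f m d"
  shows "linext f (F + G) = linext f F + linext f G"
  unfolding linext_def using assms by (rule setsum_keys_plus_distrib)

lemma additive_sum_singles:
  fixes F :: "'i \<Rightarrow>\<^sub>0 'c::comm_monoid_add" and f :: "('i \<Rightarrow>\<^sub>0 'c) \<Rightarrow> 'b::comm_monoid_add"
  assumes "f 0 = 0" "\<And>F G. f (F + G) = f F + f G"
  shows "f F = (\<Sum>m\<in>keys F. f (single m (lookup F m)))"
proof -
  have "F = (\<Sum>m\<in>keys F. single m (lookup F m))"
    by (rule poly_mapping_eqI) (simp add: lookup_sum lookup_single when_def in_keys_iff sum.delta)
  moreover have "f (\<Sum>m\<in>S. g m) = (\<Sum>m\<in>S. f (g m))" if "finite S" for S and g :: "'i \<Rightarrow> _"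
    using that by induction (auto simp: assms)
  ultimately show ?thesis by (metis finite_keys)
qed

lemma sum_mem:
  assumes "0 \<in> S" "\<And>x y. x \<in> S \<Longrightarrow> y \<in> S \<Longrightarrow> x + y \<in> S" "\<And>i. i \<in> A \<Longrightarrow> f i \<in> S"
  shows "sum f A \<in> S"
  using assms(3) by (induction A rule: infinite_finite_induct) (simp_all add: assms(1,2))

lemma sum_singles: "(\<Sum>m\<in>keys F. single m (lookup F m)) = F"
  using additive_sum_singles[of "\<lambda>x. x" F] by simp

text \<open>The pieces are restricted to those that occur in \<open>F\<close>, so that hypotheses on the support of \<open>F\<close> can
  be used on them.\<close>

lemma additive_eqI:
  fixes F :: "'i \<Rightarrow>\<^sub>0 'c::comm_monoid_add" and f :: "('i \<Rightarrow>\<^sub>0 'c) \<Rightarrow> 'b::comm_monoid_add"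
  assumes "f 0 = 0" "\<And>F G. f (F + G) = f F + f G" "g 0 = 0" "\<And>F G. g (F + G) = g F + g G"
    and "\<And>m. m \<in> keys F \<Longrightarrow> f (single m (lookup F m)) = g (single m (lookup F m))"
  shows "f F = g F"
  using additive_sum_singles[of f F] additive_sum_singles[of g F] assms by simp

lemma biadditive_eqI:
  fixes F :: "'i \<Rightarrow>\<^sub>0 'c::comm_monoid_add" and G :: "'j \<Rightarrow>\<^sub>0 'd::comm_monoid_add"
    and f :: "('i \<Rightarrow>\<^sub>0 'c) \<Rightarrow> ('j \<Rightarrow>\<^sub>0 'd) \<Rightarrow> 'b::comm_monoid_add"
  assumes "\<And>G. f 0 G = 0" "\<And>F F' G. f (F + F') G = f F G + f F' G"
    "\<And>F. f F 0 = 0" "\<And>F G G'. f F (G + G') = f F G + f F G'"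
    "\<And>G. g 0 G = 0" "\<And>F F' G. g (F + F') G = g F G + g F' G"
    "\<And>F. g F 0 = 0" "\<And>F G G'. g F (G + G') = g F G + g F G'"
    and "\<And>m n. m \<in> keys F \<Longrightarrow> n \<in> keys G \<Longrightarrow> f (single m (lookup F m)) (single n (lookup G n)) = g (single m (lookup F m)) (single n (lookup G n))"
  shows "f F G = g F G"
  apply (rule additive_eqI[where f = "\<lambda>F. f F G" and g = "\<lambda>F. g F G"])
      apply (simp_all add: assms)
  subgoal for m
    by (rule additive_eqI[where f = "\<lambda>G. f _ G" and g = "\<lambda>G. g _ G"]) (simp_all add: assms)
  done

lemma lookup_chi: "finite p \<Longrightarrow> lookup (chi p) i = (if i \<in> p then 1 else 0)"
  by (simp add: chi_def lookup_sum lookup_single when_def sum.delta)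

lemma keys_chi [simp]: "finite p \<Longrightarrow> keys (chi p) = p"
  by (auto simp: in_keys_iff lookup_chi split: if_splits)

lemma keys_mono_add [simp]: "keys (m + n) = keys m \<union> keys (n::mono)"
  by (auto simp: in_keys_iff lookup_add)

lemma lookup_drop_var [simp]: "lookup (drop_var v m) i = (if i = v then 0 else lookup m i)"
  by (simp add: drop_var_def lookup_update)

lemma keys_drop_var [simp]: "keys (drop_var v m) = keys m - {v}"
  by (auto simp: in_keys_iff split: if_splits)

lemma drop_var_add [simp]: "drop_var v (m + n) = drop_var v m + drop_var v n"
  by (rule poly_mapping_eqI) (simp add: lookup_add)

lemma drop_var_single [simp]: "drop_var v (single v k) = 0"
  by (rule poly_mapping_eqI) (simp add: lookup_single when_def)

lemma drop_var_chi: "finite p \<Longrightarrow> drop_var v (chi p) = chi (p - {v})"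
  by (rule poly_mapping_eqI) (simp add: lookup_chi)

lemma drop_var_idem: "v \<notin> keys m \<Longrightarrow> drop_var v m = m"
  by (rule poly_mapping_eqI) (simp add: in_keys_iff)

lemma drop_var_restore: "drop_var v m + single v (lookup m v) = m"
  by (rule poly_mapping_eqI) (simp add: lookup_add lookup_single when_def)

lemma chi_Un_disjoint: "finite p \<Longrightarrow> finite q \<Longrightarrow> p \<inter> q = {} \<Longrightarrow> chi p + chi q = chi (p \<union> q)"
  by (rule poly_mapping_eqI) (auto simp: lookup_add lookup_chi)

lemma chi_empty [simp]: "chi {} = 0" by (simp add: chi_def)

abbreviation P where "P V \<equiv> carrier (poly_ring V)"

lemma P_iff: "F \<in> P V \<longleftrightarrow> (\<forall>m\<in>keys F. keys m \<subseteq> V)"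
  by (simp add: poly_ring_def)

lemma poly_ring_simps [simp]:
  "F \<otimes>\<^bsub>poly_ring V\<^esub> G = F * G" "\<one>\<^bsub>poly_ring V\<^esub> = 1" "\<zero>\<^bsub>poly_ring V\<^esub> = 0" "F \<oplus>\<^bsub>poly_ring V\<^esub> G = F + G"
  by (simp_all add: poly_ring_def)

lemma P_0 [simp]: "0 \<in> P V" and P_1 [simp]: "1 \<in> P V"
  by (simp_all add: P_iff)

lemma P_single [simp]: "single m c \<in> P V \<longleftrightarrow> c = 0 \<or> keys m \<subseteq> V"
  by (auto simp: P_iff)

lemma P_add [intro, simp]: "F \<in> P V \<Longrightarrow> G \<in> P V \<Longrightarrow> F + G \<in> P V"
  unfolding P_iff using keys_add[of F G] by blast

lemma P_uminus [simp]: "- F \<in> P V \<longleftrightarrow> F \<in> P V"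
proof -
  have "keys (- F) = keys F" by (auto simp: in_keys_iff)
  then show ?thesis by (simp add: P_iff)
qed

lemma P_diff [intro, simp]: "F \<in> P V \<Longrightarrow> G \<in> P V \<Longrightarrow> F - G \<in> P V"
  using P_add[of F V "-G"] by simp

lemma P_mult [intro, simp]: "F \<in> P V \<Longrightarrow> G \<in> P V \<Longrightarrow> F * G \<in> P V"
  unfolding P_iff using keys_mult[of F G] by fastforce

lemma P_sum [intro, simp]: "(\<And>i. i \<in> S \<Longrightarrow> f i \<in> P V) \<Longrightarrow> sum f S \<in> P V"
  by (induction S rule: infinite_finite_induct) auto

lemma P_mono: "V \<subseteq> W \<Longrightarrow> F \<in> P V \<Longrightarrow> F \<in> P W" by (auto simp: P_iff)

lemma P_Const [simp]: "Const k \<in> P V" by (simp add: Const_def)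

lemma cring_poly_ring: "cring (poly_ring V)"
proof (rule cringI)
  show "abelian_group (poly_ring V)"
  proof (rule abelian_groupI)
    fix x assume x: "x \<in> P V"
    show "\<exists>y\<in>P V. y \<oplus>\<^bsub>poly_ring V\<^esub> x = \<zero>\<^bsub>poly_ring V\<^esub>" using x by (intro bexI[of _ "-x"]) auto
  qed (auto simp: algebra_simps)
  show "Group.comm_monoid (poly_ring V)"
    by (rule comm_monoidI) (auto simp: algebra_simps)
qed (auto simp: algebra_simps)

interpretation PR: cring "poly_ring V" for V by (rule cring_poly_ring)

lemma poly_ring_uminus [simp]: "F \<in> P V \<Longrightarrow> \<ominus>\<^bsub>poly_ring V\<^esub> F = - F"
  by (rule PR.minus_equality) auto

text \<open>The normal form modulo the Stanley-Reisner ideal of \<open>X\<close>: the ideal is spanned by monomials, hence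
  the monomials with support in \<open>X\<close> form a basis of the quotient. Taking normal forms turns
  congruences modulo the ideal into equations.\<close>

definition nf :: "nat set set \<Rightarrow> mpoly \<Rightarrow> mpoly" where
  "nf X = linext (\<lambda>m c. if keys m \<in> X then single m c else 0)"

text \<open>The power \<open>x\<^sub>v\<^sup>k\<close>.\<close>

definition xv :: "nat \<Rightarrow> nat \<Rightarrow> mpoly" where
  "xv v k = single (single v k) 1"

text \<open>The coefficient of \<open>x\<^sub>v\<^sup>k\<close>, a polynomial in the other variables.\<close>

definition coefv :: "nat \<Rightarrow> nat \<Rightarrow> mpoly \<Rightarrow> mpoly" where
  "coefv v k = linext (\<lambda>m c. if lookup m v = k then single (drop_var v m) c else 0)"

lemma deh_linext: "deh v = linext (\<lambda>m c. single (drop_var v m) c)"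
  by (simp add: fun_eq_iff deh_def linext_def)

lemma nf_0 [simp]: "nf X 0 = 0" by (simp add: nf_def)
lemma nf_add: "nf X (F + G) = nf X F + nf X G"
  unfolding nf_def by (rule linext_add) (auto simp: single_add)
lemma nf_single: "nf X (single m c) = (if keys m \<in> X then single m c else 0)"
  unfolding nf_def by (subst linext_single) auto

lemma deh_0 [simp]: "deh v 0 = 0" by (simp add: deh_linext)
lemma deh_add: "deh v (F + G) = deh v F + deh v G"
  unfolding deh_linext by (rule linext_add) (auto simp: single_add)
lemma deh_single [simp]: "deh v (single m c) = single (drop_var v m) c"
  unfolding deh_linext by (subst linext_single) auto

lemma coefv_0 [simp]: "coefv v k 0 = 0" by (simp add: coefv_def)
lemma coefv_add: "coefv v k (F + G) = coefv v k F + coefv v k G"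
  unfolding coefv_def by (rule linext_add) (auto simp: single_add)
lemma coefv_single: "coefv v k (single m c) = (if lookup m v = k then single (drop_var v m) c else 0)"
  unfolding coefv_def by (subst linext_single) auto

lemma additive_nf: "Modules.additive (nf X)" by unfold_locales (rule nf_add)
lemma additive_deh: "Modules.additive (deh v)" by unfold_locales (rule deh_add)
lemmas nf_diff = additive.diff[OF additive_nf] and nf_sum = additive.sum[OF additive_nf]
  and nf_minus = additive.minus[OF additive_nf]
lemmas deh_sum = additive.sum[OF additive_deh]

lemma deh_mult: "deh v (F * G) = deh v F * deh v G"
  by (rule biadditive_eqI[where f = "\<lambda>F G. deh v (F * G)" and g = "\<lambda>F G. deh v F * deh v G"])
     (auto simp: deh_add algebra_simps mult_single)

lemma lookup_nf: "lookup (nf X F) m = (if keys m \<in> X then lookup F m else 0)"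
  by (rule additive_eqI[where f = "\<lambda>F. lookup (nf X F) m"])
     (auto simp: nf_add lookup_add nf_single lookup_single when_def)

lemma keys_nf: "keys (nf X F) = {m \<in> keys F. keys m \<in> X}"
  by (auto simp: in_keys_iff lookup_nf split: if_splits)

lemma nf_nf [simp]: "nf X (nf X F) = nf X F"
  by (rule poly_mapping_eqI) (simp add: lookup_nf)

lemma nf_eq_self_iff: "nf X F = F \<longleftrightarrow> (\<forall>m\<in>keys F. keys m \<in> X)"
  by (auto simp: poly_mapping_eq_iff fun_eq_iff lookup_nf in_keys_iff)

lemma nf_eq_0_iff: "nf X F = 0 \<longleftrightarrow> (\<forall>m\<in>keys F. keys m \<notin> X)"
  by (auto simp: poly_mapping_eq_iff fun_eq_iff lookup_nf in_keys_iff)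

lemma P_nf [simp]: "F \<in> P V \<Longrightarrow> nf X F \<in> P V"
  by (auto simp: P_iff keys_nf)

definition down_closed :: "nat set set \<Rightarrow> bool" where
  "down_closed X \<longleftrightarrow> (\<forall>f\<in>X. \<forall>g. g \<subseteq> f \<longrightarrow> g \<in> X)"

lemma down_closedD: "down_closed X \<Longrightarrow> f \<in> X \<Longrightarrow> g \<subseteq> f \<Longrightarrow> g \<in> X"
  by (auto simp: down_closed_def)

lemma nf_mult_nf: assumes "down_closed X" shows "nf X (F * nf X G) = nf X (F * G)"
  by (rule biadditive_eqI[where f = "\<lambda>F G. nf X (F * nf X G)" and g = "\<lambda>F G. nf X (F * G)"])
     (auto simp: nf_add algebra_simps mult_single nf_single intro: down_closedD[OF assms])

lemma down_closed_link: "down_closed X \<Longrightarrow> down_closed (link v X)"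
  unfolding link_def down_closed_def by (auto intro: subset_insertI2) (meson insert_mono)

text \<open>Setting \<open>x\<^sub>v = 1\<close> maps the ideal of \<open>X\<close> into the ideal of the link: a set whose trace away from \<open>v\<close>
  lies in the link is a face of \<open>X\<close>.\<close>

lemma nf_deh_nf: assumes "down_closed X" shows "nf (link v X) (deh v (nf X F)) = nf (link v X) (deh v F)"
  by (rule additive_eqI[where f = "\<lambda>F. nf (link v X) (deh v (nf X F))" and g = "\<lambda>F. nf (link v X) (deh v F)"])
     (auto simp: nf_add deh_add nf_single link_def intro: down_closedD[OF assms])

lemma xv_0 [simp]: "xv v 0 = 1" by (simp add: xv_def)
lemma xv_add: "xv v (j + k) = xv v j * xv v k" by (simp add: xv_def mult_single single_add)
lemma P_xv [simp]: "v \<in> V \<Longrightarrow> xv v k \<in> P V" by (auto simp: xv_def)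
lemma deh_xv [simp]: "deh v (xv v k) = 1" by (simp add: xv_def)

lemma deh_id: "F \<in> P (V - {v}) \<Longrightarrow> deh v F = F"
  by (rule additive_eqI[where f = "deh v" and g = "\<lambda>x. x"])
    (auto simp: deh_add P_iff intro!: arg_cong2[where f = single] drop_var_idem)

lemma deh_P: assumes "F \<in> P V" shows "deh v F \<in> P (V - {v})"
  unfolding deh_def using assms by (intro P_sum) (auto simp: P_iff)

lemma coefv_P: assumes "F \<in> P V" shows "coefv v k F \<in> P (V - {v})"
  unfolding coefv_def linext_def using assms by (intro P_sum) (auto simp: P_iff)

text \<open>Conversely, multiplication by a positive power of \<open>x\<^sub>v\<close> maps the ideal of the link into the ideal
  of \<open>X\<close>. For \<open>v \<in> a\<close> this makes it possible to extend homomorphisms from the link to \<open>X\<close>.\<close>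

lemma nf_xv_nf_link:
  assumes "down_closed X" "k > 0" "F \<in> P (V - {v})"
  shows "nf X (xv v k * nf (link v X) F) = nf X (xv v k * F)"
proof (rule additive_eqI[where f = "\<lambda>F. nf X (xv v k * nf (link v X) F)" and g = "\<lambda>F. nf X (xv v k * F)"])
  fix m assume "m \<in> keys F"
  then have "v \<notin> keys m" using assms(3) by (auto simp: P_iff)
  then have "insert v (keys m) \<in> X \<Longrightarrow> keys m \<in> link v X"
    using down_closedD[OF assms(1), of "insert v (keys m)" "keys m"] by (auto simp: link_def)
  then show "nf X (xv v k * nf (link v X) (single m (lookup F m))) = nf X (xv v k * single m (lookup F m))"
    using assms(2) by (auto simp: nf_single xv_def mult_single)
qed (auto simp: nf_add algebra_simps)

lemma xv_mult_deh:
  assumes "\<And>m. m \<in> keys F \<Longrightarrow> lookup m v = k"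
  shows "xv v k * deh v F = F"
  by (rule additive_eqI[where f = "\<lambda>F. xv v k * deh v F" and g = "\<lambda>x. x"])
    (auto simp: deh_add algebra_simps xv_def mult_single assms[symmetric] drop_var_restore add.commute[of "single v _"])

section \<open>The Stanley-Reisner ideal\<close>

lemma single_eq_sqfree_mult: "single m c = single (m - chi (keys m)) c * sqfree (keys m)"
proof -
  have "m - chi (keys m) + chi (keys m) = m"
    by (rule poly_mapping_eqI) (auto simp: lookup_add lookup_minus lookup_chi in_keys_iff)
  then show ?thesis by (simp add: sqfree_def mult_single)
qed

lemma ideal_nf_zero:
  assumes "down_closed X"
  shows "ideal {F \<in> P V. nf X F = 0} (poly_ring V)"
proof (rule idealI)
  show "ring (poly_ring V)" by (rule PR.ring_axioms)
  show "subgroup {F \<in> P V. nf X F = 0} (add_monoid (poly_ring V))"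
  proof (rule PR.add.subgroupI)
    fix F assume "F \<in> {F \<in> P V. nf X F = 0}"
    then show "\<ominus>\<^bsub>poly_ring V\<^esub> F \<in> {F \<in> P V. nf X F = 0}" by (simp add: nf_minus)
  qed (auto simp: nf_add)
next
  fix F G assume "F \<in> {F \<in> P V. nf X F = 0}" "G \<in> P V"
  then show "G \<otimes>\<^bsub>poly_ring V\<^esub> F \<in> {F \<in> P V. nf X F = 0}"
      "F \<otimes>\<^bsub>poly_ring V\<^esub> G \<in> {F \<in> P V. nf X F = 0}"
    using nf_mult_nf[OF assms, of G F] by (auto simp: mult.commute)
qed

lemma sqfree_P: "finite p \<Longrightarrow> p \<subseteq> V \<Longrightarrow> sqfree p \<in> P V"
  by (simp add: sqfree_def)

lemma nf_sqfree: "finite p \<Longrightarrow> nf X (sqfree p) = (if p \<in> X then sqfree p else 0)"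
  by (simp add: sqfree_def nf_single)

lemma sqfree_nonfaces_P: "finite V \<Longrightarrow> sqfree ` nonfaces V X \<subseteq> P V"
  by (auto simp: nonfaces_def intro!: sqfree_P intro: finite_subset)

lemma ideal_sr_ideal: "finite V \<Longrightarrow> ideal (sr_ideal V X) (poly_ring V)"
  unfolding sr_ideal_def by (intro PR.genideal_ideal sqfree_nonfaces_P)

text \<open>A monomial whose support is a nonface is a multiple of the generator that belongs to its support.
  This also holds for the void family, where \<open>{}\<close> is a nonface and the ideal is the unit ideal.\<close>

lemma sr_ideal_eq:
  assumes "down_closed X" "finite V"
  shows "sr_ideal V X = {F \<in> P V. nf X F = 0}"
proof
  show "sr_ideal V X \<subseteq> {F \<in> P V. nf X F = 0}"
    unfolding sr_ideal_def
  proof (rule PR.genideal_minimal[OF ideal_nf_zero[OF assms(1)]], safe)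
    fix p assume p: "p \<in> nonfaces V X"
    then have "finite p" using assms(2) by (auto simp: nonfaces_def intro: finite_subset)
    with p show "sqfree p \<in> P V" "nf X (sqfree p) = 0"
      by (auto simp: nonfaces_def nf_sqfree intro!: sqfree_P)
  qed
next
  interpret I: ideal "sr_ideal V X" "poly_ring V" by (rule ideal_sr_ideal[OF assms(2)])
  show "{F \<in> P V. nf X F = 0} \<subseteq> sr_ideal V X"
  proof safe
    fix F assume F: "F \<in> P V" "nf X F = 0"
    have "single m (lookup F m) \<in> sr_ideal V X" if m: "m \<in> keys F" for m
    proof -
      have "keys m \<in> nonfaces V X" using F m by (auto simp: nonfaces_def P_iff nf_eq_0_iff)
      then have "sqfree (keys m) \<in> sr_ideal V X"
        unfolding sr_ideal_def using PR.genideal_self[OF sqfree_nonfaces_P[OF assms(2)]] by blast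
      moreover have "keys (m - chi (keys m)) \<subseteq> keys m"
        by (auto simp: in_keys_iff lookup_minus)
      then have "keys (m - chi (keys m)) \<subseteq> V"
        using F(1) m unfolding P_iff by blast
      ultimately show ?thesis
        using I.I_l_closed[of "sqfree (keys m)" "single (m - chi (keys m)) (lookup F m)"]
        by (subst single_eq_sqfree_mult) simp
    qed
    then have "(\<Sum>m\<in>keys F. single m (lookup F m)) \<in> sr_ideal V X"
      using I.a_closed I.zero_closed by (intro sum_mem) auto
    then show "F \<in> sr_ideal V X" by (simp add: sum_singles)
  qed
qed

section \<open>Modules of homomorphisms and maps of cokernels\<close>

lemma (in module) submoduleI2:
  assumes "H \<subseteq> carrier M" "\<zero>\<^bsub>M\<^esub> \<in> H" "\<And>a b. a \<in> H \<Longrightarrow> b \<in> H \<Longrightarrow> a \<oplus>\<^bsub>M\<^esub> b \<in> H"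
    and smult: "\<And>r x. r \<in> carrier R \<Longrightarrow> x \<in> H \<Longrightarrow> r \<odot>\<^bsub>M\<^esub> x \<in> H"
  shows "submodule H R M"
proof (rule submoduleI)
  fix a assume a: "a \<in> H"
  then have "(\<ominus> \<one>) \<odot>\<^bsub>M\<^esub> a = \<ominus>\<^bsub>M\<^esub> a" using assms(1) by (subst smult_l_minus) auto
  then show "\<ominus>\<^bsub>M\<^esub> a \<in> H" using smult[of "\<ominus> \<one>" a] a by simp
qed (use assms in auto)

lemma module_quot_ring_module:
  fixes R (structure)
  assumes "cring R" "ideal I R"
  shows "module R (quot_ring_module R I)"
proof -
  interpret R: cring R by fact
  interpret I: ideal I R by fact
  interpret Q: cring "R Quot I" by (rule I.quotient_is_cring[OF assms(1)])
  interpret h: ring_hom_ring R "R Quot I" "(+>) I" by (rule I.rcos_ring_hom_ring)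
  have ag: "abelian_group (quot_ring_module R I)"
  proof (rule abelian_groupI)
    fix x assume "x \<in> carrier (quot_ring_module R I)"
    then show "\<exists>y\<in>carrier (quot_ring_module R I). y \<oplus>\<^bsub>quot_ring_module R I\<^esub> x = \<zero>\<^bsub>quot_ring_module R I\<^esub>"
      by (auto simp: quot_ring_module_def intro!: bexI[of _ "\<ominus>\<^bsub>R Quot I\<^esub> x"] Q.l_neg)
  qed (auto simp: quot_ring_module_def Q.a_ac)
  show ?thesis
    by (rule moduleI[OF assms(1) ag])
       (auto simp: quot_ring_module_def Q.l_distr Q.r_distr Q.m_assoc)
qed

text \<open>The laws of a module for \<open>Hom(M, N)\<close> come from \<open>N\<close>; what they take from \<open>M\<close> is closure under
  addition and scalars.\<close>

locale hom_setup = N?: module R N for R (structure) and N (structure) +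
  fixes M :: "('a, 'm, 'y) module_scheme"
  assumes M_add: "x \<in> carrier M \<Longrightarrow> y \<in> carrier M \<Longrightarrow> x \<oplus>\<^bsub>M\<^esub> y \<in> carrier M"
    and M_smult: "r \<in> carrier R \<Longrightarrow> x \<in> carrier M \<Longrightarrow> r \<odot>\<^bsub>M\<^esub> x \<in> carrier M"
begin

lemma mod_homI:
  assumes "\<And>x. x \<in> carrier M \<Longrightarrow> f x \<in> carrier N"
    and "\<And>x y. x \<in> carrier M \<Longrightarrow> y \<in> carrier M \<Longrightarrow> f (x \<oplus>\<^bsub>M\<^esub> y) = f x \<oplus>\<^bsub>N\<^esub> f y"
    and "\<And>r x. r \<in> carrier R \<Longrightarrow> x \<in> carrier M \<Longrightarrow> f (r \<odot>\<^bsub>M\<^esub> x) = r \<odot>\<^bsub>N\<^esub> f x"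
  shows "(\<lambda>x\<in>carrier M. f x) \<in> mod_hom R M N"
  using assms by (auto simp: mod_hom_def M_add M_smult)

lemma mod_homD:
  assumes "f \<in> mod_hom R M N"
  shows "x \<in> carrier M \<Longrightarrow> f x \<in> carrier N"
    and "x \<in> carrier M \<Longrightarrow> y \<in> carrier M \<Longrightarrow> f (x \<oplus>\<^bsub>M\<^esub> y) = f x \<oplus>\<^bsub>N\<^esub> f y"
    and "r \<in> carrier R \<Longrightarrow> x \<in> carrier M \<Longrightarrow> f (r \<odot>\<^bsub>M\<^esub> x) = r \<odot>\<^bsub>N\<^esub> f x"
    and "f \<in> extensional (carrier M)"
  using assms by (auto simp: mod_hom_def PiE_iff)

lemma mod_hom_eqI:
  assumes "f \<in> mod_hom R M N" "g \<in> mod_hom R M N" "\<And>x. x \<in> carrier M \<Longrightarrow> f x = g x"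
  shows "f = g"
  using extensionalityI[OF mod_homD(4)[OF assms(1)] mod_homD(4)[OF assms(2)] assms(3)] .

lemma hom_simps [simp]:
  "carrier (hom_module R M N) = mod_hom R M N"
  "x \<in> carrier M \<Longrightarrow> (f \<oplus>\<^bsub>hom_module R M N\<^esub> g) x = f x \<oplus>\<^bsub>N\<^esub> g x"
  "x \<in> carrier M \<Longrightarrow> \<zero>\<^bsub>hom_module R M N\<^esub> x = \<zero>\<^bsub>N\<^esub>"
  "x \<in> carrier M \<Longrightarrow> (r \<odot>\<^bsub>hom_module R M N\<^esub> f) x = r \<odot>\<^bsub>N\<^esub> f x"
  by (simp_all add: hom_module_def)

lemma hom_add_closed:
  assumes "f \<in> mod_hom R M N" "g \<in> mod_hom R M N"
  shows "f \<oplus>\<^bsub>hom_module R M N\<^esub> g \<in> mod_hom R M N"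
  unfolding hom_module_def
  by (simp, rule mod_homI) (auto simp: mod_homD[OF assms(1)] mod_homD[OF assms(2)] N.M.a_ac smult_r_distr)

lemma hom_smult_closed:
  assumes "r \<in> carrier R" "f \<in> mod_hom R M N"
  shows "r \<odot>\<^bsub>hom_module R M N\<^esub> f \<in> mod_hom R M N"
  unfolding hom_module_def
  by (simp, rule mod_homI) (auto simp: mod_homD[OF assms(2)] assms(1) smult_r_distr smult_assoc1[symmetric] R.m_comm)

lemma hom_zero_closed: "\<zero>\<^bsub>hom_module R M N\<^esub> \<in> mod_hom R M N"
  unfolding hom_module_def by (simp, rule mod_homI) auto

lemma hom_minus_closed:
  assumes "f \<in> mod_hom R M N"
  shows "(\<lambda>x\<in>carrier M. \<ominus>\<^bsub>N\<^esub> f x) \<in> mod_hom R M N"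
  by (rule mod_homI) (auto simp: mod_homD[OF assms(1)] N.M.minus_add smult_r_minus)

lemma module_hom_module: "module R (hom_module R M N)"
proof (rule moduleI)
  show "cring R" ..
  show "abelian_group (hom_module R M N)"
  proof (rule abelian_groupI, goal_cases)
    case (3 x y z) then show ?case
      by (auto intro!: mod_hom_eqI hom_add_closed simp: N.M.a_assoc mod_homD(1))
  next
    case (4 x y) then show ?case
      by (auto intro!: mod_hom_eqI hom_add_closed simp: N.M.a_comm mod_homD(1))
  next
    case (5 x) then show ?case
      by (auto intro!: mod_hom_eqI hom_add_closed hom_zero_closed simp: mod_homD(1))
  next
    case (6 x)
    then show ?case
      by (intro bexI[of _ "\<lambda>y\<in>carrier M. \<ominus>\<^bsub>N\<^esub> x y"])
        (auto intro!: mod_hom_eqI hom_add_closed hom_zero_closed hom_minus_closed simp: mod_homD(1) N.M.l_neg)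
  qed (auto simp: hom_zero_closed hom_add_closed)
qed (auto intro!: mod_hom_eqI hom_add_closed hom_smult_closed
      simp: mod_homD(1) smult_l_distr smult_r_distr smult_assoc1)

lemma hom_minus_apply:
  assumes "f \<in> mod_hom R M N" "g \<in> mod_hom R M N" "x \<in> carrier M"
  shows "(f \<ominus>\<^bsub>hom_module R M N\<^esub> g) x = f x \<ominus>\<^bsub>N\<^esub> g x"
proof -
  interpret H: module R "hom_module R M N" by (rule module_hom_module)
  have "\<ominus>\<^bsub>hom_module R M N\<^esub> g = (\<lambda>x\<in>carrier M. \<ominus>\<^bsub>N\<^esub> g x)"
    by (rule H.M.minus_equality)
      (auto intro!: mod_hom_eqI hom_add_closed hom_zero_closed hom_minus_closed simp: mod_homD(1) N.M.l_neg assms)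
  then show ?thesis using assms by (simp add: a_minus_def)
qed

end

locale quotient_module = module R M for R (structure) and M (structure) +
  fixes S assumes sub: "submodule S R M"
begin

sublocale S: abelian_subgroup S M
  by (rule abelian_subgroupI3[OF additive_subgroupI])
     (use submodule.axioms(1)[OF sub] in \<open>auto simp: M.abelian_group_axioms\<close>)

lemma S_smult: "r \<in> carrier R \<Longrightarrow> x \<in> S \<Longrightarrow> r \<odot>\<^bsub>M\<^esub> x \<in> S"
  using submodule.smult_closed[OF sub] .

lemma quot_carrier: "carrier (quot_module M S) = {S +>\<^bsub>M\<^esub> x | x. x \<in> carrier M}"
  by (auto simp: quot_module_def A_RCOSETS_def')

lemma coset_eq_iff:
  assumes "x \<in> carrier M" "y \<in> carrier M"
  shows "S +>\<^bsub>M\<^esub> x = S +>\<^bsub>M\<^esub> y \<longleftrightarrow> x \<ominus>\<^bsub>M\<^esub> y \<in> S"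
  by (metis S.a_rcos_module S.a_rcos_self S.a_repr_independence' a_minus_def assms)

lemma quot_add:
  assumes "x \<in> carrier M" "y \<in> carrier M"
  shows "(S +>\<^bsub>M\<^esub> x) \<oplus>\<^bsub>quot_module M S\<^esub> (S +>\<^bsub>M\<^esub> y) = S +>\<^bsub>M\<^esub> (x \<oplus>\<^bsub>M\<^esub> y)"
  using assms by (simp add: quot_module_def S.a_rcos_sum)

lemma coset_smult_eq:
  assumes "r \<in> carrier R" "x \<in> carrier M" "y \<in> S +>\<^bsub>M\<^esub> x"
  shows "S +>\<^bsub>M\<^esub> (r \<odot>\<^bsub>M\<^esub> y) = S +>\<^bsub>M\<^esub> (r \<odot>\<^bsub>M\<^esub> x)"
proof -
  obtain s where s: "s \<in> S" "y = s \<oplus>\<^bsub>M\<^esub> x" using assms(3) by (auto simp: a_r_coset_def')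
  have "r \<odot>\<^bsub>M\<^esub> y = (r \<odot>\<^bsub>M\<^esub> s) \<oplus>\<^bsub>M\<^esub> (r \<odot>\<^bsub>M\<^esub> x)" using s assms by (simp add: smult_r_distr)
  then have "r \<odot>\<^bsub>M\<^esub> y \<in> S +>\<^bsub>M\<^esub> (r \<odot>\<^bsub>M\<^esub> x)"
    using S_smult[OF assms(1) s(1)] by (auto simp: a_r_coset_def')
  then show ?thesis using S.a_repr_independence' assms by auto
qed

lemma quot_smult:
  assumes "r \<in> carrier R" "x \<in> carrier M"
  shows "r \<odot>\<^bsub>quot_module M S\<^esub> (S +>\<^bsub>M\<^esub> x) = S +>\<^bsub>M\<^esub> (r \<odot>\<^bsub>M\<^esub> x)"
proof -
  have "(\<Union>y\<in>S +>\<^bsub>M\<^esub> x. S +>\<^bsub>M\<^esub> (r \<odot>\<^bsub>M\<^esub> y)) = S +>\<^bsub>M\<^esub> (r \<odot>\<^bsub>M\<^esub> x)"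
    using coset_smult_eq[OF assms] S.a_rcos_self[OF assms(2)] by blast
  then show ?thesis by (simp add: quot_module_def)
qed

end

text \<open>A homomorphism \<open>L\<close> of groups with \<open>L(S) \<subseteq> S'\<close> and the map that it induces on cokernels. The map is
  written as a union over representatives, which is how the localization maps on \<open>T\<^sup>1\<close> and \<open>T\<^sup>2\<close>
  are given.\<close>

locale coset_map = A: quotient_module R M S + B: quotient_module R' M' S'
  for R :: "('r, 'x) ring_scheme" and M :: "('r, 'm, 'y) module_scheme" and S
    and R' :: "('r, 'x') ring_scheme" and M' :: "('r, 'n, 'y') module_scheme" and S' +
  fixes L :: "'m \<Rightarrow> 'n"
  assumes L_closed: "x \<in> carrier M \<Longrightarrow> L x \<in> carrier M'"
    and L_add: "x \<in> carrier M \<Longrightarrow> y \<in> carrier M \<Longrightarrow> L (x \<oplus>\<^bsub>M\<^esub> y) = L x \<oplus>\<^bsub>M'\<^esub> L y"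
    and L_sub: "x \<in> S \<Longrightarrow> L x \<in> S'"
begin

definition cmap :: "'m set \<Rightarrow> 'n set" where
  "cmap t = (\<Union>y\<in>t. S' +>\<^bsub>M'\<^esub> L y)"

lemma cmap_coset:
  assumes "x \<in> carrier M"
  shows "cmap (S +>\<^bsub>M\<^esub> x) = S' +>\<^bsub>M'\<^esub> L x"
proof -
  have "S' +>\<^bsub>M'\<^esub> L y = S' +>\<^bsub>M'\<^esub> L x" if y: "y \<in> S +>\<^bsub>M\<^esub> x" for y
  proof -
    obtain s where s: "s \<in> S" "y = s \<oplus>\<^bsub>M\<^esub> x" using y by (auto simp: a_r_coset_def')
    then have "L y \<in> S' +>\<^bsub>M'\<^esub> L x"
      using L_add[of s x] L_sub[of s] assms A.S.a_subset by (auto simp: a_r_coset_def')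
    then show ?thesis using B.S.a_repr_independence' L_closed assms by auto
  qed
  then show ?thesis using A.S.a_rcos_self[OF assms] unfolding cmap_def by blast
qed

lemma L_minus:
  assumes "x \<in> carrier M" "y \<in> carrier M"
  shows "L (x \<ominus>\<^bsub>M\<^esub> y) = L x \<ominus>\<^bsub>M'\<^esub> L y"
proof -
  have "L (x \<ominus>\<^bsub>M\<^esub> y) \<oplus>\<^bsub>M'\<^esub> L y = L x"
    using assms by (subst L_add[symmetric]) (auto simp: a_minus_def A.M.a_assoc A.M.l_neg)
  then show ?thesis
    using assms L_closed by (metis A.M.minus_closed B.M.add.inv_solve_right a_minus_def)
qed

end

lemma (in coset_map) cmap_iso:
  fixes C C'
  assumes C: "C \<subseteq> carrier M" "C' \<subseteq> carrier M'" "\<And>x y. x \<in> C \<Longrightarrow> y \<in> C \<Longrightarrow> x \<ominus>\<^bsub>M\<^esub> y \<in> C"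
    and L_C: "\<And>x. x \<in> C \<Longrightarrow> L x \<in> C'"
    and inj: "\<And>x. x \<in> C \<Longrightarrow> L x \<in> S' \<Longrightarrow> x \<in> S"
    and surj: "\<And>y. y \<in> C' \<Longrightarrow> \<exists>x\<in>C. L x = y"
  shows "bij_betw cmap {S +>\<^bsub>M\<^esub> x | x. x \<in> C} {S' +>\<^bsub>M'\<^esub> y | y. y \<in> C'}"
proof (rule bij_betwI')
  fix s t assume "s \<in> {S +>\<^bsub>M\<^esub> x | x. x \<in> C}" "t \<in> {S +>\<^bsub>M\<^esub> x | x. x \<in> C}"
  then obtain x y where xy: "s = S +>\<^bsub>M\<^esub> x" "t = S +>\<^bsub>M\<^esub> y" "x \<in> C" "y \<in> C" by auto
  then have c: "x \<in> carrier M" "y \<in> carrier M" using C by auto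
  show "cmap s = cmap t \<longleftrightarrow> s = t"
    using inj[OF C(3)[OF xy(3,4)]] c
    by (auto simp: xy cmap_coset B.coset_eq_iff A.coset_eq_iff L_closed L_minus[symmetric] L_sub)
next
  fix s assume "s \<in> {S +>\<^bsub>M\<^esub> x | x. x \<in> C}"
  then show "cmap s \<in> {S' +>\<^bsub>M'\<^esub> y | y. y \<in> C'}"
    using C L_C by (auto simp: cmap_coset subset_iff)
next
  fix t assume "t \<in> {S' +>\<^bsub>M'\<^esub> y | y. y \<in> C'}"
  then obtain x where "x \<in> C" "t = S' +>\<^bsub>M'\<^esub> L x" using surj by blast
  then show "\<exists>s\<in>{S +>\<^bsub>M\<^esub> x | x. x \<in> C}. t = cmap s"
    using C by (intro bexI[of _ "S +>\<^bsub>M\<^esub> x"]) (auto simp: cmap_coset subset_iff)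
qed

text \<open>A criterion for bijectivity on a graded piece, represented by the homogeneous elements \<open>C\<close> and
  \<open>C'\<close>: it suffices to lift elements of \<open>C'\<close> and to show that an element of \<open>C\<close> is trivial in the
  cokernel as soon as its image is.\<close>

lemma clinear_iso_cosets:
  assumes "coset_map (poly_ring V) M S (poly_ring V') M' S' L"
    and "\<And>k x. x \<in> carrier M \<Longrightarrow> L (Const k \<odot>\<^bsub>M\<^esub> x) = Const k \<odot>\<^bsub>M'\<^esub> L x"
    and "C \<subseteq> carrier M" "C' \<subseteq> carrier M'" "\<And>x y. x \<in> C \<Longrightarrow> y \<in> C \<Longrightarrow> x \<ominus>\<^bsub>M\<^esub> y \<in> C"
    and "\<And>x. x \<in> C \<Longrightarrow> L x \<in> C'"
    and "\<And>x. x \<in> C \<Longrightarrow> L x \<in> S' \<Longrightarrow> x \<in> S"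
    and "\<And>y. y \<in> C' \<Longrightarrow> \<exists>x\<in>C. L x = y"
  shows "clinear_iso (quot_module M S) (quot_module M' S') {S +>\<^bsub>M\<^esub> x | x. x \<in> C} {S' +>\<^bsub>M'\<^esub> y | y. y \<in> C'}
           (\<lambda>t. \<Union>y\<in>t. S' +>\<^bsub>M'\<^esub> L y)"
proof -
  interpret coset_map "poly_ring V" M S "poly_ring V'" M' S' L by fact
  have add: "cmap (s \<oplus>\<^bsub>quot_module M S\<^esub> t) = cmap s \<oplus>\<^bsub>quot_module M' S'\<^esub> cmap t"
    if st: "s \<in> {S +>\<^bsub>M\<^esub> x | x. x \<in> C}" "t \<in> {S +>\<^bsub>M\<^esub> x | x. x \<in> C}" for s t
  proof -
    obtain x y where xy: "s = S +>\<^bsub>M\<^esub> x" "t = S +>\<^bsub>M\<^esub> y" "x \<in> carrier M" "y \<in> carrier M"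
      using st assms(3) by auto
    show ?thesis unfolding xy(1,2) A.quot_add[OF xy(3,4)]
      by (simp add: xy(3,4) cmap_coset L_closed L_add B.quot_add)
  qed
  have smult: "cmap (Const k \<odot>\<^bsub>quot_module M S\<^esub> s) = Const k \<odot>\<^bsub>quot_module M' S'\<^esub> cmap s"
    if st: "s \<in> {S +>\<^bsub>M\<^esub> x | x. x \<in> C}" for s k
  proof -
    obtain x where xy: "s = S +>\<^bsub>M\<^esub> x" "x \<in> carrier M" using st assms(3) by auto
    show ?thesis unfolding xy(1) A.quot_smult[OF P_Const xy(2)]
      by (simp add: xy(2) cmap_coset L_closed assms(2) B.quot_smult)
  qed
  have eq: "(\<lambda>t. \<Union>y\<in>t. S' +>\<^bsub>M'\<^esub> L y) = cmap" by (simp add: fun_eq_iff cmap_def)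
  have bij: "bij_betw cmap {S +>\<^bsub>M\<^esub> x | x. x \<in> C} {S' +>\<^bsub>M'\<^esub> y | y. y \<in> C'}"
    using assms(3-8) by (rule cmap_iso)
  show ?thesis
    unfolding eq unfolding clinear_iso_def by (intro conjI ballI allI bij add smult)
qed

section \<open>Homomorphisms into the Stanley-Reisner ring\<close>

text \<open>A homomorphism \<open>M \<rightarrow> P/I\<close> corresponds to the map \<open>\<Phi> : M \<rightarrow> P\<close> of the normal forms of its values.
  Such a map is additive, and linear up to reduction to the normal form.\<close>

definition nf_hom :: "nat set \<Rightarrow> nat set set \<Rightarrow> (mpoly, 'm, 'y) module_scheme \<Rightarrow> ('m \<Rightarrow> mpoly) \<Rightarrow> bool" where
  "nf_hom V X M \<Phi> \<longleftrightarrow>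
     (\<forall>x\<in>carrier M. \<Phi> x \<in> P V \<and> nf X (\<Phi> x) = \<Phi> x) \<and>
     (\<forall>x\<in>carrier M. \<forall>y\<in>carrier M. \<Phi> (x \<oplus>\<^bsub>M\<^esub> y) = \<Phi> x + \<Phi> y) \<and>
     (\<forall>F\<in>P V. \<forall>x\<in>carrier M. \<Phi> (F \<odot>\<^bsub>M\<^esub> x) = nf X (F * \<Phi> x))"

lemma nf_homD:
  assumes "nf_hom V X M \<Phi>"
  shows "x \<in> carrier M \<Longrightarrow> \<Phi> x \<in> P V" "x \<in> carrier M \<Longrightarrow> nf X (\<Phi> x) = \<Phi> x"
    "x \<in> carrier M \<Longrightarrow> y \<in> carrier M \<Longrightarrow> \<Phi> (x \<oplus>\<^bsub>M\<^esub> y) = \<Phi> x + \<Phi> y"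
    "F \<in> P V \<Longrightarrow> x \<in> carrier M \<Longrightarrow> \<Phi> (F \<odot>\<^bsub>M\<^esub> x) = nf X (F * \<Phi> x)"
  using assms by (auto simp: nf_hom_def)

text \<open>The homomorphism into the quotient that belongs to a map of normal forms.\<close>

definition to_hom :: "nat set \<Rightarrow> nat set set \<Rightarrow> (mpoly, 'm, 'y) module_scheme \<Rightarrow> ('m \<Rightarrow> mpoly) \<Rightarrow> 'm \<Rightarrow> mpoly set" where
  "to_hom V X M \<Phi> = (\<lambda>x\<in>carrier M. sr_ideal V X +>\<^bsub>poly_ring V\<^esub> \<Phi> x)"

text \<open>The family \<open>X\<close> may be void, so that links of arbitrary \<open>v\<close> are covered.\<close>

locale stanley_reisner =
  fixes V :: "nat set" and X :: "nat set set"
  assumes finite_V: "finite V" and down: "down_closed X" and X_sub: "X \<subseteq> Pow V"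
begin

abbreviation "I \<equiv> sr_ideal V X"
abbreviation "A \<equiv> quot_ring_module (poly_ring V) I"
abbreviation "cls F \<equiv> I +>\<^bsub>poly_ring V\<^esub> F"

lemma I_iff: "F \<in> I \<longleftrightarrow> F \<in> P V \<and> nf X F = 0"
  using sr_ideal_eq[OF down finite_V] by simp

sublocale I: ideal I "poly_ring V" by (rule ideal_sr_ideal[OF finite_V])

sublocale A: module "poly_ring V" A
  by (rule module_quot_ring_module[OF cring_poly_ring ideal_sr_ideal[OF finite_V]])

lemma cls_eq_iff:
  assumes "F \<in> P V" "G \<in> P V"
  shows "cls F = cls G \<longleftrightarrow> nf X F = nf X G"
  using PR.quotient_eq_iff_same_a_r_cos[OF I.ideal_axioms assms] assms
  by (simp add: a_minus_def I_iff nf_diff)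

lemma cls_nf: "F \<in> P V \<Longrightarrow> cls (nf X F) = cls F"
  by (simp add: cls_eq_iff)

lemma carrier_A: "carrier A = {cls F | F. F \<in> P V}"
  by (auto simp: quot_ring_module_def FactRing_def A_RCOSETS_def')

lemma cls_mem [simp]: "F \<in> P V \<Longrightarrow> cls F \<in> carrier A"
  by (auto simp: carrier_A)

lemma A_zero: "\<zero>\<^bsub>A\<^esub> = cls 0"
  using I.zero_closed by (simp add: quot_ring_module_def FactRing_def I.a_rcos_const)

lemma A_add: "F \<in> P V \<Longrightarrow> G \<in> P V \<Longrightarrow> cls F \<oplus>\<^bsub>A\<^esub> cls G = cls (F + G)"
  by (simp add: quot_ring_module_def FactRing_def I.a_rcos_sum)

lemma A_smult: "F \<in> P V \<Longrightarrow> G \<in> P V \<Longrightarrow> F \<odot>\<^bsub>A\<^esub> cls G = cls (F * G)"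
  by (simp add: quot_ring_module_def FactRing_def I.rcoset_mult_add)

lemma A_minus:
  assumes "F \<in> P V" "G \<in> P V"
  shows "cls F \<ominus>\<^bsub>A\<^esub> cls G = cls (F - G)"
proof -
  have "cls F = cls (F - G) \<oplus>\<^bsub>A\<^esub> cls G" using assms by (simp add: A_add)
  then show ?thesis using assms by (simp add: a_minus_def A.M.a_assoc A.M.r_neg)
qed

lemma ex_nf: assumes "C \<in> carrier A" shows "\<exists>F\<in>P V. nf X F = F \<and> C = cls F"
proof -
  obtain F where "F \<in> P V" "C = cls F" using assms by (auto simp: carrier_A)
  then show ?thesis by (intro bexI[of _ "nf X F"]) (auto simp: cls_nf)
qed

end

locale stanley_reisner_hom = stanley_reisner V X for V X +
  fixes M :: "(mpoly, 'm, 'y) module_scheme"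
  assumes M_add: "x \<in> carrier M \<Longrightarrow> y \<in> carrier M \<Longrightarrow> x \<oplus>\<^bsub>M\<^esub> y \<in> carrier M"
    and M_smult: "r \<in> P V \<Longrightarrow> x \<in> carrier M \<Longrightarrow> r \<odot>\<^bsub>M\<^esub> x \<in> carrier M"
begin

sublocale H: hom_setup "poly_ring V" A M
  by unfold_locales (auto simp: M_add M_smult)

abbreviation "homs \<equiv> hom_module (poly_ring V) M A"
abbreviation "hm \<equiv> to_hom V X M"

lemma hm_apply: "x \<in> carrier M \<Longrightarrow> hm \<Phi> x = cls (\<Phi> x)"
  by (simp add: to_hom_def)

lemma hm_mem:
  assumes "nf_hom V X M \<Phi>"
  shows "hm \<Phi> \<in> mod_hom (poly_ring V) M A"
  unfolding to_hom_def
  by (rule H.mod_homI) (auto simp: nf_homD[OF assms] A_add A_smult cls_nf)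

text \<open>Each coset has exactly one representative in normal form; the uniqueness makes the chosen lifts
  additive.\<close>

lemma ex_lift:
  assumes f: "f \<in> mod_hom (poly_ring V) M A"
  obtains \<Phi> where "nf_hom V X M \<Phi>" "f = hm \<Phi>"
proof -
  have "\<forall>x\<in>carrier M. \<exists>F. F \<in> P V \<and> nf X F = F \<and> f x = cls F"
    using ex_nf H.mod_homD(1)[OF f] by blast
  then obtain \<Phi> where \<Phi>: "\<And>x. x \<in> carrier M \<Longrightarrow> \<Phi> x \<in> P V \<and> nf X (\<Phi> x) = \<Phi> x \<and> f x = cls (\<Phi> x)"
    by metis
  have "\<Phi> (x \<oplus>\<^bsub>M\<^esub> y) = \<Phi> x + \<Phi> y" if xy: "x \<in> carrier M" "y \<in> carrier M" for x y
  proof -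
    have "cls (\<Phi> (x \<oplus>\<^bsub>M\<^esub> y)) = cls (\<Phi> x + \<Phi> y)"
      using H.mod_homD(2)[OF f xy] \<Phi>[OF M_add[OF xy]] \<Phi>[OF xy(1)] \<Phi>[OF xy(2)] by (simp add: A_add)
    then show ?thesis
      using \<Phi>[OF M_add[OF xy]] \<Phi>[OF xy(1)] \<Phi>[OF xy(2)] by (simp add: cls_eq_iff nf_add)
  qed
  moreover have "\<Phi> (F \<odot>\<^bsub>M\<^esub> x) = nf X (F * \<Phi> x)" if x: "F \<in> P V" "x \<in> carrier M" for F x
  proof -
    have "cls (\<Phi> (F \<odot>\<^bsub>M\<^esub> x)) = cls (F * \<Phi> x)"
      using H.mod_homD(3)[OF f, of F x] \<Phi>[OF M_smult[OF x]] \<Phi>[OF x(2)] x by (simp add: A_smult)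
    then show ?thesis
      using \<Phi>[OF M_smult[OF x]] \<Phi>[OF x(2)] x by (simp add: cls_eq_iff)
  qed
  ultimately have "nf_hom V X M \<Phi>" using \<Phi> by (simp add: nf_hom_def)
  moreover have "f = hm \<Phi>"
    by (rule H.mod_hom_eqI[OF f hm_mem[OF \<open>nf_hom V X M \<Phi>\<close>]]) (simp add: hm_apply \<Phi>)
  ultimately show ?thesis using that by blast
qed

lemma hm_eq_iff:
  assumes "nf_hom V X M \<Phi>" "nf_hom V X M \<Psi>"
  shows "hm \<Phi> = hm \<Psi> \<longleftrightarrow> (\<forall>x\<in>carrier M. \<Phi> x = \<Psi> x)"
proof
  assume eq: "hm \<Phi> = hm \<Psi>"
  show "\<forall>x\<in>carrier M. \<Phi> x = \<Psi> x"
  proof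
    fix x assume x: "x \<in> carrier M"
    have "cls (\<Phi> x) = cls (\<Psi> x)" using fun_cong[OF eq, of x] by (simp add: hm_apply x)
    then show "\<Phi> x = \<Psi> x" using nf_homD[OF assms(1)] nf_homD[OF assms(2)] x by (simp add: cls_eq_iff)
  qed
qed (auto simp: to_hom_def intro: restrict_ext)

lemma nf_hom_add:
  assumes "nf_hom V X M \<Phi>" "nf_hom V X M \<Psi>"
  shows "nf_hom V X M (\<lambda>x. \<Phi> x + \<Psi> x)"
  using assms unfolding nf_hom_def by (auto simp: nf_add algebra_simps)

lemma nf_hom_diff:
  assumes "nf_hom V X M \<Phi>" "nf_hom V X M \<Psi>"
  shows "nf_hom V X M (\<lambda>x. \<Phi> x - \<Psi> x)"
  using assms unfolding nf_hom_def by (auto simp: nf_diff algebra_simps)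

lemma nf_hom_smult:
  assumes "nf_hom V X M \<Phi>" "F \<in> P V"
  shows "nf_hom V X M (\<lambda>x. nf X (F * \<Phi> x))"
proof -
  have "nf X (F * nf X (G * \<Phi> x)) = nf X (G * nf X (F * \<Phi> x))" for G x
    by (simp add: nf_mult_nf[OF down] mult.left_commute)
  then show ?thesis
    using assms unfolding nf_hom_def by (auto simp: nf_add algebra_simps)
qed

lemma hm_add:
  assumes "nf_hom V X M \<Phi>" "nf_hom V X M \<Psi>"
  shows "hm \<Phi> \<oplus>\<^bsub>homs\<^esub> hm \<Psi> = hm (\<lambda>x. \<Phi> x + \<Psi> x)"
  by (rule H.mod_hom_eqI)
     (use assms in \<open>auto intro!: H.hom_add_closed hm_mem nf_hom_add simp: hm_apply A_add nf_homD\<close>)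

lemma hm_diff:
  assumes "nf_hom V X M \<Phi>" "nf_hom V X M \<Psi>"
  shows "hm \<Phi> \<ominus>\<^bsub>homs\<^esub> hm \<Psi> = hm (\<lambda>x. \<Phi> x - \<Psi> x)"
proof -
  interpret Hm: module "poly_ring V" homs by (rule H.module_hom_module)
  show ?thesis
    by (rule H.mod_hom_eqI)
     (use assms Hm.M.minus_closed in \<open>auto simp: hm_mem nf_hom_diff hm_apply A_minus nf_homD H.hom_minus_apply\<close>)
qed

lemma hm_smult:
  assumes "nf_hom V X M \<Phi>" "F \<in> P V"
  shows "F \<odot>\<^bsub>homs\<^esub> hm \<Phi> = hm (\<lambda>x. nf X (F * \<Phi> x))"
  by (rule H.mod_hom_eqI)
     (use assms in \<open>auto intro!: H.hom_smult_closed hm_mem nf_hom_smult simp: hm_apply A_smult nf_homD cls_nf\<close>)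

lemma nf_hom_zero: "nf_hom V X M (\<lambda>x. 0)" by (simp add: nf_hom_def)

lemma hm_zero: "\<zero>\<^bsub>homs\<^esub> = hm (\<lambda>x. 0)"
  by (rule H.mod_hom_eqI)
     (auto intro!: H.hom_zero_closed hm_mem nf_hom_zero simp: hm_apply A_zero)

end

section \<open>Localization at a vertex and its inverse\<close>

text \<open>Modules whose addition is that of the type: the ideal, the free module on the generators, and the
  module of relations.\<close>

locale poly_module =
  fixes V :: "nat set" and M :: "(mpoly, 'm::ab_group_add, 'y) module_scheme"
  assumes add [simp]: "x \<oplus>\<^bsub>M\<^esub> y = x + y"
    and zero_mem [simp]: "0 \<in> carrier M"
    and add_mem [simp]: "x \<in> carrier M \<Longrightarrow> y \<in> carrier M \<Longrightarrow> x + y \<in> carrier M"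
    and smult_mem [simp]: "F \<in> P V \<Longrightarrow> x \<in> carrier M \<Longrightarrow> F \<odot>\<^bsub>M\<^esub> x \<in> carrier M"
    and smult_add: "F \<odot>\<^bsub>M\<^esub> (x + y) = F \<odot>\<^bsub>M\<^esub> x + F \<odot>\<^bsub>M\<^esub> y"
    and add_smult: "(F + G) \<odot>\<^bsub>M\<^esub> x = F \<odot>\<^bsub>M\<^esub> x + G \<odot>\<^bsub>M\<^esub> x"
    and mult_smult: "(F * G) \<odot>\<^bsub>M\<^esub> x = F \<odot>\<^bsub>M\<^esub> (G \<odot>\<^bsub>M\<^esub> x)"
    and one_smult [simp]: "1 \<odot>\<^bsub>M\<^esub> x = x"
begin

lemma smult_0 [simp]: "F \<odot>\<^bsub>M\<^esub> 0 = 0"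
  using smult_add[of F 0 0] by simp
lemma zero_smult [simp]: "0 \<odot>\<^bsub>M\<^esub> x = 0"
  using add_smult[of 0 0 x] by simp
lemma minus_smult: "(- F) \<odot>\<^bsub>M\<^esub> x = - (F \<odot>\<^bsub>M\<^esub> x)"
  using add_smult[of F "-F" x] by (simp add: eq_neg_iff_add_eq_0 add.commute)
lemma sum_smult: "sum f S \<odot>\<^bsub>M\<^esub> x = (\<Sum>i\<in>S. f i \<odot>\<^bsub>M\<^esub> x)"
  by (induction S rule: infinite_finite_induct) (auto simp: add_smult)
lemma uminus_mem [simp]: "x \<in> carrier M \<Longrightarrow> - x \<in> carrier M"
  using smult_mem[of "-1" x] by (simp add: minus_smult)
lemma diff_mem [simp]: "x \<in> carrier M \<Longrightarrow> y \<in> carrier M \<Longrightarrow> x - y \<in> carrier M"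
  using add_mem[of x "-y"] by simp
lemma sum_carrier [simp]: "(\<And>i. i \<in> S \<Longrightarrow> f i \<in> carrier M) \<Longrightarrow> sum f S \<in> carrier M"
  by (rule sum_mem) auto

lemma nf_hom_plus: "nf_hom V X M \<Phi> \<Longrightarrow> x \<in> carrier M \<Longrightarrow> y \<in> carrier M \<Longrightarrow> \<Phi> (x + y) = \<Phi> x + \<Phi> y"
  using nf_homD(3)[of V X M \<Phi> x y] by simp
lemma nf_hom_0: "nf_hom V X M \<Phi> \<Longrightarrow> \<Phi> 0 = 0"
  using nf_hom_plus[of X \<Phi> 0 0] by simp
lemma nf_hom_sum:
  assumes \<Phi>: "nf_hom V X M \<Phi>" and "\<And>i. i \<in> S \<Longrightarrow> f i \<in> carrier M"
  shows "\<Phi> (sum f S) = (\<Sum>i\<in>S. \<Phi> (f i))"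
  using assms(2)
  by (induction S rule: infinite_finite_induct) (auto simp: nf_hom_0[OF \<Phi>] nf_hom_plus[OF \<Phi>])
lemma nf_hom_uminus:
  assumes \<Phi>: "nf_hom V X M \<Phi>" and x: "x \<in> carrier M"
  shows "\<Phi> (- x) = - \<Phi> x"
  using nf_hom_plus[OF \<Phi> x, of "-x"] x nf_hom_0[OF \<Phi>] by (simp add: eq_neg_iff_add_eq_0 add.commute)
lemma nf_hom_minus:
  assumes \<Phi>: "nf_hom V X M \<Phi>" and "x \<in> carrier M" "y \<in> carrier M"
  shows "\<Phi> (x - y) = \<Phi> x - \<Phi> y"
  using nf_hom_plus[OF \<Phi>, of x "-y"] nf_hom_uminus[OF \<Phi>, of y] assms by simp

text \<open>Linearity needs to be checked for scalars with one term only.\<close>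

lemma nf_homI_single:
  assumes "\<And>x. x \<in> carrier M \<Longrightarrow> \<Phi> x \<in> P V" "\<And>x. x \<in> carrier M \<Longrightarrow> nf X (\<Phi> x) = \<Phi> x"
    and plus: "\<And>x y. x \<in> carrier M \<Longrightarrow> y \<in> carrier M \<Longrightarrow> \<Phi> (x + y) = \<Phi> x + \<Phi> y"
    and single: "\<And>x m c. x \<in> carrier M \<Longrightarrow> keys m \<subseteq> V \<Longrightarrow> \<Phi> (single m c \<odot>\<^bsub>M\<^esub> x) = nf X (single m c * \<Phi> x)"
  shows "nf_hom V X M \<Phi>"
proof -
  have 0: "\<Phi> 0 = 0" using plus[of 0 0] by simp
  have sum: "\<Phi> (sum f S) = (\<Sum>i\<in>S. \<Phi> (f i))" if "\<And>i. i \<in> S \<Longrightarrow> f i \<in> carrier M" for f :: "mono \<Rightarrow> 'm" and S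
    using that by (induction S rule: infinite_finite_induct) (auto simp: 0 plus)
  have "\<Phi> (F \<odot>\<^bsub>M\<^esub> x) = nf X (F * \<Phi> x)" if F: "F \<in> P V" and x: "x \<in> carrier M" for F x
  proof -
    have k: "keys m \<subseteq> V" if "m \<in> keys F" for m using F that by (auto simp: P_iff)
    have "\<Phi> (F \<odot>\<^bsub>M\<^esub> x) = \<Phi> (\<Sum>m\<in>keys F. single m (lookup F m) \<odot>\<^bsub>M\<^esub> x)"
      by (subst (1) sum_singles[symmetric]) (simp add: sum_smult)
    also have "\<dots> = (\<Sum>m\<in>keys F. nf X (single m (lookup F m) * \<Phi> x))"
      by (subst sum) (use k x in \<open>auto simp: single\<close>)
    also have "\<dots> = nf X (F * \<Phi> x)"
      by (subst (3) sum_singles[symmetric]) (simp add: nf_sum sum_distrib_right)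
    finally show ?thesis .
  qed
  then show ?thesis using assms by (simp add: nf_hom_def)
qed

end

text \<open>Homogeneity of degree \<open>a - b\<close> without negative exponents: every monomial of \<open>\<Phi> x\<close> arises from the
  degree of a term of \<open>x\<close> by adding \<open>a - b\<close>. Here \<open>deg x\<close> is the set of the degrees of the terms of
  \<open>x\<close>. This single condition implies homogeneity for the grading by exponent vectors as well as
  for the total degree.\<close>

definition shifts :: "mono \<Rightarrow> nat set \<Rightarrow> ('r, 'm, 'y) module_scheme \<Rightarrow> ('m \<Rightarrow> mono set) \<Rightarrow> ('m \<Rightarrow> mpoly) \<Rightarrow> bool" where
  "shifts a b M deg \<Phi> \<longleftrightarrow> (\<forall>x\<in>carrier M. \<forall>n\<in>keys (\<Phi> x). \<exists>d\<in>deg x. n + chi b = d + a)"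

lemma keys_minus_subset: "keys (F - G) \<subseteq> keys F \<union> keys (G :: 'i \<Rightarrow>\<^sub>0 'b::ab_group_add)"
  by (auto simp: in_keys_iff lookup_minus)

lemma shifts_diff:
  assumes "shifts a b M deg \<Phi>" "shifts a b M deg \<Psi>"
  shows "shifts a b M deg (\<lambda>x. \<Phi> x - \<Psi> x)"
  unfolding shifts_def
proof (intro ballI)
  fix x n assume x: "x \<in> carrier M" and "n \<in> keys (\<Phi> x - \<Psi> x)"
  then have "n \<in> keys (\<Phi> x) \<or> n \<in> keys (\<Psi> x)" using keys_minus_subset[of "\<Phi> x" "\<Psi> x"] by blast
  then show "\<exists>d\<in>deg x. n + chi b = d + a" using assms x by (auto simp: shifts_def)
qed

lemma keys_deh: "keys (deh v F) \<subseteq> drop_var v ` keys F"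
proof
  fix n assume "n \<in> keys (deh v F)"
  then obtain m where "m \<in> keys F" "n \<in> keys (single (drop_var v m) (lookup F m))"
    unfolding deh_def using keys_sum by fastforce
  then show "n \<in> drop_var v ` keys F" by (auto split: if_splits)
qed

lemma keys_xv_mult: "n \<in> keys (xv v k * F) \<Longrightarrow> \<exists>m\<in>keys F. n = single v k + m"
  using keys_mult[of "xv v k" F] by (auto simp: xv_def)

text \<open>The situation common to the ideal, the free module on the generators and the module of relations.
  \<open>M\<close> belongs to \<open>X\<close> and \<open>M'\<close> to the link of \<open>v\<close>. An element \<open>x\<close> of \<open>M\<close>
  has coefficients \<open>comp k x\<close> in \<open>M'\<close> with respect to the powers of \<open>x\<^sub>v\<close>, and \<open>emb\<close> embeds \<open>M'\<close>
  into the part of \<open>M\<close> of degree \<open>1\<close> in \<open>x\<^sub>v\<close>: multiplication by \<open>x\<^sub>v\<close> for the ideal,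
  and \<open>e\<^sub>p \<mapsto> e\<^bsub>p \<union> v\<^esub>\<close> for the free modules.\<close>

locale vertex_loc = stanley_reisner V X + M: poly_module V M + M': poly_module "V - {v}" M'
  for V X v and M :: "(mpoly, 'm::ab_group_add, 'y) module_scheme"
    and M' :: "(mpoly, 'k::ab_group_add, 'z) module_scheme" +
  fixes comp :: "nat \<Rightarrow> 'm \<Rightarrow> 'k" and emb :: "'k \<Rightarrow> 'm" and deg :: "'m \<Rightarrow> mono set" and deg' :: "'k \<Rightarrow> mono set"
  assumes v: "v \<in> V"
    and comp_add: "comp k (x + x1) = comp k x + comp k x1"
    and comp_mem: "x \<in> carrier M \<Longrightarrow> comp k x \<in> carrier M'"
    and comp_finite: "finite {k. comp k x \<noteq> 0}"
    and comp_smult: "comp k (single m c \<odot>\<^bsub>M\<^esub> x) =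
        (if lookup m v \<le> k then single (drop_var v m) c \<odot>\<^bsub>M'\<^esub> comp (k - lookup m v) x else 0)"
    and emb_add: "emb (y + y1) = emb y + emb y1"
    and emb_mem: "y \<in> carrier M' \<Longrightarrow> emb y \<in> carrier M"
    and emb_smult: "emb (F \<odot>\<^bsub>M'\<^esub> y) = F \<odot>\<^bsub>M\<^esub> emb y"
    and comp_emb: "y \<in> carrier M' \<Longrightarrow> comp k (emb y) = (if k = 1 then y else 0)"
    and deg_emb: "y \<in> carrier M' \<Longrightarrow> d \<in> deg (emb y) \<Longrightarrow> lookup d v = 1 \<and> drop_var v d \<in> deg' y"
    and deg_comp: "x \<in> carrier M \<Longrightarrow> d \<in> deg' (comp k x) \<Longrightarrow> d + single v k \<in> deg x"
begin

sublocale L: stanley_reisner "V - {v}" "link v X"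
  using finite_V down_closed_link[OF down] X_sub by unfold_locales (auto simp: link_def)

abbreviation "W \<equiv> V - {v}"
abbreviation "lk \<equiv> link v X"

text \<open>Localization on normal forms: \<open>\<Phi>\<close> is evaluated on a homogenization of the argument, and then
  \<open>x\<^sub>v\<close> is set to \<open>1\<close>.\<close>

definition loc :: "('m \<Rightarrow> mpoly) \<Rightarrow> 'k \<Rightarrow> mpoly" where
  "loc \<Phi> y = nf lk (deh v (\<Phi> (emb y)))"

text \<open>The inverse construction: \<open>\<Phi>'\<close> is applied to the coefficients of the powers of \<open>x\<^sub>v\<close>, and the
  result is multiplied by \<open>x\<^sub>v\<^sup>e\<close>. For \<open>e > 0\<close> this is well defined and linear, since multiplication by
  \<open>x\<^sub>v\<^sup>e\<close> maps the ideal of the link into the ideal of \<open>X\<close>.\<close>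

definition ext :: "nat \<Rightarrow> ('k \<Rightarrow> mpoly) \<Rightarrow> 'm \<Rightarrow> mpoly" where
  "ext e \<Phi>' x = nf X (\<Sum>k | comp k x \<noteq> 0. xv v (k + e) * \<Phi>' (comp k x))"

lemma emb_0 [simp]: "emb 0 = 0" using emb_add[of 0 0] by simp

lemma emb_sum: "emb (sum f S) = (\<Sum>i\<in>S. emb (f i))"
  by (induction S rule: infinite_finite_induct) (auto simp: emb_add)

lemma nf_hom_loc:
  assumes \<Phi>: "nf_hom V X M \<Phi>"
  shows "nf_hom W lk M' (loc \<Phi>)"
proof -
  have "loc \<Phi> (F \<odot>\<^bsub>M'\<^esub> y) = nf lk (F * loc \<Phi> y)" if "F \<in> P W" "y \<in> carrier M'" for F y
  proof -
    have F: "F \<in> P V" using P_mono[OF _ that(1)] by auto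
    have "loc \<Phi> (F \<odot>\<^bsub>M'\<^esub> y) = nf lk (deh v (nf X (F * \<Phi> (emb y))))"
      by (simp add: loc_def emb_smult nf_homD(4)[OF \<Phi> F emb_mem] that)
    also have "\<dots> = nf lk (F * loc \<Phi> y)"
      by (simp add: nf_deh_nf[OF down] deh_mult deh_id[OF that(1)] nf_mult_nf[OF L.down] loc_def)
    finally show ?thesis .
  qed
  then show ?thesis
    using nf_homD[OF \<Phi>] unfolding nf_hom_def
    by (auto simp: loc_def emb_add M.nf_hom_plus[OF \<Phi>] emb_mem nf_add deh_add intro!: P_nf deh_P)
qed

lemma nf_deh_smult_xv:
  assumes \<Phi>: "nf_hom V X M \<Phi>" and "x \<in> carrier M"
  shows "nf lk (deh v (\<Phi> (xv v k \<odot>\<^bsub>M\<^esub> x))) = nf lk (deh v (\<Phi> x))"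
  by (simp add: nf_homD(4)[OF \<Phi>] v assms nf_deh_nf[OF down] deh_mult)

text \<open>The localized homomorphism does not depend on the element that is chosen above \<open>y\<close>: multiplying by
  a power of \<open>x\<^sub>v\<close> does not change a value at \<open>x\<^sub>v = 1\<close>, and up to such powers \<open>x\<close> is the sum of the
  embedded coefficients. The hypothesis on \<open>x\<^sub>v x\<close> holds for all elements of the ideal, but
  for relations only if they involve no generator \<open>e\<^sub>p\<close> with \<open>v \<notin> p\<close>.\<close>

lemma nf_deh_eq_loc:
  assumes \<Phi>: "nf_hom V X M \<Phi>" and x: "x \<in> carrier M"
    and xv: "xv v 1 \<odot>\<^bsub>M\<^esub> x = (\<Sum>k | comp k x \<noteq> 0. xv v k \<odot>\<^bsub>M\<^esub> emb (comp k x))"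
    and y: "y = (\<Sum>k | comp k x \<noteq> 0. comp k x)"
  shows "nf lk (deh v (\<Phi> x)) = loc \<Phi> y"
proof -
  have m: "emb (comp k x) \<in> carrier M" "xv v k \<odot>\<^bsub>M\<^esub> emb (comp k x) \<in> carrier M" for k
    using x v by (simp_all add: emb_mem comp_mem)
  have "nf lk (deh v (\<Phi> x)) = nf lk (deh v (\<Phi> (xv v 1 \<odot>\<^bsub>M\<^esub> x)))"
    by (simp only: nf_deh_smult_xv[OF \<Phi> x])
  also have "\<dots> = (\<Sum>k | comp k x \<noteq> 0. nf lk (deh v (\<Phi> (xv v k \<odot>\<^bsub>M\<^esub> emb (comp k x)))))"
    unfolding xv by (simp add: M.nf_hom_sum[OF \<Phi>] m nf_sum deh_sum)
  also have "\<dots> = (\<Sum>k | comp k x \<noteq> 0. nf lk (deh v (\<Phi> (emb (comp k x)))))"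
    by (simp add: nf_deh_smult_xv[OF \<Phi>] m)
  also have "\<dots> = loc \<Phi> y"
    unfolding y loc_def emb_sum by (simp add: M.nf_hom_sum[OF \<Phi>] m nf_sum deh_sum)
  finally show ?thesis .
qed

lemma shifts_loc:
  assumes "shifts a b M deg \<Phi>" "finite b"
  shows "shifts (drop_var v a) (b - {v}) M' deg' (loc \<Phi>)"
  unfolding shifts_def
proof (intro ballI)
  fix y n assume y: "y \<in> carrier M'" and n: "n \<in> keys (loc \<Phi> y)"
  then obtain n0 where n0: "n0 \<in> keys (\<Phi> (emb y))" "n = drop_var v n0"
    using keys_deh by (fastforce simp: loc_def keys_nf)
  then obtain d where d: "d \<in> deg (emb y)" "n0 + chi b = d + a"
    using assms(1) emb_mem[OF y] by (auto simp: shifts_def)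
  then have "drop_var v d \<in> deg' y" using deg_emb[OF y] by auto
  moreover have "n + chi (b - {v}) = drop_var v d + drop_var v a"
    using arg_cong[OF d(2), of "drop_var v"] by (simp add: n0(2) drop_var_chi assms(2))
  ultimately show "\<exists>d\<in>deg' y. n + chi (b - {v}) = d + drop_var v a" by blast
qed

lemma ext_superset:
  assumes "finite K" "{k. comp k x \<noteq> 0} \<subseteq> K" "\<Phi>' 0 = 0"
  shows "ext e \<Phi>' x = nf X (\<Sum>k\<in>K. xv v (k + e) * \<Phi>' (comp k x))"
  unfolding ext_def by (rule arg_cong[where f = "nf X"], rule sum.mono_neutral_left) (use assms in auto)

lemma nf_hom_ext:
  assumes \<Phi>': "nf_hom W lk M' \<Phi>'" and e: "e > 0"
  shows "nf_hom V X M (ext e \<Phi>')"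
proof (rule M.nf_homI_single)
  note 0 = M'.nf_hom_0[OF \<Phi>']
  fix x assume x: "x \<in> carrier M"
  show "ext e \<Phi>' x \<in> P V"
    unfolding ext_def using P_mono[OF _ nf_homD(1)[OF \<Phi>' comp_mem[OF x]], of V] v
    by (intro P_nf P_sum P_mult P_xv) auto
  show "nf X (ext e \<Phi>' x) = ext e \<Phi>' x" by (simp add: ext_def)
next
  note 0 = M'.nf_hom_0[OF \<Phi>']
  fix x y assume x: "x \<in> carrier M" and y: "y \<in> carrier M"
  let ?K = "{k. comp k x \<noteq> 0} \<union> {k. comp k y \<noteq> 0}"
  have fin: "finite ?K" using comp_finite by simp
  show "ext e \<Phi>' (x + y) = ext e \<Phi>' x + ext e \<Phi>' y"
    by (subst (1 2 3) ext_superset[where K = ?K and \<Phi>' = \<Phi>', OF fin _ 0])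
       (auto simp: comp_add M'.nf_hom_plus[OF \<Phi>'] comp_mem x y nf_add[symmetric] sum.distrib[symmetric] algebra_simps)
next
  note 0 = M'.nf_hom_0[OF \<Phi>']
  fix x and m :: mono and c :: complex assume x: "x \<in> carrier M" and m: "keys m \<subseteq> V"
  let ?K = "{k. comp k x \<noteq> 0}" and ?j = "lookup m v" and ?c = "single (drop_var v m) c"
  have c: "?c \<in> P W" using m by auto
  have \<Phi>'P: "\<Phi>' (comp k x) \<in> P W" for k using nf_homD(1)[OF \<Phi>' comp_mem[OF x]] .
  have split: "single m c = xv v ?j * ?c"
    by (simp add: xv_def mult_single add.commute[of "single _ _"] drop_var_restore)
  have "ext e \<Phi>' (single m c \<odot>\<^bsub>M\<^esub> x) =
      nf X (\<Sum>k\<in>(\<lambda>k. k + ?j) ` ?K. xv v (k + e) * \<Phi>' (comp k (single m c \<odot>\<^bsub>M\<^esub> x)))"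
  proof (rule ext_superset[where \<Phi>' = \<Phi>', OF _ _ 0])
    show "{k. comp k (single m c \<odot>\<^bsub>M\<^esub> x) \<noteq> 0} \<subseteq> (\<lambda>k. k + ?j) ` ?K"
    proof
      fix k assume "k \<in> {k. comp k (single m c \<odot>\<^bsub>M\<^esub> x) \<noteq> 0}"
      then have "?j \<le> k" "comp (k - ?j) x \<noteq> 0" by (auto simp: comp_smult split: if_splits)
      then show "k \<in> (\<lambda>k. k + ?j) ` ?K" by (intro image_eqI[of _ _ "k - ?j"]) auto
    qed
  qed (use comp_finite in auto)
  also have "\<dots> = nf X (\<Sum>k\<in>?K. xv v (k + ?j + e) * nf lk (?c * \<Phi>' (comp k x)))"
    by (subst sum.reindex) (auto simp: comp_smult nf_homD(4)[OF \<Phi>' c comp_mem[OF x]] inj_on_def)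
  also have "\<dots> = nf X (\<Sum>k\<in>?K. xv v (k + ?j + e) * (?c * \<Phi>' (comp k x)))"
    unfolding nf_sum using e c \<Phi>'P by (intro sum.cong refl nf_xv_nf_link[where V = V] down) auto
  also have "\<dots> = nf X (single m c * (\<Sum>k\<in>?K. xv v (k + e) * \<Phi>' (comp k x)))"
    unfolding split by (simp add: xv_add sum_distrib_left algebra_simps)
  also have "\<dots> = nf X (single m c * ext e \<Phi>' x)"
    by (simp add: ext_def nf_mult_nf[OF down])
  finally show "ext e \<Phi>' (single m c \<odot>\<^bsub>M\<^esub> x) = nf X (single m c * ext e \<Phi>' x)" .
qed

lemma loc_ext:
  assumes \<Phi>': "nf_hom W lk M' \<Phi>'" and y: "y \<in> carrier M'"
  shows "loc (ext e \<Phi>') y = \<Phi>' y"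
proof -
  have "ext e \<Phi>' (emb y) = nf X (\<Sum>k\<in>{1}. xv v (k + e) * \<Phi>' (comp k (emb y)))"
    by (rule ext_superset) (auto simp: comp_emb y M'.nf_hom_0[OF \<Phi>'])
  then have "loc (ext e \<Phi>') y = nf lk (deh v (nf X (xv v (1 + e) * \<Phi>' y)))"
    by (simp add: loc_def comp_emb y)
  also have "\<dots> = \<Phi>' y"
    by (simp add: nf_deh_nf[OF down] deh_mult deh_id[OF nf_homD(1)[OF \<Phi>' y]] nf_homD(2)[OF \<Phi>' y])
  finally show ?thesis .
qed

lemma shifts_ext:
  assumes \<Phi>': "shifts (drop_var v a) b M' deg' \<Phi>'" and e: "e = lookup a v"
  shows "shifts a b M deg (ext e \<Phi>')"
  unfolding shifts_def
proof (intro ballI)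
  fix x n assume x: "x \<in> carrier M" and "n \<in> keys (ext e \<Phi>' x)"
  then have "n \<in> keys (\<Sum>k | comp k x \<noteq> 0. xv v (k + e) * \<Phi>' (comp k x))"
    by (simp add: ext_def keys_nf)
  then obtain k where "n \<in> keys (xv v (k + e) * \<Phi>' (comp k x))"
    using keys_sum by fastforce
  then obtain n' where n': "n' \<in> keys (\<Phi>' (comp k x))" "n = single v (k + e) + n'"
    using keys_xv_mult by blast
  then obtain d where d: "d \<in> deg' (comp k x)" "n' + chi b = d + drop_var v a"
    using \<Phi>' comp_mem[OF x] unfolding shifts_def by blast
  have "n + chi b = (n' + chi b) + (single v k + single v e)"
    by (simp add: n'(2) single_add ac_simps)
  also have "\<dots> = (d + single v k) + (drop_var v a + single v e)"
    unfolding d(2) by (simp add: ac_simps)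
  finally have "n + chi b = (d + single v k) + a" by (simp add: e drop_var_restore)
  then show "\<exists>d\<in>deg x. n + chi b = d + a" using deg_comp[OF x d(1)] by blast
qed

text \<open>For a homogeneous \<open>\<Phi>\<close>, the exponent of \<open>x\<^sub>v\<close> in a value on an embedded element is \<open>1 + a\<^sub>v\<close>.
  Hence nothing is lost by setting \<open>x\<^sub>v = 1\<close>: multiplication by this power of \<open>x\<^sub>v\<close> recovers the value.\<close>

lemma ext_loc:
  assumes \<Phi>: "nf_hom V X M \<Phi>" and sh: "shifts a b M deg \<Phi>" and b: "finite b" "v \<notin> b"
    and e: "e = lookup a v" and x: "x \<in> carrier M"
  shows "nf X (xv v 1 * ext e (loc \<Phi>) x) = \<Phi> (\<Sum>k | comp k x \<noteq> 0. xv v k \<odot>\<^bsub>M\<^esub> emb (comp k x))"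
proof -
  have m: "emb (comp k x) \<in> carrier M" "xv v k \<odot>\<^bsub>M\<^esub> emb (comp k x) \<in> carrier M" for k
    using x v by (simp_all add: emb_mem comp_mem)
  have *: "xv v (1 + e) * deh v (\<Phi> (emb (comp k x))) = \<Phi> (emb (comp k x))" for k
  proof (rule xv_mult_deh)
    fix n assume "n \<in> keys (\<Phi> (emb (comp k x)))"
    then obtain d where "d \<in> deg (emb (comp k x))" "n + chi b = d + a"
      using sh m unfolding shifts_def by blast
    moreover from this have "lookup n v + lookup (chi b) v = lookup d v + lookup a v"
      by (metis lookup_add)
    ultimately show "lookup n v = 1 + e"
      using deg_emb[OF comp_mem[OF x]] b e by (simp add: lookup_chi)
  qed
  have "nf X (xv v 1 * ext e (loc \<Phi>) x) =
      nf X (xv v 1 * (\<Sum>k | comp k x \<noteq> 0. xv v (k + e) * loc \<Phi> (comp k x)))"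
    by (simp add: ext_def nf_mult_nf[OF down])
  also have "\<dots> = nf X (\<Sum>k | comp k x \<noteq> 0. xv v (k + (1 + e)) * nf lk (deh v (\<Phi> (emb (comp k x)))))"
    unfolding sum_distrib_left mult.assoc[symmetric] xv_add[symmetric] by (simp add: loc_def ac_simps)
  also have "\<dots> = nf X (\<Sum>k | comp k x \<noteq> 0. xv v (k + (1 + e)) * deh v (\<Phi> (emb (comp k x))))"
    unfolding nf_sum by (intro sum.cong refl nf_xv_nf_link[where V = V] down deh_P nf_homD[OF \<Phi>] m) auto
  also have "\<dots> = nf X (\<Sum>k | comp k x \<noteq> 0. xv v k * \<Phi> (emb (comp k x)))"
    by (simp only: xv_add[of v _ "1 + e"] mult.assoc *)
  also have "\<dots> = \<Phi> (\<Sum>k | comp k x \<noteq> 0. xv v k \<odot>\<^bsub>M\<^esub> emb (comp k x))"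
    by (simp add: M.nf_hom_sum[OF \<Phi>] m nf_homD(4)[OF \<Phi>] v nf_sum)
  finally show ?thesis .
qed

lemma shifts_v:
  assumes "shifts a b M deg \<Phi>" "finite b" "v \<notin> b" "v \<in> keys a" "x \<in> carrier M" "n \<in> keys (\<Phi> x)"
  shows "v \<in> keys n"
proof -
  obtain d where "n + chi b = d + a" using assms by (auto simp: shifts_def)
  then have "v \<in> keys n \<union> b" using assms(2,4) by (metis UnCI keys_chi keys_mono_add)
  then show ?thesis using assms(3) by simp
qed

end

lemma xv_mult_inj: "xv v k * F = xv v k * G \<Longrightarrow> F = G"
  by (metis lookup_zero mult_left_cancel xv_def zero_neq_one lookup_single_eq)

text \<open>If \<open>v\<close> is contained in the support of a monomial, then multiplication by \<open>x\<^sub>v\<close> does not change the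
  support; so \<open>x\<^sub>v\<close> can be cancelled from an equation of normal forms of this kind.\<close>

lemma nf_xv_cancel:
  assumes "nf X (xv v 1 * F) = nf X (xv v 1 * G)" "nf X F = F" "nf X G = G"
    and "\<And>n. n \<in> keys F \<Longrightarrow> v \<in> keys n" "\<And>n. n \<in> keys G \<Longrightarrow> v \<in> keys n"
  shows "F = G"
proof -
  have *: "nf X (xv v 1 * F) = xv v 1 * F" if nfF: "nf X F = F" and v: "\<And>n. n \<in> keys F \<Longrightarrow> v \<in> keys n" for F
  proof -
    have "keys n \<in> X" if n: "n \<in> keys (xv v 1 * F)" for n
    proof -
      obtain m where "m \<in> keys F" "n = single v 1 + m" using keys_xv_mult[OF n] by blast
      moreover from this have "keys n = keys m" using v[of m] by auto
      ultimately show "keys n \<in> X" using nfF by (simp add: nf_eq_self_iff)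
    qed
    then show ?thesis by (simp add: nf_eq_self_iff)
  qed
  have "xv v 1 * F = nf X (xv v 1 * F)" using *[OF assms(2,4)] by (rule sym)
  also note assms(1)
  also have "nf X (xv v 1 * G) = xv v 1 * G" using *[OF assms(3,5)] .
  finally show ?thesis by (rule xv_mult_inj)
qed

section \<open>The ideal as a module graded by one variable\<close>

lemma finite_support_sum_add:
  fixes comp :: "nat \<Rightarrow> 'm::ab_group_add \<Rightarrow> 'k::ab_group_add" and g :: "nat \<Rightarrow> 'k \<Rightarrow> 'b::comm_monoid_add"
  assumes "\<And>k. comp k (x + y) = comp k x + comp k y" "finite {k. comp k x \<noteq> 0}" "finite {k. comp k y \<noteq> 0}"
    and "\<And>k. g k (comp k x + comp k y) = g k (comp k x) + g k (comp k y)" "\<And>k. g k 0 = 0"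
  shows "(\<Sum>k | comp k (x + y) \<noteq> 0. g k (comp k (x + y))) =
    (\<Sum>k | comp k x \<noteq> 0. g k (comp k x)) + (\<Sum>k | comp k y \<noteq> 0. g k (comp k y))"
proof -
  let ?K = "{k. comp k x \<noteq> 0} \<union> {k. comp k y \<noteq> 0}"
  have fin: "finite ?K" using assms by simp
  have eq: "(\<Sum>k | comp k z \<noteq> 0. g k (comp k z)) = (\<Sum>k\<in>?K. g k (comp k z))" if "z \<in> {x, y, x + y}" for z
    using that assms by (intro sum.mono_neutral_left fin) auto
  have "(\<Sum>k | comp k (x + y) \<noteq> 0. g k (comp k (x + y))) = (\<Sum>k\<in>?K. g k (comp k x + comp k y))"
    by (subst eq) (simp_all add: assms(1))
  also have "\<dots> = (\<Sum>k\<in>?K. g k (comp k x)) + (\<Sum>k\<in>?K. g k (comp k y))"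
    by (simp add: assms(4) sum.distrib)
  finally show ?thesis using eq[of x] eq[of y] by simp
qed

lemma sum_support_single:
  assumes "\<And>k. k \<noteq> j \<Longrightarrow> cf k = 0" "\<And>k. g k 0 = 0"
  shows "(\<Sum>k | cf k \<noteq> 0. g k (cf k)) = g j (cf j)"
proof (cases "cf j = 0")
  case True
  then have "cf k = 0" for k using assms(1) by (cases "k = j") auto
  then show ?thesis by (simp add: True assms)
next
  case False
  then have "{k. cf k \<noteq> 0} = {j}" using assms(1) by auto
  then show ?thesis by simp
qed

lemma keys_coefv:
  assumes "n \<in> keys (coefv v k F)"
  shows "n + single v k \<in> keys F" "v \<notin> keys n"
proof -
  obtain m where m: "m \<in> keys F" "n \<in> keys (if lookup m v = k then single (drop_var v m) (lookup F m) else 0)"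
    using assms keys_sum unfolding coefv_def linext_def by fastforce
  then have "n = drop_var v m" "lookup m v = k" by (auto split: if_splits)
  then show "n + single v k \<in> keys F" "v \<notin> keys n" using m(1) by (auto simp: drop_var_restore)
qed

lemma coefv_eq_0: "k \<notin> (\<lambda>m. lookup m v) ` keys F \<Longrightarrow> coefv v k F = 0"
  unfolding coefv_def linext_def by (rule sum.neutral) auto

lemma finite_coefv: "finite {k. coefv v k F \<noteq> 0}"
  by (rule finite_subset[of _ "(\<lambda>m. lookup m v) ` keys F"]) (use coefv_eq_0 in auto)

lemma coefv_smult:
  "coefv v k (single m c * F) =
    (if lookup m v \<le> k then single (drop_var v m) c * coefv v (k - lookup m v) F else 0)"
  by (rule additive_eqI[where f = "\<lambda>F. coefv v k (single m c * F)" and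
        g = "\<lambda>F. if lookup m v \<le> k then single (drop_var v m) c * coefv v (k - lookup m v) F else 0"])
     (auto simp: coefv_add algebra_simps mult_single coefv_single lookup_add)

lemma coefv_P_id:
  assumes F: "F \<in> P (V - {v})"
  shows "coefv v k F = (if k = 0 then F else 0)"
proof (rule additive_eqI[where f = "coefv v k" and g = "\<lambda>F. if k = 0 then F else 0"])
  fix m assume "m \<in> keys F"
  then have "v \<notin> keys m" using F by (auto simp: P_iff)
  then show "coefv v k (single m (lookup F m)) = (if k = 0 then single m (lookup F m) else 0)"
    by (auto simp: coefv_single drop_var_idem in_keys_iff)
qed (auto simp: coefv_add)

lemma coefv_xv_mult: "F \<in> P (V - {v}) \<Longrightarrow> coefv v k (xv v 1 * F) = (if k = 1 then F else 0)"
  unfolding xv_def coefv_smult by (auto simp: coefv_P_id)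

lemma deh_sum_coefv: "deh v F = (\<Sum>k | coefv v k F \<noteq> 0. coefv v k F)"
proof (rule additive_eqI[where f = "deh v" and g = "\<lambda>F. (\<Sum>k | coefv v k F \<noteq> 0. coefv v k F)"], goal_cases)
  case (4 F G) show ?case
    by (rule finite_support_sum_add[where g = "\<lambda>k x. x"]) (auto simp: coefv_add finite_coefv)
next
  case (5 m) show ?case
    by (subst sum_support_single[where j = "lookup m v" and g = "\<lambda>k x. x"]) (auto simp: coefv_single)
qed (auto simp: deh_add)

lemma sum_xv_coefv: "F = (\<Sum>k | coefv v k F \<noteq> 0. xv v k * coefv v k F)"
proof (rule additive_eqI[where f = "\<lambda>x. x" and g = "\<lambda>F. (\<Sum>k | coefv v k F \<noteq> 0. xv v k * coefv v k F)"], goal_cases)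
  case (4 F G) show ?case
    by (rule finite_support_sum_add) (auto simp: coefv_add finite_coefv algebra_simps)
next
  case (5 m) show ?case
    by (subst sum_support_single[where j = "lookup m v"])
      (auto simp: coefv_single xv_def mult_single drop_var_restore add.commute[of "single v _"])
qed auto

text \<open>The embedding of the ideal of the link into the ideal of \<open>X\<close>.\<close>

definition mult_var :: "nat \<Rightarrow> mpoly \<Rightarrow> mpoly" where "mult_var v h = xv v 1 * h"

lemma mult_var_eq: "mult_var v = (\<lambda>h. xv v 1 * h)" by (simp add: fun_eq_iff mult_var_def)

lemma keys_link_iff: "v \<notin> keys n \<Longrightarrow> down_closed X \<Longrightarrow> keys n \<in> link v X \<longleftrightarrow> insert v (keys n) \<in> X"
  using down_closedD[of X "insert v (keys n)" "keys n"] by (auto simp: link_def)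

context stanley_reisner begin

lemma I_add: "F \<in> I \<Longrightarrow> G \<in> I \<Longrightarrow> F + G \<in> I"
  by (auto simp: I_iff nf_add)

lemma I_mult: "F \<in> P V \<Longrightarrow> G \<in> I \<Longrightarrow> F * G \<in> I"
  using nf_mult_nf[OF down, of F G] by (auto simp: I_iff)

lemma I_0: "0 \<in> I" by (simp add: I_iff)

lemma poly_module_ideal: "poly_module V (ideal_module (poly_ring V) (sr_ideal V X))"
  by unfold_locales (auto simp: ideal_module_def algebra_simps I_add I_mult I_0)

lemma stanley_reisner_hom_ideal: "stanley_reisner_hom V X (ideal_module (poly_ring V) (sr_ideal V X))"
  by unfold_locales (auto simp: ideal_module_def I_add I_mult)

lemma vertex_loc_ideal:
  assumes v: "v \<in> V"
  shows "vertex_loc V X v (ideal_module (poly_ring V) (sr_ideal V X))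
     (ideal_module (poly_ring (V - {v})) (sr_ideal (V - {v}) (link v X))) (coefv v) (mult_var v) keys keys"
proof -
  interpret L: stanley_reisner "V - {v}" "link v X"
    using finite_V down_closed_link[OF down] X_sub by unfold_locales (auto simp: link_def)
  interpret M: poly_module V "ideal_module (poly_ring V) (sr_ideal V X)" by (rule poly_module_ideal)
  interpret M': poly_module "V - {v}" "ideal_module (poly_ring (V - {v})) (sr_ideal (V - {v}) (link v X))"
    by (rule L.poly_module_ideal)
  have [simp]: "F \<odot>\<^bsub>ideal_module (poly_ring U) Y\<^esub> G = F * G" "carrier (ideal_module (poly_ring U) Y) = Y" for U Y F G
    by (simp_all add: ideal_module_def)
  show ?thesis unfolding mult_var_eq
  proof (unfold_locales, goal_cases)
    case (3 x k)
    then have x: "x \<in> P V" "nf X x = 0" by (auto simp: I_iff)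
    have "keys n \<notin> link v X" if n: "n \<in> keys (coefv v k x)" for n
    proof
      assume "keys n \<in> link v X"
      then have "insert v (keys n) \<in> X" using keys_link_iff[OF keys_coefv(2)[OF n] down] by simp
      then have "keys (n + single v k) \<in> X" by (rule down_closedD[OF down]) auto
      then show False using keys_coefv(1)[OF n] x(2) by (auto simp: nf_eq_0_iff)
    qed
    then show ?case using coefv_P[OF x(1)] by (auto simp: L.I_iff nf_eq_0_iff)
  next
    case (7 y)
    then have y: "y \<in> P (V - {v})" "nf (link v X) y = 0" by (auto simp: L.I_iff)
    have "keys n \<notin> X" if n: "n \<in> keys (xv v 1 * y)" for n
    proof -
      obtain m where m: "m \<in> keys y" "n = single v 1 + m" using keys_xv_mult[OF n] by blast
      then have "v \<notin> keys m" "keys m \<notin> link v X" using y by (auto simp: P_iff nf_eq_0_iff)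
      then show ?thesis using m keys_link_iff[OF _ down] by auto
    qed
    then show ?case using P_mono[OF _ y(1), of V] v by (auto simp: I_iff nf_eq_0_iff)
  next
    case (9 y k) then show ?case using coefv_xv_mult[of y V v k] by (simp add: L.I_iff)
  next
    case (10 y d)
    then have y: "y \<in> P (V - {v})" by (auto simp: L.I_iff)
    obtain m where m: "m \<in> keys y" "d = single v 1 + m" using keys_xv_mult[OF 10(2)] by blast
    moreover have "v \<notin> keys m" using m(1) y by (auto simp: P_iff)
    ultimately show ?case by (simp add: lookup_add in_keys_iff drop_var_idem)
  next
    case (11 x d k) then show ?case using keys_coefv(1) by blast
  qed (use v in \<open>auto simp: coefv_add finite_coefv coefv_smult distrib_left mult.left_commute\<close>)
qed

text \<open>The image of the ideal of \<open>X\<close> under \<open>x\<^sub>v = 1\<close> is the whole ideal of the link, because \<open>h\<close> is the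
  image of \<open>x\<^sub>v h\<close>. So the image of a coset is again a coset, and not merely contained in one.\<close>

lemma deh_image_cls:
  assumes v: "v \<in> V" and F: "F \<in> P V"
  shows "deh v ` cls F = sr_ideal (V - {v}) (link v X) +>\<^bsub>poly_ring (V - {v})\<^esub> deh v F"
proof -
  interpret T: vertex_loc V X v "ideal_module (poly_ring V) (sr_ideal V X)"
     "ideal_module (poly_ring (V - {v})) (sr_ideal (V - {v}) (link v X))" "coefv v" "mult_var v" keys keys
    by (rule vertex_loc_ideal[OF v])
  have "deh v ` I = sr_ideal (V - {v}) (link v X)"
  proof safe
    fix G assume "G \<in> I"
    then show "deh v G \<in> sr_ideal (V - {v}) (link v X)"
      using nf_deh_nf[OF down, of v G] by (simp add: I_iff T.L.I_iff deh_P)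
  next
    fix h assume h: "h \<in> sr_ideal (V - {v}) (link v X)"
    then have "xv v 1 * h \<in> I" using T.emb_mem[of h] by (simp add: ideal_module_def mult_var_def)
    moreover have "deh v (xv v 1 * h) = h" using h deh_id[of h V v] by (simp add: deh_mult T.L.I_iff)
    ultimately show "h \<in> deh v ` I" by (metis image_eqI)
  qed
  then show ?thesis
    by (simp add: a_r_coset_def' UNION_singleton_eq_range image_image deh_add flip: \<open>deh v ` I = _\<close>)
qed

end

section \<open>Multidegrees\<close>

lemma lookup_multideg [simp]: "lookup (multideg m) i = int (lookup m i)"
  by (simp add: multideg_def Poly_Mapping.map.rep_eq when_def)

lemma multideg_add: "multideg (m + n) = multideg m + multideg n"
  by (rule poly_mapping_eqI) (simp add: lookup_add)

lemma multideg_inj: "multideg m = multideg n \<Longrightarrow> m = n"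
  by (rule poly_mapping_eqI) (metis lookup_multideg of_nat_eq_iff)

lemma total_degree_linext: "total_degree = linext (\<lambda>_ c. c)"
  by (simp add: fun_eq_iff total_degree_def linext_def)

lemma total_degree_add: "total_degree (m + n) = total_degree m + total_degree n"
  unfolding total_degree_linext by (rule linext_add) auto

lemma total_degree_chi: "finite p \<Longrightarrow> total_degree (chi p) = card p"
  by (simp add: total_degree_def lookup_chi)

text \<open>The ideal is homogeneous: if some representative of a coset is homogeneous, then its normal form
  is.\<close>

lemma (in stanley_reisner) ring_part_iff:
  assumes "G \<in> P V" "nf X G = G"
  shows "cls G \<in> sr_ring_part V X w e \<longleftrightarrow> homog w e G"
proof
  assume "cls G \<in> sr_ring_part V X w e"
  then obtain F where F: "F \<in> P V" "homog w e F" "cls G = cls F" by (auto simp: sr_ring_part_def)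
  then have "G = nf X F" using assms by (simp add: cls_eq_iff)
  then show "homog w e G" using F(2) by (auto simp: homog_def keys_nf)
qed (use assms in \<open>auto simp: sr_ring_part_def\<close>)

lemma homog_if_shift:
  fixes w :: "mono \<Rightarrow> 'g::ab_group_add"
  assumes "\<And>m n. w (m + n) = w m + w n"
    and "\<And>n. n \<in> keys G \<Longrightarrow> \<exists>d\<in>D. n + chi b = d + a" "\<And>d. d \<in> D \<Longrightarrow> w d = e"
  shows "homog w (e + (w a - w (chi b))) G"
  unfolding homog_def
proof
  fix n assume "n \<in> keys G"
  then obtain d where "d \<in> D" "n + chi b = d + a" using assms(2) by blast
  then have "w n + w (chi b) = e + w a" using assms(1,3) by metis
  then show "w n = e + (w a - w (chi b))" by (simp add: algebra_simps)
qed

section \<open>The first cotangent module\<close>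

lemma (in quotient_module) quot_part:
  "{t \<in> carrier (quot_module M S). \<exists>x\<in>t. Q x} = {S +>\<^bsub>M\<^esub> x | x. x \<in> {x \<in> carrier M. Q x}}"
proof safe
  fix t x assume t: "t \<in> carrier (quot_module M S)" "x \<in> t" "Q x"
  then obtain y where y: "y \<in> carrier M" "t = S +>\<^bsub>M\<^esub> y" by (auto simp: quot_carrier)
  then have "x \<in> carrier M" "t = S +>\<^bsub>M\<^esub> x"
    using t(2) S.a_elemrcos_carrier S.a_repr_independence' by auto
  then show "\<exists>x. t = S +>\<^bsub>M\<^esub> x \<and> x \<in> {x \<in> carrier M. Q x}" using t(3) by blast
next
  fix x assume "x \<in> carrier M" "Q x"
  then show "S +>\<^bsub>M\<^esub> x \<in> carrier (quot_module M S)" "\<exists>x\<in>S +>\<^bsub>M\<^esub> x. Q x"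
    using S.a_rcos_self by (auto simp: quot_carrier)
qed

lemma derivationsD:
  assumes "D \<in> derivations V"
  shows "F \<in> P V \<Longrightarrow> D F \<in> P V" "F \<in> P V \<Longrightarrow> G \<in> P V \<Longrightarrow> D (F + G) = D F + D G"
    "F \<in> P V \<Longrightarrow> D (Const k * F) = Const k * D F"
    "F \<in> P V \<Longrightarrow> G \<in> P V \<Longrightarrow> D (F * G) = F * D G + G * D F"
  using assms by (auto simp: derivations_def)

lemma derivationsI:
  assumes "\<And>F. F \<in> P V \<Longrightarrow> D F \<in> P V" "\<And>F G. F \<in> P V \<Longrightarrow> G \<in> P V \<Longrightarrow> D (F + G) = D F + D G"
    "\<And>k F. F \<in> P V \<Longrightarrow> D (Const k * F) = Const k * D F"
    "\<And>F G. F \<in> P V \<Longrightarrow> G \<in> P V \<Longrightarrow> D (F * G) = F * D G + G * D F"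
  shows "(\<lambda>F\<in>P V. D F) \<in> derivations V"
  using assms by (auto simp: derivations_def)

context stanley_reisner begin

abbreviation "HI \<equiv> Hom1 V I"
abbreviation "IM \<equiv> ideal_module (poly_ring V) I"
abbreviation "der_homs \<equiv> {\<lambda>F\<in>I. cls (D F) | D. D \<in> derivations V}"

sublocale IM: poly_module V IM by (rule poly_module_ideal)
sublocale H1: stanley_reisner_hom V X IM by (rule stanley_reisner_hom_ideal)

lemma carrier_IM [simp]: "carrier IM = I" and smult_IM [simp]: "F \<odot>\<^bsub>IM\<^esub> G = F * G"
  by (simp_all add: ideal_module_def)

text \<open>For \<open>G\<close> in the ideal, the term \<open>G * D F\<close> of the Leibniz rule lies in the ideal, too. So a derivation
  induces a linear map from the ideal to the quotient.\<close>

lemma nf_hom_der: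
  assumes D: "D \<in> derivations V"
  shows "nf_hom V X IM (\<lambda>F. nf X (D F))"
proof -
  have "nf X (D (F * G)) = nf X (F * nf X (D G))" if "F \<in> P V" "G \<in> I" for F G
  proof -
    have "nf X (G * D F) = 0"
      using I_mult[of "D F" G] that derivationsD(1)[OF D] by (simp add: I_iff mult.commute)
    then show ?thesis using that by (simp add: derivationsD[OF D] I_iff nf_add nf_mult_nf[OF down])
  qed
  then show ?thesis by (auto simp: nf_hom_def I_iff derivationsD[OF D] nf_add)
qed

lemma der_hom_eq: "D \<in> derivations V \<Longrightarrow> (\<lambda>F\<in>I. cls (D F)) = H1.hm (\<lambda>F. nf X (D F))"
  unfolding to_hom_def carrier_IM by (rule restrict_ext) (simp add: I_iff cls_nf derivationsD)

lemma mem_der_homs: "f \<in> der_homs \<longleftrightarrow> (\<exists>D\<in>derivations V. f = H1.hm (\<lambda>F. nf X (D F)))"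
  unfolding mem_Collect_eq using der_hom_eq by metis

lemma hm_mem_der_homs:
  assumes "nf_hom V X IM \<Phi>"
  shows "H1.hm \<Phi> \<in> der_homs \<longleftrightarrow> (\<exists>D\<in>derivations V. \<forall>F\<in>I. \<Phi> F = nf X (D F))"
  unfolding mem_der_homs using H1.hm_eq_iff[OF assms nf_hom_der] by auto

lemma quotient_T1: "quotient_module (poly_ring V) HI der_homs"
proof -
  interpret H: module "poly_ring V" HI unfolding Hom1_def by (rule H1.H.module_hom_module)
  have "submodule der_homs (poly_ring V) HI"
  proof (rule H.submoduleI2)
    show "der_homs \<subseteq> carrier HI"
    proof
      fix f assume "f \<in> der_homs"
      then obtain D where "D \<in> derivations V" "f = H1.hm (\<lambda>F. nf X (D F))" unfolding mem_der_homs by blast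
      then show "f \<in> carrier HI" using H1.hm_mem[OF nf_hom_der] by (simp add: Hom1_def)
    qed
    have "(\<lambda>F\<in>P V. 0) \<in> derivations V" by (auto simp: derivations_def)
    then have "H1.hm (\<lambda>F. 0) \<in> der_homs"
      unfolding hm_mem_der_homs[OF H1.nf_hom_zero] by (rule bexI[rotated]) (simp add: I_iff)
    then show "\<zero>\<^bsub>HI\<^esub> \<in> der_homs" by (simp add: Hom1_def H1.hm_zero)
  next
    fix f g assume "f \<in> der_homs" "g \<in> der_homs"
    then obtain D E where D: "D \<in> derivations V" "f = H1.hm (\<lambda>F. nf X (D F))"
        and E: "E \<in> derivations V" "g = H1.hm (\<lambda>F. nf X (E F))" unfolding mem_der_homs by blast
    have "(\<lambda>F\<in>P V. D F + E F) \<in> derivations V"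
    proof (rule derivationsI, goal_cases)
      case (3 k F) then show ?case by (simp add: derivationsD(3)[OF D(1)] derivationsD(3)[OF E(1)] distrib_left)
    qed (auto simp: derivationsD(1,2,4)[OF D(1)] derivationsD(1,2,4)[OF E(1)] algebra_simps)
    then have "H1.hm (\<lambda>F. nf X (D F) + nf X (E F)) \<in> der_homs"
      unfolding hm_mem_der_homs[OF H1.nf_hom_add[OF nf_hom_der[OF D(1)] nf_hom_der[OF E(1)]]]
      by (rule bexI[rotated]) (simp add: I_iff nf_add)
    then show "f \<oplus>\<^bsub>HI\<^esub> g \<in> der_homs"
      unfolding D(2) E(2) Hom1_def H1.hm_add[OF nf_hom_der[OF D(1)] nf_hom_der[OF E(1)]] .
  next
    fix G f assume G: "G \<in> P V" and "f \<in> der_homs"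
    then obtain D where D: "D \<in> derivations V" "f = H1.hm (\<lambda>F. nf X (D F))" unfolding mem_der_homs by blast
    have "(\<lambda>F\<in>P V. G * D F) \<in> derivations V"
    proof (rule derivationsI, goal_cases)
      case (3 k F) then show ?case by (simp add: derivationsD(3)[OF D(1)] mult.left_commute)
    qed (auto simp: derivationsD(1,2,4)[OF D(1)] G algebra_simps)
    then have "H1.hm (\<lambda>F. nf X (G * nf X (D F))) \<in> der_homs"
      unfolding hm_mem_der_homs[OF H1.nf_hom_smult[OF nf_hom_der[OF D(1)] G]]
      by (rule bexI[rotated]) (simp add: I_iff nf_mult_nf[OF down])
    then show "G \<odot>\<^bsub>HI\<^esub> f \<in> der_homs"
      unfolding D(2) Hom1_def H1.hm_smult[OF nf_hom_der[OF D(1)] G] .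
  qed
  then show ?thesis by (intro quotient_module.intro quotient_module_axioms.intro H.module_axioms)
qed

text \<open>The homogeneous homomorphisms from the ideal to its quotient ring. Their classes form
  \<open>T\<^sup>1\<^bsub>a - b\<^esub>\<close>.\<close>

definition graded1 :: "mono \<Rightarrow> nat set \<Rightarrow> (mpoly \<Rightarrow> mpoly set) set" where
  "graded1 a b = {H1.hm \<Phi> | \<Phi>. nf_hom V X IM \<Phi> \<and> shifts a b IM keys \<Phi>}"

lemma single_mem_I: "F \<in> I \<Longrightarrow> m \<in> keys F \<Longrightarrow> single m (lookup F m) \<in> I"
  by (auto simp: I_iff P_iff nf_eq_0_iff)

text \<open>The ideal is spanned by monomials, so homogeneity controls the values on arbitrary elements.\<close>

lemma shifts_iff_homog:
  assumes \<Phi>: "nf_hom V X IM \<Phi>"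
  shows "shifts a b IM keys \<Phi> \<longleftrightarrow> (\<forall>d. \<forall>F\<in>I. homog multideg d F \<longrightarrow>
     H1.hm \<Phi> F \<in> sr_ring_part V X multideg (d + (multideg a - multideg (chi b))))" (is "_ \<longleftrightarrow> ?R")
proof
  assume sh: "shifts a b IM keys \<Phi>"
  show ?R
  proof (intro allI ballI impI)
    fix d F assume F: "F \<in> I" "homog multideg d F"
    have "homog multideg (d + (multideg a - multideg (chi b))) (\<Phi> F)"
      by (rule homog_if_shift[where D = "keys F"]) (use F sh in \<open>auto simp: multideg_add shifts_def homog_def\<close>)
    then show "H1.hm \<Phi> F \<in> sr_ring_part V X multideg (d + (multideg a - multideg (chi b)))"
      using F nf_homD[OF \<Phi>] by (simp add: H1.hm_apply ring_part_iff)
  qed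
next
  assume R: ?R
  show "shifts a b IM keys \<Phi>"
    unfolding shifts_def
  proof (intro ballI)
    fix F n assume F: "F \<in> carrier IM" and n: "n \<in> keys (\<Phi> F)"
    have "\<Phi> F = (\<Sum>m\<in>keys F. \<Phi> (single m (lookup F m)))"
      using F by (subst (1) sum_singles[symmetric], subst IM.nf_hom_sum[OF \<Phi>]) (auto simp: single_mem_I)
    then obtain m where m: "m \<in> keys F" "n \<in> keys (\<Phi> (single m (lookup F m)))"
      using n keys_sum by fastforce
    have I: "single m (lookup F m) \<in> I" using single_mem_I F m(1) by simp
    moreover have "homog multideg (multideg m) (single m (lookup F m))" by (simp add: homog_def)
    ultimately have "H1.hm \<Phi> (single m (lookup F m)) \<in>
        sr_ring_part V X multideg (multideg m + (multideg a - multideg (chi b)))" using R by blast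
    then have "homog multideg (multideg m + (multideg a - multideg (chi b))) (\<Phi> (single m (lookup F m)))"
      using nf_homD(1,2)[OF \<Phi>] I by (simp add: H1.hm_apply ring_part_iff)
    then have "multideg (n + chi b) = multideg (m + a)" using m(2) by (auto simp: homog_def multideg_add)
    then show "\<exists>d\<in>keys F. n + chi b = d + a" using m(1) multideg_inj by blast
  qed
qed

lemma graded1_sub: "graded1 a b \<subseteq> carrier HI"
  using H1.hm_mem by (auto simp: graded1_def Hom1_def)

lemma graded1_diff:
  assumes "f \<in> graded1 a b" "g \<in> graded1 a b" shows "f \<ominus>\<^bsub>HI\<^esub> g \<in> graded1 a b"
proof -
  obtain \<Phi> \<Psi> where *: "f = H1.hm \<Phi>" "nf_hom V X IM \<Phi>" "shifts a b IM keys \<Phi>"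
     "g = H1.hm \<Psi>" "nf_hom V X IM \<Psi>" "shifts a b IM keys \<Psi>" using assms by (auto simp: graded1_def)
  then have "f \<ominus>\<^bsub>HI\<^esub> g = H1.hm (\<lambda>F. \<Phi> F - \<Psi> F)" by (simp add: Hom1_def H1.hm_diff)
  then show ?thesis using H1.nf_hom_diff[OF *(2,5)] shifts_diff[OF *(3,6)] by (auto simp: graded1_def)
qed

lemma T1_ab_eq: "T1_ab V X a b = {der_homs +>\<^bsub>HI\<^esub> f | f. f \<in> graded1 a b}"
proof -
  interpret Q: quotient_module "poly_ring V" HI der_homs by (rule quotient_T1)
  have "graded1 a b = {f \<in> carrier HI. \<forall>d. \<forall>F\<in>I. homog multideg d F \<longrightarrow>
     f F \<in> sr_ring_part V X multideg (d + (multideg a - multideg (chi b)))}"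
  proof safe
    fix f assume "f \<in> graded1 a b"
    then show "f \<in> carrier HI" using graded1_sub by blast
    fix d F assume "F \<in> I" "homog multideg d F"
    then show "f F \<in> sr_ring_part V X multideg (d + (multideg a - multideg (chi b)))"
      using \<open>f \<in> graded1 a b\<close> shifts_iff_homog by (auto simp: graded1_def)
  next
    fix f assume f: "f \<in> carrier HI" and *: "\<forall>d. \<forall>F\<in>I. homog multideg d F \<longrightarrow>
     f F \<in> sr_ring_part V X multideg (d + (multideg a - multideg (chi b)))"
    obtain \<Phi> where \<Phi>: "nf_hom V X IM \<Phi>" "f = H1.hm \<Phi>"
      using H1.ex_lift[of f] f by (auto simp: Hom1_def)
    then show "f \<in> graded1 a b" using shifts_iff_homog[OF \<Phi>(1)] * by (auto simp: graded1_def)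
  qed
  then show ?thesis unfolding T1_ab_def T1_part_def T1_def Q.quot_part by simp
qed

lemma T1_ab_sub_T1_0:
  assumes "finite b" "total_degree a = card b"
  shows "T1_ab V X a b \<subseteq> T1_0 V X"
proof
  interpret Q: quotient_module "poly_ring V" HI der_homs by (rule quotient_T1)
  fix t assume "t \<in> T1_ab V X a b"
  then obtain \<Phi> where \<Phi>: "nf_hom V X IM \<Phi>" "shifts a b IM keys \<Phi>" "t = der_homs +>\<^bsub>HI\<^esub> H1.hm \<Phi>"
    by (auto simp: T1_ab_eq graded1_def)
  have "H1.hm \<Phi> F \<in> sr_ring_part V X (int \<circ> total_degree) d"
    if F: "F \<in> I" "homog (int \<circ> total_degree) d F" for F d
  proof -
    have "homog (int \<circ> total_degree) (d + ((int \<circ> total_degree) a - (int \<circ> total_degree) (chi b))) (\<Phi> F)"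
      by (rule homog_if_shift[where D = "keys F"]) (use F \<Phi>(2) in \<open>auto simp: total_degree_add shifts_def homog_def\<close>)
    then show ?thesis
      using F nf_homD[OF \<Phi>(1)] assms by (simp add: H1.hm_apply ring_part_iff total_degree_chi)
  qed
  moreover have "H1.hm \<Phi> \<in> carrier HI" using H1.hm_mem[OF \<Phi>(1)] by (simp add: Hom1_def)
  ultimately show "t \<in> T1_0 V X"
    unfolding T1_0_def T1_part_def T1_def Q.quot_part \<Phi>(3) by auto
qed

lemma T1_ab_sub_carrier: "T1_ab V X a b \<subseteq> carrier (sr_T1 V X)"
  by (auto simp: T1_ab_def T1_part_def)

end

section \<open>Localization of the first cotangent module\<close>

locale stanley_reisner_vertex = stanley_reisner V X for V X + fixes v assumes v: "v \<in> V"
begin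

sublocale L: stanley_reisner "V - {v}" "link v X"
  using finite_V down_closed_link[OF down] X_sub by unfold_locales (auto simp: link_def)

abbreviation "W \<equiv> V - {v}"
abbreviation "lk \<equiv> link v X"

sublocale VI: vertex_loc V X v IM L.IM "coefv v" "mult_var v" keys keys
  by (rule vertex_loc_ideal[OF v])

text \<open>The localization map of \<open>T\<^sup>1\<close> is the construction \<open>loc\<close>. Every polynomial equals the sum of its
  coefficients times powers of \<open>x\<^sub>v\<close>, so the independence of the choice applies to all elements of the ideal.\<close>

lemma loc1_hom_hm:
  assumes \<Phi>: "nf_hom V X IM \<Phi>"
  shows "loc1_hom V X v (H1.hm \<Phi>) = L.H1.hm (VI.loc \<Phi>)"
proof (rule ext)
  fix h
  show "loc1_hom V X v (H1.hm \<Phi>) h = L.H1.hm (VI.loc \<Phi>) h"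
  proof (cases "h \<in> L.I")
    case True
    have *: "deh v ` H1.hm \<Phi> F = L.cls (VI.loc \<Phi> h)" if F: "F \<in> I" "deh v F = h" for F
    proof -
      have "nf lk (deh v (\<Phi> F)) = VI.loc \<Phi> h"
      proof (rule VI.nf_deh_eq_loc[OF \<Phi>])
        show "xv v 1 \<odot>\<^bsub>IM\<^esub> F = (\<Sum>k | coefv v k F \<noteq> 0. xv v k \<odot>\<^bsub>IM\<^esub> mult_var v (coefv v k F))"
          unfolding smult_IM mult_var_def by (subst (1) sum_xv_coefv[of F v]) (simp add: sum_distrib_left mult.left_commute)
        show "h = (\<Sum>k | coefv v k F \<noteq> 0. coefv v k F)" unfolding F(2)[symmetric] by (rule deh_sum_coefv)
      qed (use F in simp)
      moreover have "\<Phi> F \<in> P V" "VI.loc \<Phi> h \<in> P W" "nf lk (VI.loc \<Phi> h) = VI.loc \<Phi> h"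
        using nf_homD(1)[OF \<Phi>] nf_homD(1,2)[OF VI.nf_hom_loc[OF \<Phi>]] F True by simp_all
      ultimately have "L.cls (deh v (\<Phi> F)) = L.cls (VI.loc \<Phi> h)"
        by (simp only: L.cls_eq_iff deh_P)
      then show ?thesis using F nf_homD(1)[OF \<Phi>, of F] by (simp add: H1.hm_apply deh_image_cls[OF v])
    qed
    have "xv v 1 * h \<in> {F \<in> I. deh v F = h}"
      using VI.emb_mem[of h] True deh_id[of h V v] by (simp add: deh_mult L.I_iff mult_var_def)
    then have "(\<Union>F\<in>{F \<in> I. deh v F = h}. deh v ` H1.hm \<Phi> F) = L.cls (VI.loc \<Phi> h)"
      by (intro SUP_eq_const) (use * in blast)+
    then show ?thesis using True by (simp add: loc1_hom_def L.H1.hm_apply)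
  qed (simp add: loc1_hom_def to_hom_def)
qed

text \<open>The derivation \<open>deh v \<circ> D\<close> represents the localization of \<open>D\<close>: in \<open>D (x\<^sub>v h) = x\<^sub>v D h + h D x\<^sub>v\<close>
  the second term vanishes modulo the ideal of the link.\<close>

lemma loc_der:
  assumes D: "D \<in> derivations V"
  obtains D' where "D' \<in> derivations W" "\<And>h. h \<in> L.I \<Longrightarrow> VI.loc (\<lambda>F. nf X (D F)) h = nf lk (D' h)"
proof
  let ?D = "\<lambda>F\<in>P W. deh v (D F)"
  have PW: "F \<in> P W \<Longrightarrow> F \<in> P V" for F using P_mono[of W V F] by blast
  show "?D \<in> derivations W"
  proof (rule derivationsI)
    fix k F assume "F \<in> P W"
    then show "deh v (D (Const k * F)) = Const k * deh v (D F)"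
      by (simp only: PW derivationsD(3)[OF D] deh_mult) (simp add: deh_id)
  qed (auto simp: PW derivationsD(1,2,4)[OF D] deh_P deh_add deh_mult deh_id)
  fix h assume h: "h \<in> L.I"
  then have h': "h \<in> P W" "h \<in> P V" using PW by (auto simp: L.I_iff)
  have "nf lk (h * deh v (D (xv v 1))) = 0"
    using L.I_mult[OF deh_P[OF derivationsD(1)[OF D P_xv[OF v]]] h] by (simp add: L.I_iff mult.commute)
  then show "VI.loc (\<lambda>F. nf X (D F)) h = nf lk (?D h)"
    using h' v by (simp add: VI.loc_def mult_var_def nf_deh_nf[OF down] derivationsD[OF D] deh_add deh_mult nf_add deh_id[OF h'(1)])
qed

text \<open>The derivation \<open>x\<^sub>v\<^sup>e D'\<close>, extended by \<open>x\<^sub>v \<mapsto> 0\<close>, represents the extension of \<open>D'\<close>.\<close>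

lemma ext_der:
  assumes D': "D' \<in> derivations W" and e: "e > 0"
  obtains D where "D \<in> derivations V" "\<And>F. F \<in> I \<Longrightarrow> VI.ext e (\<lambda>h. nf lk (D' h)) F = nf X (D F)"
proof
  \<comment> \<open>outside of \<open>V\<close> the value is set to \<open>0\<close>, so that \<open>D\<close> is additive on all polynomials\<close>
  define g where "g = (\<lambda>m c. if keys m \<subseteq> V then xv v (lookup m v + e) * D' (single (drop_var v m) c) else 0)"
  define D where "D = linext g"
  have D'0: "D' 0 = 0" using derivationsD(2)[OF D', of 0 0] by simp
  have g0: "g m 0 = 0" for m by (simp add: g_def D'0)
  have gP: "single (drop_var v m) c \<in> P W" if "keys m \<subseteq> V" for m c using that by auto
  have g_add: "g m (c + d) = g m c + g m d" for m c d
    using derivationsD(2)[OF D' gP[of m c] gP[of m d]] by (simp add: g_def single_add algebra_simps)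
  have D_add: "D (F + G) = D F + D G" for F G unfolding D_def by (rule linext_add) (auto simp: g0 g_add)
  have D0: "D 0 = 0" by (simp add: D_def)
  have D_single: "D (single m c) = g m c" for m c unfolding D_def by (simp add: linext_single g0)
  have PW: "F \<in> P W \<Longrightarrow> F \<in> P V" for F using P_mono[of W V F] by blast
  have DP: "D F \<in> P V" if "F \<in> P V" for F
    unfolding D_def linext_def
  proof (rule P_sum)
    fix m assume "m \<in> keys F"
    then have "keys m \<subseteq> V" using that by (auto simp: P_iff)
    then show "g m (lookup F m) \<in> P V"
      using v PW[OF derivationsD(1)[OF D' gP]] by (simp add: g_def)
  qed
  show "(\<lambda>F\<in>P V. D F) \<in> derivations V"
  proof (rule derivationsI)
    fix k F assume F: "F \<in> P V"
    show "D (Const k * F) = Const k * D F"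
    proof (rule additive_eqI[where f = "\<lambda>F. D (Const k * F)" and g = "\<lambda>F. Const k * D F"])
      fix m assume m: "m \<in> keys F"
      then have "keys m \<subseteq> V" using F by (auto simp: P_iff)
      then show "D (Const k * single m (lookup F m)) = Const k * D (single m (lookup F m))"
        using derivationsD(3)[OF D' gP[of m "lookup F m"], of k] by (simp add: Const_def mult_single D_single g_def algebra_simps)
    qed (auto simp: D0 D_add algebra_simps)
  next
    fix F G assume F: "F \<in> P V" and G: "G \<in> P V"
    show "D (F * G) = F * D G + G * D F"
    proof (rule biadditive_eqI[where f = "\<lambda>F G. D (F * G)" and g = "\<lambda>F G. F * D G + G * D F"])
      fix m n assume "m \<in> keys F" "n \<in> keys G"
      then have mn: "keys m \<subseteq> V" "keys n \<subseteq> V" using F G by (auto simp: P_iff)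
      let ?m = "drop_var v m" and ?n = "drop_var v n" and ?c = "lookup F m" and ?d = "lookup G n"
      have s: "single m c = xv v (lookup m v) * single (drop_var v m) c" for m c
        by (simp add: xv_def mult_single add.commute[of "single _ _"] drop_var_restore)
      have "D (single m ?c * single n ?d) = xv v (lookup m v + lookup n v + e) * D' (single ?m ?c * single ?n ?d)"
        using mn by (simp add: mult_single D_single g_def lookup_add)
      also have "\<dots> = xv v (lookup m v + lookup n v + e) *
          (single ?m ?c * D' (single ?n ?d) + single ?n ?d * D' (single ?m ?c))"
        using derivationsD(4)[OF D' gP[of m ?c] gP[of n ?d]] mn by simp
      also have "\<dots> = single m ?c * D (single n ?d) + single n ?d * D (single m ?c)"
        using mn unfolding D_single g_def unfolding s[of m ?c] s[of n ?d] by (simp add: xv_add algebra_simps)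
      finally show "D (single m ?c * single n ?d) = single m ?c * D (single n ?d) + single n ?d * D (single m ?c)" .
    qed (auto simp: D0 D_add algebra_simps)
  qed (use DP D_add in auto)
  fix F assume F: "F \<in> I"
  let ?\<Phi>' = "\<lambda>h. nf lk (D' h)"
  have \<Phi>': "nf_hom W lk L.IM ?\<Phi>'" by (rule L.nf_hom_der[OF D'])
  have "VI.ext e ?\<Phi>' F = VI.ext e ?\<Phi>' (\<Sum>m\<in>keys F. single m (lookup F m))" by (simp add: sum_singles)
  also have "\<dots> = (\<Sum>m\<in>keys F. VI.ext e ?\<Phi>' (single m (lookup F m)))"
    by (rule IM.nf_hom_sum[OF VI.nf_hom_ext[OF \<Phi>' e]]) (simp add: single_mem_I F)
  also have "\<dots> = (\<Sum>m\<in>keys F. nf X (D (single m (lookup F m))))"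
  proof (rule sum.cong[OF refl])
    fix m assume m: "m \<in> keys F"
    then have mV: "keys m \<subseteq> V" using F by (auto simp: I_iff P_iff)
    have "VI.ext e ?\<Phi>' (single m (lookup F m)) =
        nf X (\<Sum>k\<in>{lookup m v}. xv v (k + e) * ?\<Phi>' (coefv v k (single m (lookup F m))))"
      by (rule VI.ext_superset) (auto simp: coefv_single D'0)
    also have "\<dots> = nf X (xv v (lookup m v + e) * D' (single (drop_var v m) (lookup F m)))"
      using nf_xv_nf_link[OF down, of "lookup m v + e", where V = V] e derivationsD(1)[OF D' gP[OF mV]]
      by (simp add: coefv_single)
    finally show "VI.ext e ?\<Phi>' (single m (lookup F m)) = nf X (D (single m (lookup F m)))"
      using mV by (simp add: D_single g_def)
  qed
  also have "\<dots> = nf X (D (\<Sum>m\<in>keys F. single m (lookup F m)))"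
    by (subst additive.sum[of D]) (auto simp: nf_sum D_add additive_def)
  finally show "VI.ext e ?\<Phi>' F = nf X ((\<lambda>F\<in>P V. D F) F)" using F by (simp add: sum_singles I_iff)
qed

lemma coset_map_T1: "coset_map (poly_ring V) HI der_homs (poly_ring W) L.HI L.der_homs (loc1_hom V X v)"
proof -
  interpret A: quotient_module "poly_ring V" HI der_homs by (rule quotient_T1)
  interpret B: quotient_module "poly_ring W" L.HI L.der_homs by (rule L.quotient_T1)
  show ?thesis
  proof (intro coset_map.intro coset_map_axioms.intro quotient_T1 L.quotient_T1)
    fix f assume "f \<in> carrier HI"
    then obtain \<Phi> where \<Phi>: "nf_hom V X IM \<Phi>" "f = H1.hm \<Phi>" using H1.ex_lift by (auto simp: Hom1_def)
    show "loc1_hom V X v f \<in> carrier L.HI"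
      using L.H1.hm_mem[OF VI.nf_hom_loc[OF \<Phi>(1)]] by (simp add: \<Phi> loc1_hom_hm Hom1_def)
  next
    fix f g assume f: "f \<in> carrier HI" and g: "g \<in> carrier HI"
    obtain \<Phi> where \<Phi>: "nf_hom V X IM \<Phi>" "f = H1.hm \<Phi>" using f H1.ex_lift by (auto simp: Hom1_def)
    obtain \<Psi> where \<Psi>: "nf_hom V X IM \<Psi>" "g = H1.hm \<Psi>" using g H1.ex_lift by (auto simp: Hom1_def)
    have "VI.loc (\<lambda>x. \<Phi> x + \<Psi> x) = (\<lambda>x. VI.loc \<Phi> x + VI.loc \<Psi> x)"
      by (simp add: VI.loc_def fun_eq_iff deh_add nf_add)
    then show "loc1_hom V X v (f \<oplus>\<^bsub>HI\<^esub> g) = loc1_hom V X v f \<oplus>\<^bsub>L.HI\<^esub> loc1_hom V X v g"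
      by (simp add: \<Phi> \<Psi> Hom1_def H1.hm_add H1.nf_hom_add loc1_hom_hm L.H1.hm_add VI.nf_hom_loc)
  next
    fix f assume "f \<in> der_homs"
    then obtain D where D: "D \<in> derivations V" "f = H1.hm (\<lambda>F. nf X (D F))" unfolding mem_der_homs by blast
    obtain D' where "D' \<in> derivations W" "\<And>h. h \<in> L.I \<Longrightarrow> VI.loc (\<lambda>F. nf X (D F)) h = nf lk (D' h)"
      by (rule loc_der[OF D(1)]) blast
    then show "loc1_hom V X v f \<in> L.der_homs"
      unfolding D(2) loc1_hom_hm[OF nf_hom_der[OF D(1)]]
      by (subst L.hm_mem_der_homs[OF VI.nf_hom_loc[OF nf_hom_der[OF D(1)]]]) blast
  qed
qed

lemma loc1_coset:
  assumes "nf_hom V X IM \<Phi>"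
  shows "loc1 V X v (der_homs +>\<^bsub>HI\<^esub> H1.hm \<Phi>) = L.der_homs +>\<^bsub>L.HI\<^esub> L.H1.hm (VI.loc \<Phi>)"
proof -
  interpret C: coset_map "poly_ring V" HI der_homs "poly_ring W" L.HI L.der_homs "loc1_hom V X v"
    by (rule coset_map_T1)
  have "loc1 V X v t = C.cmap t" for t
    by (simp add: loc1_def C.cmap_def T1_def quot_module_def)
  then show ?thesis using C.cmap_coset[of "H1.hm \<Phi>"] H1.hm_mem[OF assms]
    by (simp add: Hom1_def loc1_hom_hm[OF assms])
qed

lemma loc1_hom_graded1: "finite b \<Longrightarrow> f \<in> graded1 a b \<Longrightarrow> loc1_hom V X v f \<in> L.graded1 (drop_var v a) (b - {v})"
  using VI.nf_hom_loc VI.shifts_loc by (auto simp: graded1_def L.graded1_def loc1_hom_hm)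

lemma loc1_T1_ab:
  assumes "finite b" "t \<in> T1_ab V X a b"
  shows "loc1 V X v t \<in> T1_ab W lk (drop_var v a) (b - {v})"
proof -
  obtain \<Phi> where \<Phi>: "nf_hom V X IM \<Phi>" "shifts a b IM keys \<Phi>" "t = der_homs +>\<^bsub>HI\<^esub> H1.hm \<Phi>"
    using assms by (auto simp: T1_ab_eq graded1_def)
  have "L.H1.hm (VI.loc \<Phi>) \<in> L.graded1 (drop_var v a) (b - {v})"
    using VI.nf_hom_loc[OF \<Phi>(1)] VI.shifts_loc[OF \<Phi>(2) assms(1)] by (auto simp: L.graded1_def)
  then show ?thesis unfolding \<Phi>(3) loc1_coset[OF \<Phi>(1)] L.T1_ab_eq by blast
qed

text \<open>Both sides become equal after multiplication by \<open>x\<^sub>v\<close>. It can be cancelled, because the degree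
  \<open>a - b\<close> forces \<open>x\<^sub>v\<close> to divide all values.\<close>

lemma ext_loc1:
  assumes \<Phi>: "nf_hom V X IM \<Phi>" "shifts a b IM keys \<Phi>" and b: "finite b" "v \<notin> b" and a: "v \<in> keys a" and F: "F \<in> I"
  shows "VI.ext (lookup a v) (VI.loc \<Phi>) F = \<Phi> F"
proof (rule nf_xv_cancel[where X = X and v = v])
  have e: "lookup a v > 0" using a by (simp add: in_keys_iff)
  have "nf X (xv v 1 * VI.ext (lookup a v) (VI.loc \<Phi>) F) = \<Phi> (\<Sum>k | coefv v k F \<noteq> 0. xv v k * (xv v 1 * coefv v k F))"
    using VI.ext_loc[OF \<Phi> b refl, of F] F by (simp add: mult_var_def)
  also have "(\<Sum>k | coefv v k F \<noteq> 0. xv v k * (xv v 1 * coefv v k F)) = xv v 1 * F"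
    by (subst (3) sum_xv_coefv[of F v]) (simp add: sum_distrib_left mult.left_commute)
  also have "\<Phi> (xv v 1 * F) = nf X (xv v 1 * \<Phi> F)" using nf_homD(4)[OF \<Phi>(1), of "xv v 1" F] F v by simp
  finally show "nf X (xv v 1 * VI.ext (lookup a v) (VI.loc \<Phi>) F) = nf X (xv v 1 * \<Phi> F)" .
  show "nf X (VI.ext (lookup a v) (VI.loc \<Phi>) F) = VI.ext (lookup a v) (VI.loc \<Phi>) F" by (simp add: VI.ext_def)
  show "nf X (\<Phi> F) = \<Phi> F" using nf_homD(2)[OF \<Phi>(1)] F by simp
  show "v \<in> keys n" if "n \<in> keys (\<Phi> F)" for n
    using VI.shifts_v[OF \<Phi>(2) b a _ that] F by simp
  show "v \<in> keys n" if n: "n \<in> keys (VI.ext (lookup a v) (VI.loc \<Phi>) F)" for n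
  proof -
    have "shifts a b IM keys (VI.ext (lookup a v) (VI.loc \<Phi>))"
      using VI.shifts_ext[OF _ refl] VI.shifts_loc[OF \<Phi>(2) b(1)] b(2) by simp
    then show ?thesis using VI.shifts_v[of a b "VI.ext (lookup a v) (VI.loc \<Phi>)" F n] b a n F by simp
  qed
qed

lemma loc1_iso:
  assumes b: "finite b" "v \<notin> b" and a: "v \<in> keys a"
  shows "clinear_iso (sr_T1 V X) (sr_T1 W lk) (T1_ab V X a b)
     (T1_ab W lk (drop_var v a) b) (loc1 V X v)"
proof -
  have e: "lookup a v > 0" using a by (simp add: in_keys_iff)
  have bv: "b - {v} = b" using b by simp
  have loc1_eq: "loc1 V X v = (\<lambda>t. \<Union>y\<in>t. L.der_homs +>\<^bsub>L.HI\<^esub> loc1_hom V X v y)"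
    by (simp add: fun_eq_iff loc1_def T1_def quot_module_def)
  show ?thesis unfolding loc1_eq T1_ab_eq L.T1_ab_eq T1_def
  proof (rule clinear_iso_cosets[OF coset_map_T1])
    fix k f assume "f \<in> carrier HI"
    then obtain \<Phi> where \<Phi>: "nf_hom V X IM \<Phi>" "f = H1.hm \<Phi>" using H1.ex_lift by (auto simp: Hom1_def)
    have "VI.loc (\<lambda>x. nf X (Const k * \<Phi> x)) = (\<lambda>x. nf lk (Const k * VI.loc \<Phi> x))"
      by (simp add: VI.loc_def fun_eq_iff nf_deh_nf[OF down] deh_mult nf_mult_nf[OF L.down] deh_id)
    then show "loc1_hom V X v (Const k \<odot>\<^bsub>HI\<^esub> f) = Const k \<odot>\<^bsub>L.HI\<^esub> loc1_hom V X v f"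
      by (simp add: \<Phi> Hom1_def H1.hm_smult H1.nf_hom_smult loc1_hom_hm L.H1.hm_smult VI.nf_hom_loc)
  next
    show "graded1 a b \<subseteq> carrier HI" by (rule graded1_sub)
    show "L.graded1 (drop_var v a) b \<subseteq> carrier L.HI" by (rule L.graded1_sub)
    show "f \<ominus>\<^bsub>HI\<^esub> g \<in> graded1 a b" if "f \<in> graded1 a b" "g \<in> graded1 a b" for f g using graded1_diff that .
    show "loc1_hom V X v f \<in> L.graded1 (drop_var v a) b" if "f \<in> graded1 a b" for f
      using loc1_hom_graded1[OF b(1) that] by (simp add: bv)
  next
    fix f assume "f \<in> graded1 a b" and S: "loc1_hom V X v f \<in> L.der_homs"
    then obtain \<Phi> where \<Phi>: "f = H1.hm \<Phi>" "nf_hom V X IM \<Phi>" "shifts a b IM keys \<Phi>" by (auto simp: graded1_def)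
    from S obtain D' where D': "D' \<in> derivations W" "\<forall>h\<in>L.I. VI.loc \<Phi> h = nf lk (D' h)"
      by (auto simp: \<Phi>(1) loc1_hom_hm[OF \<Phi>(2)] L.hm_mem_der_homs[OF VI.nf_hom_loc[OF \<Phi>(2)]] simp del: mem_Collect_eq)
    obtain D where D: "D \<in> derivations V"
        "\<And>F. F \<in> I \<Longrightarrow> VI.ext (lookup a v) (\<lambda>h. nf lk (D' h)) F = nf X (D F)"
      by (rule ext_der[OF D'(1) e]) blast
    have "\<Phi> F = nf X (D F)" if F: "F \<in> I" for F
    proof -
      have "\<Phi> F = VI.ext (lookup a v) (VI.loc \<Phi>) F" using ext_loc1[OF \<Phi>(2,3) b a F] by simp
      also have "\<dots> = VI.ext (lookup a v) (\<lambda>h. nf lk (D' h)) F"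
        using D'(2) VI.comp_mem F by (simp add: VI.ext_def)
      finally show ?thesis using D(2)[OF F] by simp
    qed
    then show "f \<in> der_homs" unfolding \<Phi>(1) hm_mem_der_homs[OF \<Phi>(2)] using D(1) by blast
  next
    fix g assume "g \<in> L.graded1 (drop_var v a) b"
    then obtain \<Psi> where \<Psi>: "g = L.H1.hm \<Psi>" "nf_hom W lk L.IM \<Psi>" "shifts (drop_var v a) b L.IM keys \<Psi>"
      by (auto simp: L.graded1_def)
    let ?\<Phi> = "VI.ext (lookup a v) \<Psi>"
    have 1: "nf_hom V X IM ?\<Phi>" by (rule VI.nf_hom_ext[OF \<Psi>(2) e])
    have "loc1_hom V X v (H1.hm ?\<Phi>) = g"
      unfolding loc1_hom_hm[OF 1] \<Psi>(1) L.H1.hm_eq_iff[OF VI.nf_hom_loc[OF 1] \<Psi>(2)]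
      using VI.loc_ext[OF \<Psi>(2)] by blast
    moreover have "H1.hm ?\<Phi> \<in> graded1 a b" using 1 VI.shifts_ext[OF \<Psi>(3) refl] by (auto simp: graded1_def)
    ultimately show "\<exists>f\<in>graded1 a b. loc1_hom V X v f = g" by blast
  qed
qed

end

section \<open>Combinatorial description of the first cotangent module\<close>

lemma psi_eq: "psi b v g = (if v \<in> b then g else insert v g)"
  by (auto simp: psi_def)

text \<open>Adding \<open>v\<close> to \<open>g\<close> when \<open>v \<notin> b\<close>, and to \<open>b - {v}\<close> when \<open>v \<in> b\<close>, both times turns the condition in the link
  into the condition in \<open>X\<close>.\<close>

lemma psi_N:
  assumes "down_closed X" "A \<inter> b = {}" "g \<in> N (A - {v}) (b - {v}) (link v X)"
  shows "psi b v g \<in> N A b X"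
proof -
  have g: "g \<in> X" "v \<notin> g" "insert v g \<in> X" "A - {v} \<subseteq> g" "g \<inter> (b - {v}) = {}" "g \<union> (b - {v}) \<notin> link v X"
    using assms(3) by (auto simp: N_def link_def)
  have "insert v (g \<union> b) \<notin> X"
  proof
    assume "insert v (g \<union> b) \<in> X"
    then have "insert v (g \<union> (b - {v})) \<in> X" "g \<union> (b - {v}) \<in> X"
      by (rule down_closedD[OF assms(1)]; blast)+
    then show False using g by (auto simp: link_def)
  qed
  then show ?thesis
    using g assms(2) by (cases "v \<in> b") (auto simp: N_def psi_eq insert_absorb)
qed

lemma psi_N_tilde:
  assumes "down_closed X" "A \<inter> b = {}" "g \<in> N_tilde (A - {v}) (b - {v}) (link v X)"
  shows "psi b v g \<in> N_tilde A b X"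
proof -
  obtain b' where g: "g \<in> N (A - {v}) (b - {v}) (link v X)" and b': "b' \<subset> b - {v}" "g \<union> b' \<notin> link v X"
    using assms(3) by (auto simp: N_tilde_def)
  have vg: "v \<notin> g" using g by (auto simp: N_def link_def)
  have *: "insert v (g \<union> b') \<notin> X"
  proof
    assume "insert v (g \<union> b') \<in> X"
    moreover from this have "g \<union> b' \<in> X" by (rule down_closedD[OF assms(1)]) blast
    moreover have "v \<notin> g \<union> b'" using b'(1) vg by blast
    ultimately have "g \<union> b' \<in> link v X" unfolding link_def by simp
    then show False using b'(2) by contradiction
  qed
  \<comment> \<open>a proper subset of \<open>b\<close> that plays the role of \<open>b'\<close> for \<open>X\<close>\<close>
  define b'' where "b'' = b' \<union> (b \<inter> {v})"
  have "b'' \<subset> b" using b'(1) by (auto simp: b''_def)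
  moreover have "psi b v g \<union> b'' = insert v (g \<union> b')" by (auto simp: psi_def b''_def)
  moreover have "psi b v g \<in> N A b X" by (rule psi_N[OF assms(1,2) g])
  ultimately show ?thesis using * unfolding N_tilde_def by (intro CollectI conjI exI[of _ b'']) simp_all
qed

lemma psi_N_pairs:
  assumes "down_closed X" "A \<inter> b = {}" "fg \<in> N_pairs (A - {v}) (b - {v}) (link v X)"
  shows "map_prod (psi b v) (psi b v) fg \<in> N_pairs A b X"
proof -
  obtain f g where fg: "fg = (f, g)" "f \<in> N (A - {v}) (b - {v}) (link v X)"
      "g \<in> N (A - {v}) (b - {v}) (link v X)" "f \<union> g \<in> link v X"
    using assms(3) by (auto simp: N_pairs_def)
  have "psi b v f \<union> psi b v g \<in> X"
    by (rule down_closedD[OF assms(1), of "insert v (f \<union> g)"]) (use fg(4) in \<open>auto simp: link_def psi_def\<close>)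
  then show ?thesis using psi_N[OF assms(1,2)] fg by (auto simp: N_pairs_def)
qed

text \<open>The exponent of \<open>x\<^sub>i\<close> is negative precisely for \<open>i \<in> b - p\<close>, because \<open>a\<close> vanishes on \<open>b\<close>.\<close>

lemma xpow_eq:
  assumes "keys a \<inter> b = {}" "finite b" "finite p"
  shows "xpow (multideg (chi p) + multideg a - multideg (chi b)) = (if b \<subseteq> p then single (chi (p - b) + a) 1 else 0)"
proof -
  let ?e = "multideg (chi p) + multideg a - multideg (chi b)"
  have a0: "i \<in> b \<Longrightarrow> lookup a i = 0" for i using assms(1) by (auto simp: in_keys_iff)
  have e: "lookup ?e i = (if i \<in> p then 1 else 0) + int (lookup a i) - (if i \<in> b then 1 else 0)" for i
    by (simp add: lookup_add lookup_minus lookup_chi assms)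
  have nonneg: "(\<forall>i. 0 \<le> lookup ?e i) \<longleftrightarrow> b \<subseteq> p"
  proof
    assume *: "\<forall>i. 0 \<le> lookup ?e i"
    show "b \<subseteq> p"
    proof
      fix i assume "i \<in> b"
      then show "i \<in> p" using *[rule_format, of i] a0[of i] unfolding e by (auto split: if_splits)
    qed
  next
    assume "b \<subseteq> p"
    then show "\<forall>i. 0 \<le> lookup ?e i" unfolding e by auto
  qed
  have "Poly_Mapping.map nat ?e = chi (p - b) + a" if "b \<subseteq> p"
  proof (rule poly_mapping_eqI)
    fix i
    have "lookup (Poly_Mapping.map nat ?e) i = nat (lookup ?e i)"
      by (simp add: Poly_Mapping.map.rep_eq when_def)
    also have "\<dots> = lookup (chi (p - b) + a) i"
      unfolding e using that a0 assms by (auto simp: lookup_add lookup_chi)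
    finally show "lookup (Poly_Mapping.map nat ?e) i = lookup (chi (p - b) + a) i" .
  qed
  then show ?thesis unfolding xpow_def nonneg by simp
qed

text \<open>Applied to values of a homogeneous homomorphism: it sends \<open>x\<^sup>p\<close> to a multiple of one monomial, and to
  \<open>0\<close> unless \<open>b\<close> is contained in \<open>p\<close>. The same holds for the relation of two generators, with their
  union as \<open>p\<close>.\<close>

lemma shift_single:
  assumes "\<And>n. n \<in> keys G \<Longrightarrow> n + chi b = chi p + a" "keys a \<inter> b = {}" "finite b" "finite p"
  shows "G = (if b \<subseteq> p then single (chi (p - b) + a) (lookup G (chi (p - b) + a)) else 0)"
proof -
  have b: "b \<subseteq> p" "n = chi (p - b) + a" if n: "n \<in> keys G" for n
  proof -
    have l: "lookup n i + (if i \<in> b then 1 else 0) = (if i \<in> p then 1 else 0) + lookup a i" for i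
      using arg_cong[OF assms(1)[OF n], of "\<lambda>d. lookup d i"] by (simp add: lookup_add lookup_chi assms)
    have a0: "i \<in> b \<Longrightarrow> lookup a i = 0" for i using assms(2) by (auto simp: in_keys_iff)
    show "b \<subseteq> p"
    proof
      fix i assume "i \<in> b" then show "i \<in> p" using l[of i] a0[of i] by (auto split: if_splits)
    qed
    show "n = chi (p - b) + a"
    proof (rule poly_mapping_eqI)
      fix i show "lookup n i = lookup (chi (p - b) + a) i"
        using l[of i] a0[of i] \<open>b \<subseteq> p\<close> assms(4) by (auto simp: lookup_add lookup_chi split: if_splits)
    qed
  qed
  show ?thesis
  proof (rule poly_mapping_eqI)
    fix n show "lookup G n = lookup (if b \<subseteq> p then single (chi (p - b) + a) (lookup G (chi (p - b) + a)) else 0) n"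
      using b[of n] by (cases "n \<in> keys G") (auto simp: lookup_single when_def in_keys_iff)
  qed
qed

lemma sqfree_mult: "finite p \<Longrightarrow> finite q \<Longrightarrow> p \<inter> q = {} \<Longrightarrow> sqfree p * sqfree q = sqfree (p \<union> q)"
  by (simp add: sqfree_def mult_single chi_Un_disjoint)

lemma sqfree_insert: "finite p \<Longrightarrow> v \<notin> p \<Longrightarrow> xv v 1 * sqfree p = sqfree (insert v p)"
  using sqfree_mult[of "{v}" p] by (simp add: xv_def sqfree_def chi_def)

lemma Const_mult_single: "Const k * single m c = single m (k * c)"
  by (simp add: Const_def mult_single)

context stanley_reisner begin

lemma nonface_finite: "p \<in> nonfaces V X \<Longrightarrow> finite p"
  using finite_V by (auto simp: nonfaces_def intro: finite_subset)

lemma sqfree_mem_I: "p \<in> nonfaces V X \<Longrightarrow> sqfree p \<in> I"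
  using nonface_finite[of p] by (auto simp: I_iff nonfaces_def nf_sqfree sqfree_P)

lemma nonface_superset: "p \<in> nonfaces V X \<Longrightarrow> p \<subseteq> r \<Longrightarrow> r \<subseteq> V \<Longrightarrow> r \<in> nonfaces V X"
  using down_closedD[OF down] by (auto simp: nonfaces_def)

text \<open>Let \<open>\<kappa> p\<close> be the coefficient of the value on \<open>x\<^sup>p\<close>. By linearity it does not change if a nonface \<open>p\<close> that
  contains \<open>b\<close> is enlarged, as long as \<open>(p \<union> a) - b\<close> remains a face. So it depends only on \<open>f = (p \<union> a) - b\<close>, and \<open>f \<union> b\<close> serves as a canonical
  representative. If \<open>f \<union> b'\<close> is a nonface for a proper subset \<open>b'\<close> of \<open>b\<close>, then the value on \<open>x\<^bsup>f \<union> b'\<^esup>\<close> is \<open>0\<close>,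
  and the coefficient vanishes.\<close>

lemma ex_represents1:
  assumes a: "keys a \<subseteq> V" and b: "b \<subseteq> V" and ab: "keys a \<inter> b = {}" and t: "t \<in> T1_ab V X a b"
  shows "\<exists>\<mu>. represents1 V X a b \<mu> t"
proof -
  interpret Q: quotient_module "poly_ring V" HI der_homs by (rule quotient_T1)
  have finb: "finite b" using b finite_V finite_subset by blast
  obtain \<Phi> where \<Phi>: "nf_hom V X IM \<Phi>" "shifts a b IM keys \<Phi>" "t = der_homs +>\<^bsub>HI\<^esub> H1.hm \<Phi>"
    using t by (auto simp: T1_ab_eq graded1_def)
  define \<kappa> where "\<kappa> p = lookup (\<Phi> (sqfree p)) (chi (p - b) + a)" for p
  have val: "\<Phi> (sqfree p) = (if b \<subseteq> p then single (chi (p - b) + a) (\<kappa> p) else 0)" if p: "p \<in> nonfaces V X" for p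
    unfolding \<kappa>_def
  proof (rule shift_single[OF _ ab finb nonface_finite[OF p]])
    fix n assume "n \<in> keys (\<Phi> (sqfree p))"
    then show "n + chi b = chi p + a"
      using \<Phi>(2) sqfree_mem_I[OF p] by (auto simp: shifts_def sqfree_def)
  qed
  \<comment> \<open>\<open>x\<^sup>r\<close> is a multiple of \<open>x\<^sup>p\<close>, and the monomial of degree \<open>r + a - b\<close> is nonzero in the ring\<close>
  have step: "\<kappa> r = (if b \<subseteq> p then \<kappa> p else 0)"
    if pr: "p \<in> nonfaces V X" "p \<subseteq> r" "r \<subseteq> V" "b \<subseteq> r" and X: "(r \<union> keys a) - b \<in> X" for p r
  proof -
    have r: "r \<in> nonfaces V X" using nonface_superset pr by blast
    have fin: "finite r" "finite p" using r pr nonface_finite by auto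
    have "sqfree r = sqfree (r - p) * sqfree p"
      using fin pr by (subst sqfree_mult) (auto simp: Un_absorb2)
    then have "\<Phi> (sqfree r) = nf X (sqfree (r - p) * \<Phi> (sqfree p))"
      using nf_homD(4)[OF \<Phi>(1), of "sqfree (r - p)" "sqfree p"] sqfree_mem_I[OF pr(1)] fin pr
      by (simp add: sqfree_P subset_iff)
    also have "sqfree (r - p) * \<Phi> (sqfree p) = (if b \<subseteq> p then single (chi (r - b) + a) (\<kappa> p) else 0)"
    proof -
      have "chi (r - p) + chi (p - b) = chi (r - b)" if "b \<subseteq> p"
        using fin pr that by (subst chi_Un_disjoint) (auto intro!: arg_cong[where f = chi])
      then show ?thesis
        unfolding val[OF pr(1)] by (simp add: sqfree_def mult_single flip: add.assoc)
    qed
    also have "nf X \<dots> = \<dots>"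
    proof -
      have "keys (chi (r - b) + a) = (r \<union> keys a) - b" using fin ab by auto
      then show ?thesis using X by (auto simp: nf_single)
    qed
    finally have "single (chi (r - b) + a) (\<kappa> r) = single (chi (r - b) + a) (if b \<subseteq> p then \<kappa> p else 0)"
      using val[OF r] pr(4) by (simp split: if_splits)
    then show ?thesis by (metis lookup_single_eq)
  qed
  define \<mu> where "\<mu> f = \<kappa> (f \<union> b)" for f
  have N: "f \<union> b \<in> nonfaces V X" "f \<union> b \<subseteq> V" "(f \<union> b \<union> keys a) - b = f" if "f \<in> N (keys a) b X" for f
    using that b X_sub by (auto simp: N_def nonfaces_def)
  have "\<mu> f = 0" if f: "f \<in> N_tilde (keys a) b X" for f
  proof -
    obtain b' where f: "f \<in> N (keys a) b X" "b' \<subset> b" "f \<union> b' \<notin> X" using f by (auto simp: N_tilde_def)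
    have "f \<union> b' \<in> nonfaces V X" using f b N(2) by (auto simp: nonfaces_def)
    moreover have "\<not> b \<subseteq> f \<union> b'" using f(1,2) by (auto simp: N_def)
    moreover have "f \<in> X" using f(1) by (simp add: N_def)
    ultimately show ?thesis unfolding \<mu>_def using f N[OF f(1)] by (subst step[of "f \<union> b'"]) auto
  qed
  moreover have "\<mu> f = \<mu> g" if fg: "(f, g) \<in> N_pairs (keys a) b X" for f g
  proof -
    have fg: "f \<in> N (keys a) b X" "g \<in> N (keys a) b X" "f \<union> g \<in> X" using fg by (auto simp: N_pairs_def)
    have eq: "(f \<union> g \<union> b \<union> keys a) - b = f \<union> g" using fg by (auto simp: N_def)
    have "\<kappa> (f \<union> g \<union> b) = \<kappa> (f \<union> b)"
      using N[OF fg(1)] N[OF fg(2)] eq fg(3) by (subst step[of "f \<union> b"]) auto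
    moreover have "\<kappa> (f \<union> g \<union> b) = \<kappa> (g \<union> b)"
      using N[OF fg(1)] N[OF fg(2)] eq fg(3) by (subst step[of "g \<union> b"]) auto
    ultimately show ?thesis by (simp add: \<mu>_def)
  qed
  moreover have "H1.hm \<Phi> (sqfree p) = cls (if (p \<union> keys a) - b \<in> X
         then Const (\<mu> ((p \<union> keys a) - b)) * xpow (multideg (chi p) + multideg a - multideg (chi b)) else 0)"
    if p: "p \<in> nonfaces V X" for p
  proof -
    note pf = nonface_finite[OF p]
    have pV: "p \<subseteq> V" using p by (simp add: nonfaces_def)
    have xp: "xpow (multideg (chi p) + multideg a - multideg (chi b)) \<in> P V"
      using pf pV a by (auto simp: xpow_eq[OF ab finb pf])
    have keys: "keys (chi (p - b) + a) = (p \<union> keys a) - b" using pf ab by auto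
    have "\<Phi> (sqfree p) = nf X (if (p \<union> keys a) - b \<in> X
         then Const (\<mu> ((p \<union> keys a) - b)) * xpow (multideg (chi p) + multideg a - multideg (chi b)) else 0)"
    proof (cases "(p \<union> keys a) - b \<in> X \<and> b \<subseteq> p")
      case True
      have "(p \<union> keys a) - b \<union> b = p \<union> keys a" using True by auto
      moreover have "\<kappa> (p \<union> keys a) = \<kappa> p"
        using True p pV a by (subst step[of p]) (auto simp: Un_assoc)
      ultimately show ?thesis using True
        by (simp add: val[OF p] \<mu>_def xpow_eq[OF ab finb pf] Const_mult_single nf_single keys del: keys_mono_add)
    next
      case False
      have "nf X (\<Phi> (sqfree p)) = \<Phi> (sqfree p)" using nf_homD(2)[OF \<Phi>(1)] sqfree_mem_I[OF p] by simp
      then show ?thesis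
        using False val[OF p] by (auto simp: xpow_eq[OF ab finb pf] nf_single keys simp del: keys_mono_add split: if_splits)
    qed
    then show ?thesis
      using sqfree_mem_I[OF p] xp nf_homD(1)[OF \<Phi>(1)] by (subst H1.hm_apply) (auto simp: cls_nf)
  qed
  moreover have "H1.hm \<Phi> \<in> t" unfolding \<Phi>(3)
    by (rule Q.S.a_rcos_self) (simp add: Hom1_def H1.hm_mem[OF \<Phi>(1)])
  moreover have "t \<in> carrier (sr_T1 V X)" using t T1_ab_sub_carrier by blast
  ultimately show ?thesis unfolding represents1_def by (intro exI[of _ \<mu>]) blast
qed

end

context stanley_reisner_vertex begin

lemma insert_v_nonface: "p \<in> nonfaces W lk \<Longrightarrow> insert v p \<in> nonfaces V X"
  using down_closedD[OF down, of "insert v p" p] v by (auto simp: nonfaces_def link_def)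

text \<open>Setting \<open>x\<^sub>v = 1\<close> in the value on a generator \<open>p \<union> v\<close> gives the value prescribed in the link on \<open>p\<close>. The two
  case distinctions may differ if \<open>v \<in> b\<close>, but then the monomial is zero in the ring of
  the link. The lemma is stated for a union \<open>s\<close> of generators, since relations need the same computation.\<close>

lemma deh_term:
  assumes s: "s \<subseteq> W" and ab: "keys a \<inter> b = {}" and finb: "finite b"
  shows "nf lk (deh v (if (insert v s \<union> keys a) - b \<in> X
       then Const c * xpow (multideg (chi (insert v s)) + multideg a - multideg (chi b)) else 0)) =
     nf lk (if (s \<union> keys (drop_var v a)) - (b - {v}) \<in> lk
       then Const c * xpow (multideg (chi s) + multideg (drop_var v a) - multideg (chi (b - {v}))) else 0)"
proof -
  have fin: "finite s" "finite (insert v s)" "finite (b - {v})" using s finite_V finb finite_subset by auto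
  have vs: "v \<notin> s" using s by auto
  have ab': "keys (drop_var v a) \<inter> (b - {v}) = {}" using ab by auto
  have bs: "b \<subseteq> insert v s \<longleftrightarrow> b - {v} \<subseteq> s" by auto
  note xp = xpow_eq[OF ab finb fin(2)] xpow_eq[OF ab' fin(3,1)]
  define T where "T = (s \<union> keys (drop_var v a)) - (b - {v})"
  have d: "drop_var v (chi (insert v s - b) + a) = chi (s - (b - {v})) + drop_var v a"
    using fin vs by (auto simp: drop_var_chi intro!: arg_cong[where f = chi])
  have k: "keys (chi (s - (b - {v})) + drop_var v a) = T" using fin ab' by (auto simp: T_def)
  show ?thesis
  proof (cases "b - {v} \<subseteq> s \<and> T \<in> lk")
    case True
    then have "insert v T \<in> X" by (simp add: link_def)
    then have "(insert v s \<union> keys a) - b \<in> X" by (rule down_closedD[OF down]) (auto simp: T_def)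
    then show ?thesis using True unfolding xp bs by (simp add: T_def Const_mult_single d del: drop_var_add)
  next
    case False
    then show ?thesis unfolding xp bs
      by (auto simp: Const_mult_single d nf_single k T_def[symmetric] simp del: drop_var_add keys_mono_add keys_drop_var)
  qed
qed

lemma psi_face:
  assumes "p \<subseteq> W" "keys a \<inter> b = {}"
  shows "psi b v ((p \<union> keys (drop_var v a)) - (b - {v})) = (insert v p \<union> keys a) - b"
  using assms by (auto simp: psi_def)

text \<open>Localization evaluates on \<open>x\<^sub>v x\<^sup>p = x\<^bsup>p \<union> v\<^esup>\<close>, and replacing \<open>p\<close> by \<open>p \<union> v\<close> corresponds to \<open>psi\<close>
  on the faces \<open>(p \<union> a) - b\<close>.\<close>

lemma represents1_loc1:
  assumes b: "b \<subseteq> V" and a: "keys a \<subseteq> V" and ab: "keys a \<inter> b = {}" and t: "t \<in> T1_ab V X a b"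
    and rep: "represents1 V X a b \<mu> t"
  shows "represents1 W lk (drop_var v a) (b - {v}) (\<mu> \<circ> psi b v) (loc1 V X v t)"
proof -
  interpret Q: quotient_module "poly_ring V" HI der_homs by (rule quotient_T1)
  interpret Q': quotient_module "poly_ring W" L.HI L.der_homs by (rule L.quotient_T1)
  have finb: "finite b" using b finite_V finite_subset by blast
  obtain f where f: "f \<in> t" "\<And>p. p \<in> nonfaces V X \<Longrightarrow> f (sqfree p) = cls (if (p \<union> keys a) - b \<in> X
         then Const (\<mu> ((p \<union> keys a) - b)) * xpow (multideg (chi p) + multideg a - multideg (chi b)) else 0)"
    and tc: "t \<in> carrier (sr_T1 V X)"
    using rep by (auto simp: represents1_def)
  obtain g where g: "g \<in> carrier HI" "t = der_homs +>\<^bsub>HI\<^esub> g"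
    using tc unfolding T1_def Q.quot_carrier by blast
  have f': "f \<in> carrier HI" "t = der_homs +>\<^bsub>HI\<^esub> f"
    using g f(1) Q.S.a_elemrcos_carrier Q.S.a_repr_independence' by auto
  obtain \<Phi> where \<Phi>: "nf_hom V X IM \<Phi>" "f = H1.hm \<Phi>" using f'(1) H1.ex_lift by (auto simp: Hom1_def)
  have loc: "loc1 V X v t = L.der_homs +>\<^bsub>L.HI\<^esub> L.H1.hm (VI.loc \<Phi>)"
    unfolding f'(2) \<Phi>(2) by (rule loc1_coset[OF \<Phi>(1)])
  have "L.H1.hm (VI.loc \<Phi>) (sqfree p) = L.cls (if (p \<union> keys (drop_var v a)) - (b - {v}) \<in> lk
       then Const ((\<mu> \<circ> psi b v) ((p \<union> keys (drop_var v a)) - (b - {v}))) *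
         xpow (multideg (chi p) + multideg (drop_var v a) - multideg (chi (b - {v}))) else 0)"
    (is "_ = L.cls ?R") if p: "p \<in> nonfaces W lk" for p
  proof -
    have pV: "p \<subseteq> W" using p by (simp add: nonfaces_def)
    note fin = L.nonface_finite[OF p] and ip = insert_v_nonface[OF p]
    let ?T = "if (insert v p \<union> keys a) - b \<in> X
         then Const (\<mu> ((insert v p \<union> keys a) - b)) * xpow (multideg (chi (insert v p)) + multideg a - multideg (chi b)) else 0"
    have TP: "?T \<in> P V"
      using a pV v fin by (auto simp: xpow_eq[OF ab finb nonface_finite[OF ip]] intro!: P_mult)
    have "\<Phi> (sqfree (insert v p)) = nf X ?T"
    proof -
      have "cls (\<Phi> (sqfree (insert v p))) = cls ?T"
        using f(2)[OF ip] sqfree_mem_I[OF ip] by (simp only: \<Phi>(2) H1.hm_apply carrier_IM)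
      then show ?thesis using TP nf_homD(1,2)[OF \<Phi>(1)] sqfree_mem_I[OF ip] by (simp only: cls_eq_iff carrier_IM)
    qed
    moreover have "mult_var v (sqfree p) = sqfree (insert v p)"
      unfolding mult_var_def by (rule sqfree_insert) (use pV fin in auto)
    ultimately have "VI.loc \<Phi> (sqfree p) = nf lk (deh v (nf X ?T))" by (simp only: VI.loc_def)
    also have "\<dots> = nf lk (deh v ?T)" by (rule nf_deh_nf[OF down])
    also have "\<dots> = nf lk ?R"
      unfolding deh_term[OF pV ab finb] by (simp only: psi_face[OF pV ab] o_apply)
    finally have "VI.loc \<Phi> (sqfree p) = nf lk ?R" .
    moreover have "?R \<in> P W"
    proof -
      have "keys (drop_var v a) \<inter> (b - {v}) = {}" "finite (b - {v})" using ab finb by auto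
      then show ?thesis using a pV fin by (auto simp: xpow_eq intro!: P_mult)
    qed
    ultimately show ?thesis using L.sqfree_mem_I[OF p] by (simp only: L.H1.hm_apply L.carrier_IM L.cls_nf)
  qed
  moreover have "L.H1.hm (VI.loc \<Phi>) \<in> loc1 V X v t" unfolding loc
    by (rule Q'.S.a_rcos_self) (simp add: Hom1_def L.H1.hm_mem[OF VI.nf_hom_loc[OF \<Phi>(1)]])
  moreover have "loc1 V X v t \<in> carrier (sr_T1 W lk)"
    using loc1_T1_ab[OF finb t] L.T1_ab_sub_carrier by blast
  moreover have "\<forall>f\<in>N_tilde (keys (drop_var v a)) (b - {v}) lk. (\<mu> \<circ> psi b v) f = 0"
    using psi_N_tilde[OF down ab] rep by (auto simp: represents1_def)
  moreover have "\<forall>(f, g)\<in>N_pairs (keys (drop_var v a)) (b - {v}) lk. (\<mu> \<circ> psi b v) f = (\<mu> \<circ> psi b v) g"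
    using psi_N_pairs[OF down ab] rep by (fastforce simp: represents1_def)
  ultimately show ?thesis unfolding represents1_def by blast
qed

end

section \<open>The second cotangent module\<close>

abbreviation scal :: "mpoly \<Rightarrow> ('j \<Rightarrow>\<^sub>0 mpoly) \<Rightarrow> ('j \<Rightarrow>\<^sub>0 mpoly)" where
  "scal F r \<equiv> Poly_Mapping.map ((*) F) r"

lemma lookup_scal: "lookup (scal F r) p = F * lookup r p"
  by (simp add: Poly_Mapping.map.rep_eq when_def)

lemma scal_single: "scal F (single p G) = single p (F * G)"
  by (rule poly_mapping_eqI) (simp add: lookup_scal lookup_single when_def)

lemma scal_add: "scal F (r + s) = scal F r + scal F s" and add_scal: "scal (F + G) r = scal F r + scal G r"
  and mult_scal: "scal (F * G) r = scal F (scal G r)" and one_scal [simp]: "scal 1 r = r" and scal_0 [simp]: "scal F 0 = 0"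
  and scal_diff: "scal F (r - s) = scal F r - scal F s"
  by (rule poly_mapping_eqI; simp add: lookup_scal lookup_add lookup_minus algebra_simps)+

lemma present_linext: "present g = linext (\<lambda>p F. F * g p)"
  by (simp add: fun_eq_iff present_def linext_def)

lemma present_0 [simp]: "present g 0 = 0" by (simp add: present_linext)
lemma present_add: "present g (r + s) = present g r + present g s"
  unfolding present_linext by (rule linext_add) (auto simp: algebra_simps)
lemma present_single [simp]: "present g (single p F) = F * g p"
  unfolding present_linext by (subst linext_single) auto
lemma present_scal: "present g (scal F r) = F * present g r"
  by (rule additive_eqI[where f = "\<lambda>r. present g (scal F r)" and g = "\<lambda>r. F * present g r"])
     (auto simp: scal_add present_add scal_single algebra_simps)
lemma additive_present: "Modules.additive (present g)" by unfold_locales (rule present_add)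
lemmas present_diff = additive.diff[OF additive_present]

lemma lookup_linext_single:
  fixes h :: "'i \<Rightarrow> 'c::comm_monoid_add \<Rightarrow> 'b::comm_monoid_add"
  assumes "\<And>p. h p 0 = 0" "\<And>p F G. h p (F + G) = h p F + h p G"
  shows "lookup (linext (\<lambda>p F. single p (h p F)) r) q = h q (lookup r q)"
  by (rule additive_eqI[where f = "\<lambda>r. lookup (linext (\<lambda>p F. single p (h p F)) r) q" and g = "\<lambda>r. h q (lookup r q)"])
     (auto simp: assms linext_add single_add lookup_add linext_single lookup_single when_def)

text \<open>The degrees of the terms of a relation, where \<open>e\<^sub>p\<close> has the degree of \<open>x\<^sup>p\<close>.\<close>

definition rel_degs :: "(nat set \<Rightarrow>\<^sub>0 mpoly) \<Rightarrow> mono set" where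
  "rel_degs r = {m + chi p | p m. p \<in> keys r \<and> m \<in> keys (lookup r p)}"

lemma finite_rel_degs: "finite (rel_degs r)"
proof -
  have "rel_degs r = (\<Union>p\<in>keys r. (\<lambda>m. m + chi p) ` keys (lookup r p))" by (auto simp: rel_degs_def)
  then show ?thesis by simp
qed

lemma rel_degs_linext:
  assumes "d \<in> rel_degs (linext (\<lambda>p F. single (\<phi> p) (h p F)) r)"
  shows "\<exists>p\<in>keys r. \<exists>m\<in>keys (h p (lookup r p)). d = m + chi (\<phi> p)"
proof -
  obtain q m where q: "d = m + chi q" "m \<in> keys (lookup (\<Sum>p\<in>keys r. single (\<phi> p) (h p (lookup r p))) q)"
    using assms by (auto simp: rel_degs_def linext_def)
  then obtain p where p: "p \<in> keys r" "m \<in> keys (lookup (single (\<phi> p) (h p (lookup r p))) q)"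
    using keys_sum[of "\<lambda>p. lookup (single (\<phi> p) (h p (lookup r p))) q" "keys r"] by (auto simp: lookup_sum)
  then show ?thesis using q(1) by (auto simp: lookup_single when_def split: if_splits)
qed

text \<open>The component of degree \<open>d\<close> of a relation. The condition says that \<open>chi p \<le> d\<close>, since
  subtraction of exponents is truncated.\<close>

definition rel_part :: "mono \<Rightarrow> (nat set \<Rightarrow>\<^sub>0 mpoly) \<Rightarrow> (nat set \<Rightarrow>\<^sub>0 mpoly)" where
  "rel_part d = linext (\<lambda>p F. single p (if d = (d - chi p) + chi p then single (d - chi p) (lookup F (d - chi p)) else 0))"

lemma rel_part_add: "rel_part d (r + s) = rel_part d r + rel_part d s" and rel_part_0 [simp]: "rel_part d 0 = 0"
  unfolding rel_part_def by (rule linext_add, auto simp: lookup_add single_add)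

lemma lookup_part: "lookup (rel_part d r) p = (if d = (d - chi p) + chi p then single (d - chi p) (lookup (lookup r p) (d - chi p)) else 0)"
  unfolding rel_part_def by (subst lookup_linext_single) (auto simp: lookup_add single_add)

lemma lookup_lookup_part: "lookup (lookup (rel_part d r) p) m = (if d = m + chi p then lookup (lookup r p) m else 0)"
proof (cases "d = m + chi p")
  case True then show ?thesis by (simp add: lookup_part)
next
  case False
  have "m \<noteq> d - chi p" if "d = (d - chi p) + chi p" using False that by metis
  then show ?thesis using False by (auto simp: lookup_part lookup_single when_def)
qed

lemma sum_part: "(\<Sum>d\<in>rel_degs r. rel_part d r) = r"
proof (rule poly_mapping_eqI, rule poly_mapping_eqI)
  fix p m
  have "lookup (lookup (\<Sum>d\<in>rel_degs r. rel_part d r) p) m = (\<Sum>d\<in>rel_degs r. if d = m + chi p then lookup (lookup r p) m else 0)"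
    by (simp add: lookup_sum lookup_lookup_part)
  also have "\<dots> = lookup (lookup r p) m"
  proof (cases "lookup (lookup r p) m = 0")
    case False
    then have "m + chi p \<in> rel_degs r"
      unfolding rel_degs_def in_keys_iff by (intro CollectI exI[of _ p] exI[of _ m]) auto
    then show ?thesis by (simp add: finite_rel_degs sum.delta)
  qed (simp add: sum.neutral)
  finally show "lookup (lookup (\<Sum>d\<in>rel_degs r. rel_part d r) p) m = lookup (lookup r p) m" .
qed

text \<open>Relations form a graded submodule: the components of a relation are relations.\<close>

lemma present_part: "present sqfree (rel_part d r) = single d (lookup (present sqfree r) d)"
proof (rule additive_eqI[where f = "\<lambda>r. present sqfree (rel_part d r)" and g = "\<lambda>r. single d (lookup (present sqfree r) d)"])
  fix p
  show "present sqfree (rel_part d (single p (lookup r p))) = single d (lookup (present sqfree (single p (lookup r p))) d)"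
  proof (rule additive_eqI[where f = "\<lambda>F. present sqfree (rel_part d (single p F))" and g = "\<lambda>F. single d (lookup (present sqfree (single p F)) d)"])
    fix m :: mono and c :: complex
    have *: "rel_part d (single p (single m c)) = (if d = m + chi p then single p (single m c) else 0)"
      by (rule poly_mapping_eqI, rule poly_mapping_eqI)
        (auto simp: lookup_lookup_part lookup_single when_def)
    show "present sqfree (rel_part d (single p (single m c))) = single d (lookup (present sqfree (single p (single m c))) d)"
      unfolding * by (simp add: sqfree_def mult_single lookup_single when_def)
  qed (auto simp: rel_part_add present_add single_add lookup_add algebra_simps)
qed (auto simp: rel_part_add present_add single_add lookup_add)

lemma keys_part: "keys (rel_part d r) \<subseteq> keys r"
  by (auto simp: in_keys_iff lookup_part split: if_splits)

lemma keys_lookup_part: "m \<in> keys (lookup (rel_part d r) p) \<Longrightarrow> m \<in> keys (lookup r p) \<and> d = m + chi p"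
  by (auto simp: in_keys_iff lookup_lookup_part split: if_splits)

lemma (in poly_module) module_M:
  assumes "\<zero>\<^bsub>M\<^esub> = 0"
  shows "module (poly_ring V) M"
proof (rule moduleI[OF cring_poly_ring])
  show "abelian_group M"
  proof (rule abelian_groupI)
    fix x assume "x \<in> carrier M"
    then show "\<exists>y\<in>carrier M. y \<oplus>\<^bsub>M\<^esub> x = \<zero>\<^bsub>M\<^esub>" by (intro bexI[of _ "-x"]) (auto simp: assms)
  qed (auto simp: assms algebra_simps)
qed (auto simp: smult_add add_smult mult_smult)

context stanley_reisner begin

abbreviation "J \<equiv> nonfaces V X"
abbreviation "FM \<equiv> free_module V J"
abbreviation "R \<equiv> relations V J sqfree"
abbreviation "FR \<equiv> FM\<lparr>carrier := R\<rparr>"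
abbreviation "K \<equiv> koszul V J sqfree"
abbreviation "REL \<equiv> rel_module V J sqfree"
abbreviation "HR \<equiv> Hom2 V J sqfree"

lemma carrier_FM: "r \<in> carrier FM \<longleftrightarrow> keys r \<subseteq> J \<and> (\<forall>p. lookup r p \<in> P V)"
  by (simp add: free_module_def)

lemma FM_simps [simp]: "r \<oplus>\<^bsub>FM\<^esub> s = r + s" "F \<odot>\<^bsub>FM\<^esub> r = scal F r" "\<zero>\<^bsub>FM\<^esub> = 0"
  by (simp_all add: free_module_def)

lemma R_iff: "r \<in> R \<longleftrightarrow> r \<in> carrier FM \<and> present sqfree r = 0"
  by (simp add: relations_def)

lemma scal_FM: "F \<in> P V \<Longrightarrow> r \<in> carrier FM \<Longrightarrow> scal F r \<in> carrier FM"
  by (auto simp: carrier_FM lookup_scal in_keys_iff)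

lemma add_FM: "r \<in> carrier FM \<Longrightarrow> s \<in> carrier FM \<Longrightarrow> r + s \<in> carrier FM"
  using keys_add[of r s] by (auto simp: carrier_FM lookup_add)

lemma single_FM: "p \<in> J \<Longrightarrow> F \<in> P V \<Longrightarrow> single p F \<in> carrier FM"
  by (auto simp: carrier_FM lookup_single when_def)

sublocale FM: poly_module V FM
  by unfold_locales (auto simp: scal_FM add_FM scal_add add_scal mult_scal, auto simp: carrier_FM)

sublocale FR: poly_module V FR
  by unfold_locales (auto simp: R_iff scal_FM add_FM scal_add add_scal mult_scal present_add present_scal)

lemma present_mem_I: "r \<in> carrier FM \<Longrightarrow> present sqfree r \<in> I"
  unfolding present_def by (intro sum_mem I_0 I_add I_mult sqfree_mem_I) (auto simp: carrier_FM)

text \<open>The generators of \<open>R\<^sub>0\<close>.\<close>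

definition koszul_rel :: "(nat set \<Rightarrow>\<^sub>0 mpoly) \<Rightarrow> (nat set \<Rightarrow>\<^sub>0 mpoly) \<Rightarrow> (nat set \<Rightarrow>\<^sub>0 mpoly)" where
  "koszul_rel e f = scal (present sqfree f) e - scal (present sqfree e) f"

lemma koszul_alt: "K = (\<lambda>S. submodule S (poly_ring V) FM) hull {koszul_rel e f | e f. e \<in> carrier FM \<and> f \<in> carrier FM}"
  by (simp add: koszul_def koszul_rel_def)

text \<open>The hull is contained in every submodule that contains the generators, in particular in the one of
  all elements with the property \<open>Q\<close>.\<close>

lemma koszul_induct:
  assumes r: "r \<in> K"
    and gen: "\<And>e f. e \<in> carrier FM \<Longrightarrow> f \<in> carrier FM \<Longrightarrow> Q (koszul_rel e f)"
    and zero: "Q 0" and add: "\<And>r s. r \<in> carrier FM \<Longrightarrow> s \<in> carrier FM \<Longrightarrow> Q r \<Longrightarrow> Q s \<Longrightarrow> Q (r + s)"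
    and smult: "\<And>F r. F \<in> P V \<Longrightarrow> r \<in> carrier FM \<Longrightarrow> Q r \<Longrightarrow> Q (scal F r)"
  shows "r \<in> carrier FM" "Q r"
proof -
  interpret F: module "poly_ring V" FM by (rule FM.module_M) simp
  have koszul_rel: "koszul_rel e f \<in> carrier FM" if "e \<in> carrier FM" "f \<in> carrier FM" for e f
    using that present_mem_I by (auto simp: koszul_rel_def scal_FM I_iff intro!: FM.diff_mem)
  have "K \<subseteq> {r \<in> carrier FM. Q r}"
    unfolding koszul_alt
  proof (rule hull_minimal)
    show "submodule {r \<in> carrier FM. Q r} (poly_ring V) FM"
      by (rule F.submoduleI2) (auto simp: zero add smult scal_FM add_FM)
  qed (auto simp: gen koszul_rel)
  then show "r \<in> carrier FM" "Q r" using r by auto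
qed

lemma K_props: "0 \<in> K" "r \<in> K \<Longrightarrow> s \<in> K \<Longrightarrow> r + s \<in> K" "F \<in> P V \<Longrightarrow> r \<in> K \<Longrightarrow> scal F r \<in> K"
  "e \<in> carrier FM \<Longrightarrow> f \<in> carrier FM \<Longrightarrow> koszul_rel e f \<in> K"
proof -
  interpret F: module "poly_ring V" FM by (rule FM.module_M) simp
  let ?G = "{koszul_rel e f | e f. e \<in> carrier FM \<and> f \<in> carrier FM}"
  have K: "r \<in> K \<longleftrightarrow> (\<forall>S. submodule S (poly_ring V) FM \<and> ?G \<subseteq> S \<longrightarrow> r \<in> S)" for r
    unfolding koszul_alt hull_def by blast
  have S: "r + s \<in> S" if "submodule S (poly_ring V) FM" "r \<in> S" "s \<in> S" for S r s
    using F.submoduleE(5)[OF that] by simp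
  have S0: "0 \<in> S" if "submodule S (poly_ring V) FM" for S
    using subgroup.one_closed[OF submodule.axioms(1)[OF that]] by simp
  have der_homs: "scal F r \<in> S" if "submodule S (poly_ring V) FM" "F \<in> P V" "r \<in> S" for S F r
    using F.submoduleE(4)[OF that(1), of F r] that by simp
  show "0 \<in> K" using S0 unfolding K by blast
  show "r \<in> K \<Longrightarrow> s \<in> K \<Longrightarrow> r + s \<in> K" using S unfolding K by blast
  show "F \<in> P V \<Longrightarrow> r \<in> K \<Longrightarrow> scal F r \<in> K" using der_homs unfolding K by blast
  show "e \<in> carrier FM \<Longrightarrow> f \<in> carrier FM \<Longrightarrow> koszul_rel e f \<in> K" unfolding K by blast
qed

lemma K_FM: "r \<in> K \<Longrightarrow> r \<in> carrier FM"
  by (rule koszul_induct(1)[where Q = "\<lambda>_. True"]) auto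

lemma K_R: "r \<in> K \<Longrightarrow> r \<in> R"
proof -
  assume r: "r \<in> K"
  have "present sqfree r = 0"
    by (rule koszul_induct(2)[OF r]) (auto simp: koszul_rel_def present_diff present_scal present_add)
  then show "r \<in> R" using K_FM[OF r] by (simp add: R_iff)
qed

lemma R_FM: "r \<in> R \<Longrightarrow> r \<in> carrier FM" by (simp add: R_iff)

sublocale RQ: quotient_module "poly_ring V" FR K
proof -
  interpret F: module "poly_ring V" FR by (rule FR.module_M) simp
  have "submodule K (poly_ring V) FR"
    by (rule F.submoduleI2) (auto simp: K_R K_props)
  then show "quotient_module (poly_ring V) FR K"
    by (intro quotient_module.intro quotient_module_axioms.intro F.module_axioms)
qed

abbreviation "rel_cls r \<equiv> K +>\<^bsub>FM\<^esub> r"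

lemma rel_cls_FR: "K +>\<^bsub>FR\<^esub> r = rel_cls r"
  by (simp add: a_r_coset_def r_coset_def)

lemma rel_cls_def: "rel_cls r = {k + r | k. k \<in> K}"
  by (auto simp: a_r_coset_def r_coset_def)

lemma carrier_REL: "carrier REL = {rel_cls r | r. r \<in> R}"
  unfolding rel_module_def RQ.quot_carrier rel_cls_FR by simp

lemma REL_add: "r \<in> R \<Longrightarrow> s \<in> R \<Longrightarrow> rel_cls r \<oplus>\<^bsub>REL\<^esub> rel_cls s = rel_cls (r + s)"
  using RQ.quot_add[of r s] by (simp add: rel_module_def rel_cls_FR)

lemma REL_smult: "F \<in> P V \<Longrightarrow> r \<in> R \<Longrightarrow> F \<odot>\<^bsub>REL\<^esub> rel_cls r = rel_cls (scal F r)"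
  using RQ.quot_smult[of F r] by (simp add: rel_module_def rel_cls_FR)

lemma R_add: "r \<in> R \<Longrightarrow> s \<in> R \<Longrightarrow> r + s \<in> R" using FR.add_mem by simp
lemma R_scal: "F \<in> P V \<Longrightarrow> r \<in> R \<Longrightarrow> scal F r \<in> R" using FR.smult_mem by simp

lemma rel_cls_REL [simp]: "r \<in> R \<Longrightarrow> rel_cls r \<in> carrier REL" by (auto simp: carrier_REL)

sublocale H2: stanley_reisner_hom V X REL
  by unfold_locales (auto simp: carrier_REL REL_add REL_smult intro: R_add R_scal)

sublocale HF: stanley_reisner_hom V X FM
  by unfold_locales (auto simp: add_FM scal_FM)

lemma Hom2_eq: "HR = H2.homs"
  by (simp add: Hom2_def sr_ideal_def)

text \<open>Maps of normal forms on the relations that vanish on \<open>R\<^sub>0\<close>, which are the homomorphisms from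
  \<open>R/R\<^sub>0\<close>; \<open>on_cosets\<close> passes to the quotient.\<close>

definition nf_hom2 :: "((nat set \<Rightarrow>\<^sub>0 mpoly) \<Rightarrow> mpoly) \<Rightarrow> bool" where
  "nf_hom2 \<Phi> \<longleftrightarrow> nf_hom V X FR \<Phi> \<and> (\<forall>k\<in>K. \<Phi> k = 0)"

definition on_cosets :: "('s \<Rightarrow> mpoly) \<Rightarrow> 's set \<Rightarrow> mpoly" where
  "on_cosets \<Phi> C = \<Phi> (SOME r. r \<in> C)"

abbreviation "hm2 \<Phi> \<equiv> H2.hm (on_cosets \<Phi>)"

lemma nf_hom2_const:
  assumes "nf_hom2 \<Phi>" "r \<in> R" "s \<in> rel_cls r"
  shows "\<Phi> s = \<Phi> r"
proof -
  have \<Phi>: "nf_hom V X FR \<Phi>" using assms(1) by (simp add: nf_hom2_def)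
  obtain k where k: "k \<in> K" "s = k + r" using assms(3) by (auto simp: rel_cls_def)
  then have "\<Phi> s = \<Phi> k + \<Phi> r" using FR.nf_hom_plus[OF \<Phi>, of k r] K_R assms(2) by simp
  then show ?thesis using k(1) assms(1) by (simp add: nf_hom2_def)
qed

lemma rel_cls_self: "r \<in> rel_cls r" using K_props(1) by (force simp: rel_cls_def)

lemma rel_cls_R: "r \<in> R \<Longrightarrow> s \<in> rel_cls r \<Longrightarrow> s \<in> R" using R_add K_R by (auto simp: rel_cls_def)

lemma on_cosets_rel_cls: "nf_hom2 \<Phi> \<Longrightarrow> r \<in> R \<Longrightarrow> on_cosets \<Phi> (rel_cls r) = \<Phi> r"
  unfolding on_cosets_def by (rule nf_hom2_const[OF _ _ someI[of "\<lambda>s. s \<in> rel_cls r" r]]) (auto simp: rel_cls_self)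

lemma nf_hom_on_cosets:
  assumes "nf_hom2 \<Phi>"
  shows "nf_hom V X REL (on_cosets \<Phi>)"
proof -
  have \<Phi>: "nf_hom V X FR \<Phi>" using assms by (simp add: nf_hom2_def)
  show ?thesis
    using nf_homD[OF \<Phi>] R_add R_scal on_cosets_rel_cls[OF assms]
    unfolding nf_hom_def by (auto simp: carrier_REL REL_add REL_smult)
qed

lemma hm2_apply: "nf_hom2 \<Phi> \<Longrightarrow> r \<in> R \<Longrightarrow> hm2 \<Phi> (rel_cls r) = cls (\<Phi> r)"
  by (simp add: H2.hm_apply on_cosets_rel_cls)

lemma hm2_mem: "nf_hom2 \<Phi> \<Longrightarrow> hm2 \<Phi> \<in> carrier HR"
  unfolding Hom2_eq using H2.hm_mem[OF nf_hom_on_cosets] by simp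

lemma ex_lift2:
  assumes "f \<in> carrier HR"
  obtains \<Phi> where "nf_hom2 \<Phi>" "f = hm2 \<Phi>"
proof -
  obtain \<Psi> where \<Psi>: "nf_hom V X REL \<Psi>" "f = H2.hm \<Psi>"
    using H2.ex_lift assms by (auto simp: Hom2_eq)
  let ?\<Phi> = "\<lambda>r. \<Psi> (rel_cls r)"
  have "nf_hom V X FR ?\<Phi>"
    using nf_homD[OF \<Psi>(1)] unfolding nf_hom_def by (auto simp flip: REL_add REL_smult)
  moreover have "\<Psi> (rel_cls k) = 0" if k: "k \<in> K" for k
  proof -
    have "0 \<in> R" using FR.zero_mem by simp
    have "\<Psi> (rel_cls 0) = \<Psi> (rel_cls 0) + \<Psi> (rel_cls 0)"
      using nf_homD(3)[OF \<Psi>(1), of "rel_cls 0" "rel_cls 0"] \<open>0 \<in> R\<close> by (simp add: REL_add)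
    moreover have "rel_cls k = rel_cls 0"
      using RQ.S.a_rcos_const[OF k] RQ.S.a_rcos_const[OF K_props(1)] by (simp add: rel_cls_FR)
    ultimately show ?thesis by simp
  qed
  ultimately have 1: "nf_hom2 ?\<Phi>" by (simp add: nf_hom2_def)
  have "on_cosets ?\<Phi> C = \<Psi> C" if "C \<in> carrier REL" for C
    using that on_cosets_rel_cls[OF 1] by (auto simp: carrier_REL)
  then have "f = hm2 ?\<Phi>" unfolding \<Psi>(2) using H2.hm_eq_iff[OF \<Psi>(1) nf_hom_on_cosets[OF 1]] by simp
  then show ?thesis using that 1 by blast
qed

lemma hm2_eq_iff:
  assumes "nf_hom2 \<Phi>" "nf_hom2 \<Psi>"
  shows "hm2 \<Phi> = hm2 \<Psi> \<longleftrightarrow> (\<forall>r\<in>R. \<Phi> r = \<Psi> r)"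
  unfolding H2.hm_eq_iff[OF nf_hom_on_cosets[OF assms(1)] nf_hom_on_cosets[OF assms(2)]]
  using on_cosets_rel_cls[OF assms(1)] on_cosets_rel_cls[OF assms(2)] by (auto simp: carrier_REL)

lemma FR_hom: "stanley_reisner_hom V X FR"
  by unfold_locales (auto intro: R_add R_scal)

lemma nf_hom2_add: "nf_hom2 \<Phi> \<Longrightarrow> nf_hom2 \<Psi> \<Longrightarrow> nf_hom2 (\<lambda>r. \<Phi> r + \<Psi> r)"
  unfolding nf_hom2_def using stanley_reisner_hom.nf_hom_add[OF FR_hom] by auto
lemma nf_hom2_diff: "nf_hom2 \<Phi> \<Longrightarrow> nf_hom2 \<Psi> \<Longrightarrow> nf_hom2 (\<lambda>r. \<Phi> r - \<Psi> r)"
  unfolding nf_hom2_def using stanley_reisner_hom.nf_hom_diff[OF FR_hom] by auto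
lemma nf_hom2_smult: "nf_hom2 \<Phi> \<Longrightarrow> F \<in> P V \<Longrightarrow> nf_hom2 (\<lambda>r. nf X (F * \<Phi> r))"
  unfolding nf_hom2_def using stanley_reisner_hom.nf_hom_smult[OF FR_hom] by auto

lemma hm2_add: "nf_hom2 \<Phi> \<Longrightarrow> nf_hom2 \<Psi> \<Longrightarrow> hm2 \<Phi> \<oplus>\<^bsub>HR\<^esub> hm2 \<Psi> = hm2 (\<lambda>r. \<Phi> r + \<Psi> r)"
  unfolding Hom2_eq using H2.hm_add[OF nf_hom_on_cosets nf_hom_on_cosets, of \<Phi> \<Psi>] by (simp add: on_cosets_def[abs_def])
lemma hm2_diff: "nf_hom2 \<Phi> \<Longrightarrow> nf_hom2 \<Psi> \<Longrightarrow> hm2 \<Phi> \<ominus>\<^bsub>HR\<^esub> hm2 \<Psi> = hm2 (\<lambda>r. \<Phi> r - \<Psi> r)"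
  unfolding Hom2_eq using H2.hm_diff[OF nf_hom_on_cosets nf_hom_on_cosets, of \<Phi> \<Psi>] by (simp add: on_cosets_def[abs_def])
lemma hm2_smult: "nf_hom2 \<Phi> \<Longrightarrow> F \<in> P V \<Longrightarrow> F \<odot>\<^bsub>HR\<^esub> hm2 \<Phi> = hm2 (\<lambda>r. nf X (F * \<Phi> r))"
  unfolding Hom2_eq using H2.hm_smult[OF nf_hom_on_cosets, of \<Phi> F] by (simp add: on_cosets_def[abs_def])

text \<open>A homomorphism \<open>\<eta>\<close> on the free module sends a Koszul relation \<open>j(f) e - j(e) f\<close> to
  \<open>j(f) \<eta>(e) - j(e) \<eta>(f)\<close>, which lies in the ideal.\<close>

lemma nf_hom_FM_R:
  assumes \<eta>: "nf_hom V X FM \<eta>"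
  shows "nf_hom2 \<eta>"
proof -
  have "\<eta> k = 0" if "k \<in> K" for k
  proof (rule koszul_induct(2)[OF that])
    fix e f assume ef: "e \<in> carrier FM" "f \<in> carrier FM"
    have "\<eta> (scal (present sqfree e) f) = 0" if "e \<in> carrier FM" "f \<in> carrier FM" for e f
      using nf_homD(4)[OF \<eta>, of "present sqfree e" f] that present_mem_I[of e]
        I_mult[of "\<eta> f" "present sqfree e"] nf_homD(1)[OF \<eta>, of f] by (simp add: I_iff mult.commute)
    then show "\<eta> (koszul_rel e f) = 0"
      unfolding koszul_rel_def using ef present_mem_I by (subst FM.nf_hom_minus[OF \<eta>]) (auto simp: scal_FM I_iff)
  qed (auto simp: FM.nf_hom_0[OF \<eta>] FM.nf_hom_plus[OF \<eta>] nf_homD(4)[OF \<eta>, simplified])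
  then show ?thesis using \<eta> by (auto simp: nf_hom2_def nf_hom_def R_FM)
qed

abbreviation "cob_homs \<equiv> {\<lambda>C\<in>carrier REL. \<Union>r\<in>C. h r | h.
   h \<in> mod_hom (poly_ring V) FM (quot_ring_module (poly_ring V) (genideal (poly_ring V) (sqfree ` J)))}"

lemma cob_hom_eq:
  assumes \<eta>: "nf_hom V X FM \<eta>"
  shows "(\<lambda>C\<in>carrier REL. \<Union>r\<in>C. HF.hm \<eta> r) = hm2 \<eta>"
  unfolding to_hom_def
proof (rule restrict_ext)
  fix C assume "C \<in> carrier REL"
  then obtain r where r: "r \<in> R" "C = rel_cls r" by (auto simp: carrier_REL)
  have "(\<Union>s\<in>C. (\<lambda>x\<in>carrier FM. cls (\<eta> x)) s) = cls (\<eta> r)"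
  proof (rule SUP_eq_const)
    show "C \<noteq> {}" using rel_cls_self r(2) by blast
    fix s assume "s \<in> C"
    then show "(\<lambda>x\<in>carrier FM. cls (\<eta> x)) s = cls (\<eta> r)"
      using nf_hom2_const[OF nf_hom_FM_R[OF \<eta>] r(1)] rel_cls_R[OF r(1)] R_FM r(2) by simp
  qed
  then show "(\<Union>s\<in>C. (\<lambda>x\<in>carrier FM. cls (\<eta> x)) s) = cls (on_cosets \<eta> C)"
    using on_cosets_rel_cls[OF nf_hom_FM_R[OF \<eta>] r(1)] r(2) by simp
qed

lemma mem_cob_homs: "f \<in> cob_homs \<longleftrightarrow> (\<exists>\<eta>. nf_hom V X FM \<eta> \<and> f = hm2 \<eta>)"
proof
  assume "f \<in> cob_homs"
  then obtain h where h: "h \<in> mod_hom (poly_ring V) FM A" "f = (\<lambda>C\<in>carrier REL. \<Union>r\<in>C. h r)"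
    unfolding mem_Collect_eq sr_ideal_def by blast
  obtain \<eta> where "nf_hom V X FM \<eta>" "h = HF.hm \<eta>" by (rule HF.ex_lift[OF h(1)])
  then show "\<exists>\<eta>. nf_hom V X FM \<eta> \<and> f = hm2 \<eta>" using h(2) cob_hom_eq by blast
next
  assume "\<exists>\<eta>. nf_hom V X FM \<eta> \<and> f = hm2 \<eta>"
  then obtain \<eta> where \<eta>: "nf_hom V X FM \<eta>" "f = hm2 \<eta>" by blast
  show "f \<in> cob_homs" unfolding mem_Collect_eq \<eta>(2) cob_hom_eq[OF \<eta>(1), symmetric]
    using HF.hm_mem[OF \<eta>(1)] unfolding sr_ideal_def by blast
qed

text \<open>A class in \<open>T\<^sup>2\<close> is trivial if and only if it is represented by the restriction of a homomorphism on the free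
  module.\<close>

lemma hm2_mem_cob_homs:
  assumes "nf_hom2 \<Phi>"
  shows "hm2 \<Phi> \<in> cob_homs \<longleftrightarrow> (\<exists>\<eta>. nf_hom V X FM \<eta> \<and> (\<forall>r\<in>R. \<Phi> r = \<eta> r))"
  unfolding mem_cob_homs using hm2_eq_iff[OF assms nf_hom_FM_R] by blast

lemma quotient_T2: "quotient_module (poly_ring V) HR cob_homs"
proof -
  interpret H: module "poly_ring V" HR unfolding Hom2_eq by (rule H2.H.module_hom_module)
  have "submodule cob_homs (poly_ring V) HR"
  proof (rule H.submoduleI2)
    show "cob_homs \<subseteq> carrier HR"
    proof
      fix f assume "f \<in> cob_homs"
      then obtain \<eta> where "nf_hom V X FM \<eta>" "f = hm2 \<eta>" unfolding mem_cob_homs by blast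
      then show "f \<in> carrier HR" using hm2_mem[OF nf_hom_FM_R] by simp
    qed
    show "\<zero>\<^bsub>HR\<^esub> \<in> cob_homs"
      unfolding mem_cob_homs Hom2_eq H2.hm_zero
      by (rule exI[of _ "\<lambda>_. 0"]) (simp add: HF.nf_hom_zero on_cosets_def[abs_def])
  next
    fix f g assume "f \<in> cob_homs" "g \<in> cob_homs"
    then obtain \<eta> \<theta> where *: "nf_hom V X FM \<eta>" "f = hm2 \<eta>" "nf_hom V X FM \<theta>" "g = hm2 \<theta>" unfolding mem_cob_homs by blast
    show "f \<oplus>\<^bsub>HR\<^esub> g \<in> cob_homs"
      unfolding *(2,4) hm2_add[OF nf_hom_FM_R[OF *(1)] nf_hom_FM_R[OF *(3)]] mem_cob_homs
      using HF.nf_hom_add[OF *(1,3)] by blast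
  next
    fix G f assume G: "G \<in> P V" and "f \<in> cob_homs"
    then obtain \<eta> where *: "nf_hom V X FM \<eta>" "f = hm2 \<eta>" unfolding mem_cob_homs by blast
    show "G \<odot>\<^bsub>HR\<^esub> f \<in> cob_homs"
      unfolding *(2) hm2_smult[OF nf_hom_FM_R[OF *(1)] G] mem_cob_homs
      using HF.nf_hom_smult[OF *(1) G] by blast
  qed
  then show ?thesis by (intro quotient_module.intro quotient_module_axioms.intro H.module_axioms)
qed

text \<open>The homogeneous homomorphisms from \<open>R/R\<^sub>0\<close> to the quotient ring. Their classes form
  \<open>T\<^sup>2\<^bsub>a - b\<^esub>\<close>.\<close>

definition graded2 :: "mono \<Rightarrow> nat set \<Rightarrow> ((nat set \<Rightarrow>\<^sub>0 mpoly) set \<Rightarrow> mpoly set) set" where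
  "graded2 a b = {hm2 \<Phi> | \<Phi>. nf_hom2 \<Phi> \<and> shifts a b FR rel_degs \<Phi>}"

lemma rel_part_R: assumes r: "r \<in> R" shows "rel_part d r \<in> R"
proof -
  have "lookup (rel_part d r) p \<in> P V" for p
    using r keys_lookup_part by (fastforce simp: R_iff carrier_FM P_iff)
  then show ?thesis using r keys_part[of d r] by (auto simp: R_iff carrier_FM present_part)
qed

lemma shifts_iff_homog2:
  assumes \<Phi>: "nf_hom2 \<Phi>"
  shows "shifts a b FR rel_degs \<Phi> \<longleftrightarrow> (\<forall>d. \<forall>r\<in>R. homog_rel multideg d r \<longrightarrow>
     hm2 \<Phi> (rel_cls r) \<in> sr_ring_part V X multideg (d + (multideg a - multideg (chi b))))" (is "_ \<longleftrightarrow> ?R")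
proof
  have \<Phi>': "nf_hom V X FR \<Phi>" using \<Phi> by (simp add: nf_hom2_def)
  {
    assume sh: "shifts a b FR rel_degs \<Phi>"
    show ?R
    proof (intro allI ballI impI)
      fix d r assume r: "r \<in> R" "homog_rel multideg d r"
      have "homog multideg (d + (multideg a - multideg (chi b))) (\<Phi> r)"
        by (rule homog_if_shift[where D = "rel_degs r"])
          (use r sh in \<open>auto simp: multideg_add shifts_def homog_rel_def rel_degs_def\<close>)
      then show "hm2 \<Phi> (rel_cls r) \<in> sr_ring_part V X multideg (d + (multideg a - multideg (chi b)))"
        using r nf_homD(1,2)[OF \<Phi>'] by (simp add: hm2_apply[OF \<Phi>] ring_part_iff)
    qed
  next
    assume R: ?R
    show "shifts a b FR rel_degs \<Phi>"
      unfolding shifts_def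
    proof (intro ballI)
      fix r n assume "r \<in> carrier FR" and n: "n \<in> keys (\<Phi> r)"
      then have r: "r \<in> R" by simp
      have "\<Phi> r = (\<Sum>d\<in>rel_degs r. \<Phi> (rel_part d r))"
        using rel_part_R[OF r] by (subst (1) sum_part[symmetric], subst FR.nf_hom_sum[OF \<Phi>']) auto
      then obtain d where d: "d \<in> rel_degs r" "n \<in> keys (\<Phi> (rel_part d r))"
        using n keys_sum by fastforce
      have "homog_rel multideg (multideg d) (rel_part d r)"
        unfolding homog_rel_def using keys_lookup_part by blast
      then have "hm2 \<Phi> (rel_cls (rel_part d r)) \<in> sr_ring_part V X multideg (multideg d + (multideg a - multideg (chi b)))"
        using R rel_part_R[OF r] by blast
      then have "homog multideg (multideg d + (multideg a - multideg (chi b))) (\<Phi> (rel_part d r))"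
        using rel_part_R[OF r] nf_homD(1,2)[OF \<Phi>'] by (simp add: hm2_apply[OF \<Phi>] ring_part_iff)
      then have "multideg (n + chi b) = multideg (d + a)" using d(2) by (auto simp: homog_def multideg_add)
      then show "\<exists>d\<in>rel_degs r. n + chi b = d + a" using d(1) multideg_inj by blast
    qed
  }
qed

lemma graded2_sub: "graded2 a b \<subseteq> carrier HR"
  using hm2_mem by (auto simp: graded2_def)

lemma graded2_diff:
  assumes "f \<in> graded2 a b" "g \<in> graded2 a b" shows "f \<ominus>\<^bsub>HR\<^esub> g \<in> graded2 a b"
proof -
  obtain \<Phi> \<Psi> where *: "f = hm2 \<Phi>" "nf_hom2 \<Phi>" "shifts a b FR rel_degs \<Phi>"
     "g = hm2 \<Psi>" "nf_hom2 \<Psi>" "shifts a b FR rel_degs \<Psi>" using assms by (auto simp: graded2_def)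
  then have "f \<ominus>\<^bsub>HR\<^esub> g = hm2 (\<lambda>F. \<Phi> F - \<Psi> F)" by (simp add: hm2_diff)
  then show ?thesis using nf_hom2_diff[OF *(2,5)] shifts_diff[OF *(3,6)] by (auto simp: graded2_def)
qed

lemma T2_ab_eq: "T2_ab V X a b = {cob_homs +>\<^bsub>HR\<^esub> f | f. f \<in> graded2 a b}"
proof -
  interpret Q: quotient_module "poly_ring V" HR cob_homs by (rule quotient_T2)
  have "graded2 a b = {f \<in> carrier HR. \<forall>d. \<forall>r\<in>R. homog_rel multideg d r \<longrightarrow>
     f (rel_cls r) \<in> sr_ring_part V X multideg (d + (multideg a - multideg (chi b)))}"
  proof safe
    fix f assume "f \<in> graded2 a b"
    then show "f \<in> carrier HR" using graded2_sub by blast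
    obtain \<Phi> where \<Phi>: "nf_hom2 \<Phi>" "shifts a b FR rel_degs \<Phi>" "f = hm2 \<Phi>" using \<open>f \<in> graded2 a b\<close> by (auto simp: graded2_def)
    fix d r assume "r \<in> R" "homog_rel multideg d r"
    then show "f (rel_cls r) \<in> sr_ring_part V X multideg (d + (multideg a - multideg (chi b)))"
      using \<Phi>(2) unfolding \<Phi>(3) shifts_iff_homog2[OF \<Phi>(1)] by blast
  next
    fix f assume f: "f \<in> carrier HR" and *: "\<forall>d. \<forall>r\<in>R. homog_rel multideg d r \<longrightarrow>
     f (rel_cls r) \<in> sr_ring_part V X multideg (d + (multideg a - multideg (chi b)))"
    obtain \<Phi> where \<Phi>: "nf_hom2 \<Phi>" "f = hm2 \<Phi>" by (rule ex_lift2[OF f])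
    have "shifts a b FR rel_degs \<Phi>" using * unfolding shifts_iff_homog2[OF \<Phi>(1)] \<Phi>(2) .
    then show "f \<in> graded2 a b" using \<Phi> by (auto simp: graded2_def)
  qed
  then show ?thesis unfolding T2_ab_def T2_part_def T2_def Q.quot_part by simp
qed

lemma T2_ab_sub_T2_0:
  assumes "finite b" "total_degree a = card b"
  shows "T2_ab V X a b \<subseteq> T2_0 V X"
proof
  interpret Q: quotient_module "poly_ring V" HR cob_homs by (rule quotient_T2)
  fix t assume "t \<in> T2_ab V X a b"
  then obtain \<Phi> where \<Phi>: "nf_hom2 \<Phi>" "shifts a b FR rel_degs \<Phi>" "t = cob_homs +>\<^bsub>HR\<^esub> hm2 \<Phi>"
    unfolding T2_ab_eq graded2_def by blast
  have \<Phi>': "nf_hom V X FR \<Phi>" using \<Phi> by (simp add: nf_hom2_def)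
  have "hm2 \<Phi> (rel_cls r) \<in> sr_ring_part V X (int \<circ> total_degree) (d + 0)"
    if r: "r \<in> R" "homog_rel (int \<circ> total_degree) d r" for r d
  proof -
    have "homog (int \<circ> total_degree) (d + ((int \<circ> total_degree) a - (int \<circ> total_degree) (chi b))) (\<Phi> r)"
      by (rule homog_if_shift[where D = "rel_degs r"])
        (use r \<Phi>(2) in \<open>auto simp: total_degree_add shifts_def homog_rel_def rel_degs_def\<close>)
    then show ?thesis
      using r nf_homD(1,2)[OF \<Phi>'] assms by (simp add: hm2_apply[OF \<Phi>(1)] ring_part_iff total_degree_chi)
  qed
  moreover have "hm2 \<Phi> \<in> carrier HR" using hm2_mem[OF \<Phi>(1)] .
  ultimately show "t \<in> T2_0 V X"
    unfolding T2_0_def T2_part_def T2_def Q.quot_part \<Phi>(3) by blast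
qed

lemma T2_ab_sub_carrier: "T2_ab V X a b \<subseteq> carrier (sr_T2 V X)"
  by (auto simp: T2_ab_def T2_part_def)

end

section \<open>Relations of the complex and of the link\<close>

text \<open>Replacing \<open>e\<^sub>p\<close> by \<open>x\<^sub>v e\<^bsub>p - v\<^esub>\<close> if \<open>v \<in> p\<close> identifies an element over \<open>X\<close> with a polynomial in \<open>x\<^sub>v\<close> over
  the free module of the link. This is its coefficient of \<open>x\<^sub>v\<^sup>k\<close>.\<close>

definition rel_coef :: "nat \<Rightarrow> nat \<Rightarrow> (nat set \<Rightarrow>\<^sub>0 mpoly) \<Rightarrow> (nat set \<Rightarrow>\<^sub>0 mpoly)" where
  "rel_coef v k = linext (\<lambda>p F. single (p - {v})
     (if v \<in> p then if k = 0 then 0 else coefv v (k - 1) F else coefv v k F))"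

text \<open>The homogenization \<open>e\<^sub>p \<mapsto> e\<^bsub>p \<union> v\<^esub>\<close>, of degree \<open>1\<close> in \<open>x\<^sub>v\<close>.\<close>

definition rel_emb :: "nat \<Rightarrow> (nat set \<Rightarrow>\<^sub>0 mpoly) \<Rightarrow> (nat set \<Rightarrow>\<^sub>0 mpoly)" where
  "rel_emb v = linext (\<lambda>p F. single (insert v p) F)"

lemma rel_coef_0 [simp]: "rel_coef v k 0 = 0" by (simp add: rel_coef_def)
lemma rel_coef_add: "rel_coef v k (r + s) = rel_coef v k r + rel_coef v k s"
  unfolding rel_coef_def by (rule linext_add) (auto simp: coefv_add single_add)
lemma rel_coef_single: "rel_coef v k (single p F) = single (p - {v})
    (if v \<in> p then if k = 0 then 0 else coefv v (k - 1) F else coefv v k F)"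
  unfolding rel_coef_def by (subst linext_single) auto
lemma additive_rel_coef: "Modules.additive (rel_coef v k)" by unfold_locales (rule rel_coef_add)
lemmas rel_coef_diff = additive.diff[OF additive_rel_coef]

lemma rel_emb_0 [simp]: "rel_emb v 0 = 0" by (simp add: rel_emb_def)
lemma rel_emb_add: "rel_emb v (r + s) = rel_emb v r + rel_emb v s"
  unfolding rel_emb_def by (rule linext_add) (auto simp: single_add)
lemma rel_emb_single: "rel_emb v (single p F) = single (insert v p) F"
  unfolding rel_emb_def by (subst linext_single) auto
lemma additive_rel_emb: "Modules.additive (rel_emb v)" by unfold_locales (rule rel_emb_add)
lemmas rel_emb_diff = additive.diff[OF additive_rel_emb]
lemma rel_emb_scal: "rel_emb v (scal F r) = scal F (rel_emb v r)"
  by (rule additive_eqI[where f = "\<lambda>r. rel_emb v (scal F r)" and g = "\<lambda>r. scal F (rel_emb v r)"])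
     (auto simp: scal_add rel_emb_add scal_single rel_emb_single)

lemma rel_coef_mono:
  assumes "finite p"
  shows "rel_coef v k (single p (single m c)) =
    (if k = lookup (m + chi p) v then single (p - {v}) (single (drop_var v m) c) else 0)"
  using assms by (auto simp: rel_coef_single coefv_single lookup_add lookup_chi)

lemma finite_rel_coef: "finite {k. rel_coef v k r \<noteq> 0}"
proof -
  define A where "A p = {k. coefv v k (lookup r p) \<noteq> 0}" for p
  have "rel_coef v k r = 0" if k: "k \<notin> (\<Union>p\<in>keys r. A p \<union> Suc ` A p)" for k
    unfolding rel_coef_def linext_def
  proof (rule sum.neutral, rule ballI)
    fix p assume p: "p \<in> keys r"
    have "coefv v k (lookup r p) = 0" using k p by (auto simp: A_def)
    moreover have "coefv v (k - 1) (lookup r p) = 0" if "k \<noteq> 0"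
    proof (rule ccontr)
      assume "coefv v (k - 1) (lookup r p) \<noteq> 0"
      then have "k \<in> Suc ` A p" using that by (intro image_eqI[of _ _ "k - 1"]) (auto simp: A_def)
      then show False using k p by blast
    qed
    ultimately show "single (p - {v}) (if v \<in> p then if k = 0 then 0 else coefv v (k - 1) (lookup r p) else coefv v k (lookup r p)) = 0"
      by auto
  qed
  then have "{k. rel_coef v k r \<noteq> 0} \<subseteq> (\<Union>p\<in>keys r. A p \<union> Suc ` A p)" by blast
  then show ?thesis by (rule finite_subset) (simp add: finite_coefv A_def)
qed

lemma rel_coef_smult:
  "rel_coef v k (scal (single m c) r) =
    (if lookup m v \<le> k then scal (single (drop_var v m) c) (rel_coef v (k - lookup m v) r) else 0)"
proof (rule additive_eqI[where f = "\<lambda>r. rel_coef v k (scal (single m c) r)" and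
        g = "\<lambda>r. if lookup m v \<le> k then scal (single (drop_var v m) c) (rel_coef v (k - lookup m v) r) else 0"])
  fix p
  let ?F = "lookup r p"
  show "rel_coef v k (scal (single m c) (single p ?F)) =
    (if lookup m v \<le> k then scal (single (drop_var v m) c) (rel_coef v (k - lookup m v) (single p ?F)) else 0)"
    by (auto simp: scal_single rel_coef_single coefv_smult diff_right_commute)
qed (auto simp: scal_add rel_coef_add)

lemma rel_coef_rel_emb:
  assumes "\<And>p. p \<in> keys r \<Longrightarrow> v \<notin> p" "\<And>p. lookup r p \<in> P (V - {v})"
  shows "rel_coef v k (rel_emb v r) = (if k = 1 then r else 0)"
proof (rule additive_eqI[where f = "\<lambda>r. rel_coef v k (rel_emb v r)" and g = "\<lambda>r. if k = 1 then r else 0"])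
  fix p assume "p \<in> keys r"
  then show "rel_coef v k (rel_emb v (single p (lookup r p))) = (if k = 1 then single p (lookup r p) else 0)"
    using assms(1)[of p] coefv_P_id[OF assms(2)[of p]] by (auto simp: rel_emb_single rel_coef_single)
qed (auto simp: rel_coef_add rel_emb_add)

lemma single_sum: "(\<Sum>m\<in>keys F. single p (single m (lookup F m))) = single p F"
proof -
  have "single p (\<Sum>m\<in>S. g m) = (\<Sum>m\<in>S. single p (g m))" for S :: "'b set" and g :: "'b \<Rightarrow> 'b \<Rightarrow>\<^sub>0 'c"
    by (induction S rule: infinite_finite_induct) (auto simp: single_add)
  from this[symmetric] show ?thesis by (simp add: sum_singles)
qed

lemma additive_eqI2:
  fixes r :: "'i \<Rightarrow>\<^sub>0 ('j \<Rightarrow>\<^sub>0 'c::comm_monoid_add)" and f :: "_ \<Rightarrow> 'b::comm_monoid_add"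
  assumes "f 0 = 0" "\<And>F G. f (F + G) = f F + f G" "g 0 = 0" "\<And>F G. g (F + G) = g F + g G"
    and "\<And>p m c. p \<in> keys r \<Longrightarrow> m \<in> keys (lookup r p) \<Longrightarrow> f (single p (single m c)) = g (single p (single m c))"
  shows "f r = g r"
proof (rule additive_eqI[of f g, OF assms(1-4)])
  fix p assume p: "p \<in> keys r"
  show "f (single p (lookup r p)) = g (single p (lookup r p))"
    by (rule additive_eqI[where f = "\<lambda>F. f (single p F)" and g = "\<lambda>F. g (single p F)"])
       (use p in \<open>auto simp: assms single_add\<close>)
qed

lemma present_rel_coef:
  assumes "\<And>p. p \<in> keys r \<Longrightarrow> finite p"
  shows "present sqfree (rel_coef v k r) = coefv v k (present sqfree r)"
  by (rule additive_eqI2[where f = "\<lambda>r. present sqfree (rel_coef v k r)" and g = "\<lambda>r. coefv v k (present sqfree r)"])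
     (use assms in \<open>auto simp: rel_coef_add present_add coefv_add rel_coef_mono sqfree_def mult_single coefv_single drop_var_chi\<close>)

lemma present_rel_emb:
  assumes "\<And>p. p \<in> keys r \<Longrightarrow> finite p \<and> v \<notin> p"
  shows "present sqfree (rel_emb v r) = xv v 1 * present sqfree r"
proof (rule additive_eqI[where f = "\<lambda>r. present sqfree (rel_emb v r)" and g = "\<lambda>r. xv v 1 * present sqfree r"])
  fix p assume "p \<in> keys r"
  then show "present sqfree (rel_emb v (single p (lookup r p))) = xv v 1 * present sqfree (single p (lookup r p))"
    using assms[of p] sqfree_insert[of p v] by (simp add: rel_emb_single mult.left_commute)
qed (auto simp: rel_emb_add present_add algebra_simps)

lemma deh_rel_linext: "deh_rel v = linext (\<lambda>p F. single (p - {v}) (deh v F))"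
  by (simp add: fun_eq_iff deh_rel_def linext_def)

lemma deh_rel_add: "deh_rel v (r + s) = deh_rel v r + deh_rel v s"
  unfolding deh_rel_linext by (rule linext_add) (auto simp: deh_add single_add)
lemma deh_rel_0 [simp]: "deh_rel v 0 = 0" by (simp add: deh_rel_linext)
lemma deh_rel_single: "deh_rel v (single p F) = single (p - {v}) (deh v F)"
  unfolding deh_rel_linext by (subst linext_single) auto

lemma deh_rel_sum:
  assumes "\<And>p. p \<in> keys r \<Longrightarrow> finite p"
  shows "deh_rel v r = (\<Sum>k | rel_coef v k r \<noteq> 0. rel_coef v k r)"
proof (rule additive_eqI2[where f = "deh_rel v" and g = "\<lambda>r. \<Sum>k | rel_coef v k r \<noteq> 0. rel_coef v k r"], goal_cases)
  case (4 F G) show ?case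
    by (rule finite_support_sum_add[where g = "\<lambda>k x. x"]) (auto simp: rel_coef_add finite_rel_coef)
next
  case (5 p m c)
  then show ?case using assms[of p]
    by (subst sum_support_single[where j = "lookup (m + chi p) v" and g = "\<lambda>k x. x"])
      (auto simp: rel_coef_mono deh_rel_single)
qed (auto simp: deh_rel_add)

lemma deh_rel_rel_emb:
  assumes "\<And>p. p \<in> keys r \<Longrightarrow> v \<notin> p" "\<And>p. lookup r p \<in> P (V - {v})"
  shows "deh_rel v (rel_emb v r) = r"
proof (rule additive_eqI[where f = "\<lambda>r. deh_rel v (rel_emb v r)" and g = "\<lambda>r. r"])
  fix p assume "p \<in> keys r"
  then show "deh_rel v (rel_emb v (single p (lookup r p))) = single p (lookup r p)"
    using assms(1)[of p] deh_id[OF assms(2)[of p]] by (simp add: rel_emb_single deh_rel_single)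
qed (auto simp: deh_rel_add rel_emb_add)

text \<open>Replacing \<open>x\<^sub>v e\<^sub>p\<close> by \<open>e\<^bsub>p \<union> v\<^esub>\<close> for \<open>v \<notin> p\<close> changes \<open>x\<^sub>v r\<close> by multiples of the relations of \<open>p\<close> and \<open>p \<union> v\<close>.
  This is the sum of these multiples.\<close>

definition rel_defect :: "nat \<Rightarrow> (nat set \<Rightarrow>\<^sub>0 mpoly) \<Rightarrow> (nat set \<Rightarrow>\<^sub>0 mpoly)" where
  "rel_defect v = linext (\<lambda>p F. scal F (taylor p (insert v p)))"

lemma rel_defect_0 [simp]: "rel_defect v 0 = 0" by (simp add: rel_defect_def)

lemma scal_0_left [simp]: "scal 0 r = 0"
  by (rule poly_mapping_eqI) (simp add: lookup_scal)

lemma rel_defect_add: "rel_defect v (r + s) = rel_defect v r + rel_defect v s"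
  unfolding rel_defect_def by (rule linext_add) (auto simp: add_scal)

lemma rel_defect_single: "rel_defect v (single p F) = scal F (taylor p (insert v p))"
  unfolding rel_defect_def by (subst linext_single) auto

lemma sqfree_empty [simp]: "sqfree {} = 1" by (simp add: sqfree_def)
lemma sqfree_singleton: "sqfree {v} = xv v 1" by (simp add: sqfree_def xv_def chi_def)

text \<open>The analogue of the expansion of a polynomial in powers of \<open>x\<^sub>v\<close>; for \<open>v \<in> p\<close> the relation of \<open>p\<close>
  and \<open>p \<union> v\<close> is \<open>0\<close>, so the defect only sees the generators without \<open>v\<close>.\<close>

lemma xv_smult_rel:
  assumes "\<And>p. p \<in> keys r \<Longrightarrow> finite p"
  shows "scal (xv v 1) r = (\<Sum>k | rel_coef v k r \<noteq> 0. scal (xv v k) (rel_emb v (rel_coef v k r))) + rel_defect v r"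
proof (rule additive_eqI2[where f = "scal (xv v 1)" and
      g = "\<lambda>r. (\<Sum>k | rel_coef v k r \<noteq> 0. scal (xv v k) (rel_emb v (rel_coef v k r))) + rel_defect v r"], goal_cases)
  case (4 F G)
  have "(\<Sum>k | rel_coef v k (F + G) \<noteq> 0. scal (xv v k) (rel_emb v (rel_coef v k (F + G)))) =
    (\<Sum>k | rel_coef v k F \<noteq> 0. scal (xv v k) (rel_emb v (rel_coef v k F))) + (\<Sum>k | rel_coef v k G \<noteq> 0. scal (xv v k) (rel_emb v (rel_coef v k G)))"
    by (rule finite_support_sum_add[where g = "\<lambda>k x. scal (xv v k) (rel_emb v x)"]) (auto simp: rel_coef_add finite_rel_coef rel_emb_add scal_add)
  then show ?case by (simp add: rel_defect_add algebra_simps)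
next
  case (5 p m c)
  then have p: "finite p" using assms by auto
  let ?r = "single p (single m c)" and ?k = "lookup (m + chi p) v"
  have "(\<Sum>k | rel_coef v k ?r \<noteq> 0. scal (xv v k) (rel_emb v (rel_coef v k ?r))) = scal (xv v ?k) (rel_emb v (rel_coef v ?k ?r))"
    by (rule sum_support_single[where g = "\<lambda>k x. scal (xv v k) (rel_emb v x)"]) (auto simp: rel_coef_mono p)
  also have "\<dots> = single (insert v p) (xv v ?k * single (drop_var v m) c)"
    by (simp add: rel_coef_mono p rel_emb_single scal_single)
  also have "xv v ?k * single (drop_var v m) c = (if v \<in> p then xv v 1 else 1) * single m c"
  proof -
    have "xv v (lookup m v) * single (drop_var v m) c = single m c"
      by (simp add: xv_def mult_single add.commute[of "single _ _"] drop_var_restore)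
    then show ?thesis by (simp add: lookup_add lookup_chi p xv_add mult.assoc mult.commute[of _ "xv v 1"] del: One_nat_def)
  qed
  finally have S: "(\<Sum>k | rel_coef v k ?r \<noteq> 0. scal (xv v k) (rel_emb v (rel_coef v k ?r))) =
      single (insert v p) ((if v \<in> p then xv v 1 else 1) * single m c)" .
  show ?case unfolding S
    by (cases "v \<in> p") (simp_all add: rel_defect_single taylor_def scal_diff scal_single insert_absorb sqfree_singleton
        mult.commute[of "single m c"] insert_Diff_if)
qed (auto simp: scal_add)

lemma rel_degs_taylor:
  assumes "finite p" "finite q" "d \<in> rel_degs (taylor p q)"
  shows "d = chi (p \<union> q)"
proof -
  show ?thesis
  proof (cases "p = q")
    case True
    then show ?thesis using assms(3) by (simp add: taylor_def rel_degs_def)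
  next
    case False
    have *: "m = chi (q - p) \<and> s = p \<or> m = chi (p - q) \<and> s = q" if "m \<in> keys (lookup (taylor p q) s)" for m s
      using that False unfolding taylor_def sqfree_def by (auto simp: lookup_minus lookup_single when_def in_keys_iff split: if_splits)
    have "chi (q - p) + chi p = chi (p \<union> q)" "chi (p - q) + chi q = chi (p \<union> q)"
      using assms chi_Un_disjoint[of "q - p" p] chi_Un_disjoint[of "p - q" q] by (simp_all add: Un_commute Int_commute)
    then show ?thesis using * assms(3) by (auto simp: rel_degs_def)
  qed
qed

lemma rel_degs_rel_emb:
  assumes "d \<in> rel_degs (rel_emb v r)" "\<And>p. p \<in> keys r \<Longrightarrow> finite p \<and> v \<notin> p" "\<And>p. lookup r p \<in> P (V - {v})"
  shows "lookup d v = 1 \<and> drop_var v d \<in> rel_degs r"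
proof -
  obtain p m where pm: "p \<in> keys r" "m \<in> keys (lookup r p)" "d = m + chi (insert v p)"
    using rel_degs_linext[where \<phi> = "insert v" and h = "\<lambda>p F. F"] assms(1) unfolding rel_emb_def by blast
  have vm: "v \<notin> keys m" using pm(2) assms(3)[of p] by (auto simp: P_iff)
  have "lookup d v = 1" using vm assms(2)[OF pm(1)] by (simp add: pm(3) lookup_add lookup_chi in_keys_iff)
  moreover have "drop_var v d = m + chi p"
    using vm assms(2)[OF pm(1)] by (simp add: pm(3) drop_var_chi drop_var_idem)
  ultimately show ?thesis using pm by (auto simp: rel_degs_def)
qed

lemma rel_degs_rel_coef:
  assumes "d \<in> rel_degs (rel_coef v k r)" "\<And>p. p \<in> keys r \<Longrightarrow> finite p"
  shows "d + single v k \<in> rel_degs r"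
proof -
  obtain p m where pm: "p \<in> keys r" "d = m + chi (p - {v})"
     "m \<in> keys (if v \<in> p then if k = 0 then 0 else coefv v (k - 1) (lookup r p) else coefv v k (lookup r p))"
    using rel_degs_linext[where \<phi> = "\<lambda>p. p - {v}" and h = "\<lambda>p F. if v \<in> p then if k = 0 then 0 else coefv v (k - 1) F else coefv v k F"]
      assms(1) unfolding rel_coef_def by blast
  have fin: "finite p" using assms(2) pm(1) by blast
  show ?thesis
  proof (cases "v \<in> p")
    case True
    then have k: "k \<noteq> 0" and m: "m \<in> keys (coefv v (k - 1) (lookup r p))" using pm(3) by (auto split: if_splits)
    have k1: "single v k = single v (k - 1) + single v (1::nat)" using k by (simp flip: single_add)
    have p1: "chi (p - {v}) + single v 1 = chi p"
      using chi_Un_disjoint[of "p - {v}" "{v}"] fin True by (simp add: chi_def insert_absorb)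
    have "d + single v k = (m + single v (k - 1)) + (chi (p - {v}) + single v 1)"
      unfolding pm(2) k1 by (simp only: ac_simps)
    then have "d + single v k = (m + single v (k - 1)) + chi p" unfolding p1 .
    then show ?thesis using keys_coefv(1)[OF m] pm(1) by (auto simp: rel_degs_def)
  next
    case False
    then have "d + single v k = (m + single v k) + chi p" using pm(2) by (simp add: ac_simps)
    moreover have "m + single v k \<in> keys (lookup r p)" using keys_coefv(1) pm(3) False by simp
    ultimately show ?thesis using pm(1) by (auto simp: rel_degs_def)
  qed
qed

lemma (in stanley_reisner) FM_fin: "r \<in> carrier FM \<Longrightarrow> p \<in> keys r \<Longrightarrow> finite p"
  using nonface_finite by (auto simp: carrier_FM)

lemma (in stanley_reisner) FM_induct:
  assumes r: "r \<in> carrier FM" and "Q 0" "\<And>r s. Q r \<Longrightarrow> Q s \<Longrightarrow> Q (r + s)"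
    and "\<And>p m c. p \<in> J \<Longrightarrow> keys m \<subseteq> V \<Longrightarrow> Q (single p (single m c))"
  shows "Q r"
proof -
  have "Q (single p (single m c))" if "p \<in> keys r" "m \<in> keys (lookup r p)" for p m c
    using r that unfolding carrier_FM P_iff by (intro assms(4)) blast+
  then have "(\<Sum>p\<in>keys r. \<Sum>m\<in>keys (lookup r p). single p (single m (lookup (lookup r p) m))) \<in> {r. Q r}"
    by (intro sum_mem) (simp_all add: assms(2,3))
  then show ?thesis by (simp add: single_sum sum_singles)
qed

lemma (in stanley_reisner) taylor_R: assumes "p \<in> J" "q \<in> J" shows "taylor p q \<in> R"
proof -
  have fin: "finite p" "finite q" and sub: "p \<subseteq> V" "q \<subseteq> V"
    using assms nonface_finite by (auto simp: nonfaces_def)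
  have "sqfree (q - p) \<in> P V" "sqfree (p - q) \<in> P V" using fin sub by (auto intro!: sqfree_P)
  then have "taylor p q \<in> carrier FM"
    unfolding taylor_def using assms by (intro FM.diff_mem single_FM) auto
  moreover have "sqfree (q - p) * sqfree p = sqfree (p \<union> q)" "sqfree (p - q) * sqfree q = sqfree (p \<union> q)"
    using fin sqfree_mult[of "q - p" p] sqfree_mult[of "p - q" q] by (simp_all add: Un_commute Int_commute)
  then have "present sqfree (taylor p q) = 0" by (simp add: taylor_def present_diff)
  ultimately show ?thesis unfolding R_iff by blast
qed

section \<open>Localization of the second cotangent module\<close>

context stanley_reisner_vertex begin

lemma L_FM:
  assumes r: "r \<in> carrier L.FM"
  shows "p \<in> keys r \<Longrightarrow> finite p \<and> v \<notin> p" "p \<in> keys r \<Longrightarrow> insert v p \<in> J" "lookup r p \<in> P W"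
proof -
  have J: "p \<in> keys r \<Longrightarrow> p \<in> L.J" using r unfolding L.carrier_FM by blast
  show "p \<in> keys r \<Longrightarrow> insert v p \<in> J" using J insert_v_nonface by blast
  show "p \<in> keys r \<Longrightarrow> finite p \<and> v \<notin> p" using J L.nonface_finite[of p] by (auto simp: nonfaces_def)
  show "lookup r p \<in> P W" using r unfolding L.carrier_FM by blast
qed

lemma nonface_minus_v: "p \<in> J \<Longrightarrow> p - {v} \<in> L.J"
  using down_closedD[OF down, of "insert v (p - {v})" p] by (auto simp: nonfaces_def link_def)

lemma rel_coef_FM: assumes r: "r \<in> carrier FM" shows "rel_coef v k r \<in> carrier L.FM"
  unfolding rel_coef_def linext_def
proof (rule L.FM.sum_carrier)
  fix p assume "p \<in> keys r"
  then show "single (p - {v}) (if v \<in> p then if k = 0 then 0 else coefv v (k - 1) (lookup r p) else coefv v k (lookup r p)) \<in> carrier L.FM"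
    using r by (intro L.single_FM nonface_minus_v) (auto simp: carrier_FM coefv_P)
qed

lemma rel_emb_FM: assumes r: "r \<in> carrier L.FM" shows "rel_emb v r \<in> carrier FM"
  unfolding rel_emb_def linext_def
  using L_FM[OF r] P_mono[of W V] by (intro FM.sum_carrier single_FM) blast+

lemma vertex_loc_FM: "vertex_loc V X v FM L.FM (rel_coef v) (rel_emb v) rel_degs rel_degs"
proof (intro vertex_loc.intro vertex_loc_axioms.intro stanley_reisner_axioms FM.poly_module_axioms L.FM.poly_module_axioms v, goal_cases)
  case (8 y k) then show ?case using rel_coef_rel_emb L_FM[OF 8] by blast
next
  case (9 y d) then show ?case using rel_degs_rel_emb L_FM[OF 9(1)] by blast
next
  case (10 x d k) then show ?case using rel_degs_rel_coef FM_fin by blast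
qed (auto simp: rel_coef_add finite_rel_coef rel_coef_smult rel_emb_add rel_emb_scal rel_coef_FM rel_emb_FM)

text \<open>The free modules and the relations share the maps \<open>rel_coef\<close> and \<open>rel_emb\<close>. For this reason, localization
  and extension of a homomorphism on the relations are compatible with coboundaries.\<close>

lemma vertex_loc_FR: "vertex_loc V X v FR L.FR (rel_coef v) (rel_emb v) rel_degs rel_degs"
proof (intro vertex_loc.intro vertex_loc_axioms.intro stanley_reisner_axioms FR.poly_module_axioms L.FR.poly_module_axioms v, goal_cases)
  case (2 x k) then show ?case
    using rel_coef_FM present_rel_coef[of x v k] FM_fin by (auto simp: R_iff L.R_iff)
next
  case (6 y)
  then have "y \<in> L.R" by simp
  then have y: "y \<in> carrier L.FM" "present sqfree y = 0" unfolding L.R_iff by blast+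
  have "present sqfree (rel_emb v y) = 0" using present_rel_emb[of y v] L_FM(1)[OF y(1)] y(2) by simp
  then have "rel_emb v y \<in> R" unfolding R_iff using rel_emb_FM[OF y(1)] by blast
  then show ?case by simp
next
  case (8 y k)
  then have "y \<in> carrier L.FM" by (simp add: L.R_iff)
  then show ?case by (intro rel_coef_rel_emb) (use L_FM in blast)+
next
  case (9 y d)
  then have "y \<in> carrier L.FM" by (simp add: L.R_iff)
  then show ?case by (intro rel_degs_rel_emb 9(2)) (use L_FM in blast)+
next
  case (10 x d k)
  then have "x \<in> carrier FM" by (simp add: R_iff)
  then show ?case by (intro rel_degs_rel_coef 10(2)) (use FM_fin in blast)
qed (auto simp: rel_coef_add finite_rel_coef rel_coef_smult rel_emb_add rel_emb_scal)

sublocale VF: vertex_loc V X v FM L.FM "rel_coef v" "rel_emb v" rel_degs rel_degs by (rule vertex_loc_FM)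
sublocale VR: vertex_loc V X v FR L.FR "rel_coef v" "rel_emb v" rel_degs rel_degs by (rule vertex_loc_FR)

lemma koszul_rel_rel_emb:
  assumes "e \<in> carrier L.FM" "f \<in> carrier L.FM"
  shows "scal (xv v 1) (rel_emb v (L.koszul_rel e f)) = koszul_rel (rel_emb v e) (rel_emb v f)"
  using present_rel_emb[of e v] present_rel_emb[of f v] L_FM[OF assms(1)] L_FM[OF assms(2)]
  by (simp add: L.koszul_rel_def koszul_rel_def rel_emb_diff rel_emb_scal scal_diff mult_scal)

text \<open>Homogenized Koszul relations of the link become Koszul relations after multiplication by \<open>x\<^sub>v\<close>, because
  \<open>x\<^bsup>p \<union> v\<^esup> = x\<^sub>v x\<^sup>p\<close>. This is enough, since \<open>x\<^sub>v\<close> is set to \<open>1\<close> afterwards.\<close>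

lemma rel_emb_K: assumes "k \<in> L.K" shows "scal (xv v 1) (rel_emb v k) \<in> K"
proof (rule L.koszul_induct(2)[OF assms], goal_cases)
  case (1 e f) then show ?case by (simp only: koszul_rel_rel_emb K_props rel_emb_FM)
next
  case 2 show ?case using K_props(1) by simp
next
  case (3 r s) then show ?case by (simp only: rel_emb_add scal_add K_props)
next
  case (4 F r)
  have "scal (xv v 1) (rel_emb v (scal F r)) = scal F (scal (xv v 1) (rel_emb v r))"
    by (simp only: rel_emb_scal mult.commute flip: mult_scal)
  moreover have "F \<in> P V" using 4(1) P_mono[of W V] by blast
  ultimately show ?case using 4 by (simp only: K_props)
qed

lemma koszul_rel_add: "koszul_rel (e + e') f = koszul_rel e f + koszul_rel e' f" "koszul_rel e (f + f') = koszul_rel e f + koszul_rel e f'"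
  by (simp_all add: koszul_rel_def scal_add add_scal present_add)

text \<open>Homogeneous elements have only one coefficient, and the Koszul relation of two of them is
  mapped to the Koszul relation of their coefficients.\<close>

lemma koszul_rel_mono:
  assumes "p \<in> J" "q \<in> J" "keys m \<subseteq> V" "keys n \<subseteq> V"
  shows "rel_coef v k (koszul_rel (single p (single m c)) (single q (single n d))) \<in> L.K"
proof -
  let ?e = "single p (single m c)" and ?f = "single q (single n d)"
  let ?e' = "single (p - {v}) (single (drop_var v m) c)" and ?f' = "single (q - {v}) (single (drop_var v n) d)"
  let ?i = "lookup (m + chi p) v" and ?j = "lookup (n + chi q) v"
  have fin: "finite p" "finite q" using assms nonface_finite by auto
  have pr: "present sqfree ?e = single (m + chi p) c" "present sqfree ?f = single (n + chi q) d"
    "present sqfree ?e' = single (drop_var v (m + chi p)) c" "present sqfree ?f' = single (drop_var v (n + chi q)) d"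
    using fin by (auto simp: sqfree_def mult_single drop_var_chi)
  have ef: "?e' \<in> carrier L.FM" "?f' \<in> carrier L.FM"
    using assms nonface_minus_v by (auto intro!: L.single_FM)
  have "rel_coef v k (scal (single (n + chi q) d) ?e) = (if k = ?i + ?j then scal (single (drop_var v (n + chi q)) d) ?e' else 0)"
    unfolding rel_coef_smult rel_coef_mono[OF fin(1)] by (auto simp del: map_single)
  moreover have "rel_coef v k (scal (single (m + chi p) c) ?f) = (if k = ?i + ?j then scal (single (drop_var v (m + chi p)) c) ?f' else 0)"
    unfolding rel_coef_smult rel_coef_mono[OF fin(2)] by (auto simp del: map_single)
  ultimately have "rel_coef v k (koszul_rel ?e ?f) = (if k = ?i + ?j then L.koszul_rel ?e' ?f' else 0)"
    unfolding koszul_rel_def L.koszul_rel_def rel_coef_diff pr by (simp del: map_single drop_var_add)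
  then show ?thesis using L.K_props ef by simp
qed

text \<open>Bilinearity of Koszul relations reduces the claim to elements with one term.\<close>

lemma rel_coef_K: assumes "r \<in> K" shows "rel_coef v k r \<in> L.K"
proof (rule koszul_induct(2)[OF assms, where Q = "\<lambda>r. \<forall>k. rel_coef v k r \<in> L.K", THEN spec], goal_cases)
  case (1 e f)
  have "\<forall>k. rel_coef v k (koszul_rel e (single q (single n d))) \<in> L.K" if "q \<in> J" "keys n \<subseteq> V" for q n d
    by (rule FM_induct[OF 1(1)])
      (use that koszul_rel_mono L.K_props in \<open>auto simp: koszul_rel_add rel_coef_add koszul_rel_def[of 0]\<close>)
  then show ?case
    by (intro FM_induct[OF 1(2), where Q = "\<lambda>f. \<forall>k. rel_coef v k (koszul_rel e f) \<in> L.K"])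
      (use L.K_props in \<open>auto simp: koszul_rel_add rel_coef_add koszul_rel_def[of _ 0]\<close>)
next
  case (4 F r)
  have r: "r \<in> carrier FM" by (rule 4(2))
  have "\<forall>k. rel_coef v k (scal (single m c) r) \<in> L.K" if "keys m \<subseteq> V" for m c
  proof -
    have "single (drop_var v m) c \<in> P W" using that by auto
    then show ?thesis using 4(3) L.K_props by (simp add: rel_coef_smult)
  qed
  then have "\<forall>k. (\<Sum>m\<in>keys F. rel_coef v k (scal (single m (lookup F m)) r)) \<in> L.K"
    using 4(1) by (intro allI sum_mem L.K_props) (auto simp: P_iff)
  moreover have "rel_coef v k (scal F r) = (\<Sum>m\<in>keys F. rel_coef v k (scal (single m (lookup F m)) r))" for k
    using additive_sum_singles[of "\<lambda>F. rel_coef v k (scal F r)" F] by (simp add: add_scal rel_coef_add)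
  ultimately show ?case by simp
qed (use L.K_props in \<open>auto simp: rel_coef_add\<close>)

lemma nf_hom2_loc:
  assumes "nf_hom2 \<Phi>"
  shows "L.nf_hom2 (VR.loc \<Phi>)"
proof -
  have \<Phi>: "nf_hom V X FR \<Phi>" "\<And>k. k \<in> K \<Longrightarrow> \<Phi> k = 0" using assms by (auto simp: nf_hom2_def)
  have "VR.loc \<Phi> k = 0" if k: "k \<in> L.K" for k
  proof -
    have "rel_emb v k \<in> carrier FR" using VR.emb_mem[of k] L.K_R[OF k] by simp
    from VR.nf_deh_smult_xv[OF \<Phi>(1) this, of 1] show ?thesis
      using \<Phi>(2)[OF rel_emb_K[OF k]] by (simp add: VR.loc_def)
  qed
  then show ?thesis using VR.nf_hom_loc[OF \<Phi>(1)] by (simp add: L.nf_hom2_def)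
qed

lemma nf_hom2_ext:
  assumes "L.nf_hom2 \<Psi>" and e: "e > 0"
  shows "nf_hom2 (VR.ext e \<Psi>)"
proof -
  have \<Psi>: "nf_hom W lk L.FR \<Psi>" "\<And>k. k \<in> L.K \<Longrightarrow> \<Psi> k = 0" using assms by (auto simp: L.nf_hom2_def)
  have "VR.ext e \<Psi> k = 0" if k: "k \<in> K" for k
    using \<Psi>(2)[OF rel_coef_K[OF k]] by (simp add: VR.ext_def)
  then show ?thesis using VR.nf_hom_ext[OF \<Psi>(1) e] by (simp add: nf_hom2_def)
qed

text \<open>The localization map of \<open>T\<^sup>2\<close> is the construction \<open>loc\<close>. It is evaluated on relations between generators that
  contain \<open>v\<close>, and for these the defect vanishes.\<close>

lemma loc2_hom_hm2:
  assumes \<Phi>: "nf_hom2 \<Phi>"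
  shows "loc2_hom V X v (hm2 \<Phi>) = L.hm2 (VR.loc \<Phi>)"
proof (rule ext)
  fix C
  have \<Phi>': "nf_hom V X FR \<Phi>" using \<Phi> by (simp add: nf_hom2_def)
  note L\<Phi> = nf_hom2_loc[OF \<Phi>]
  show "loc2_hom V X v (hm2 \<Phi>) C = L.hm2 (VR.loc \<Phi>) C"
  proof (cases "C \<in> carrier L.REL")
    case True
    then obtain s where s: "s \<in> L.R" "C = L.rel_cls s" by (auto simp: L.carrier_REL)
    let ?S = "{r \<in> R. (\<forall>p\<in>keys r. v \<in> p) \<and> deh_rel v r \<in> C}"
    have *: "deh v ` hm2 \<Phi> (rel_cls r) = L.cls (VR.loc \<Phi> s)" if "r \<in> ?S" for r
    proof -
      have r: "r \<in> R" "\<And>p. p \<in> keys r \<Longrightarrow> v \<in> p" "deh_rel v r \<in> L.rel_cls s" using that s(2) by auto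
      have fin: "p \<in> keys r \<Longrightarrow> finite p" for p using FM_fin R_FM r(1) by blast
      have "rel_defect v r = 0"
        unfolding rel_defect_def linext_def using r(2) by (intro sum.neutral) (auto simp: taylor_def insert_absorb)
      then have xr: "scal (xv v 1) r = (\<Sum>k | rel_coef v k r \<noteq> 0. scal (xv v k) (rel_emb v (rel_coef v k r)))"
        using xv_smult_rel[OF fin, of r v] by simp
      have "nf lk (deh v (\<Phi> r)) = VR.loc \<Phi> (deh_rel v r)"
        by (rule VR.nf_deh_eq_loc[OF \<Phi>']) (use r(1) xr deh_rel_sum[OF fin, of r v] in simp_all)
      also have "\<dots> = VR.loc \<Phi> s" by (rule L.nf_hom2_const[OF L\<Phi> s(1) r(3)])
      finally have eq: "nf lk (deh v (\<Phi> r)) = VR.loc \<Phi> s" .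
      have m: "\<Phi> r \<in> P V" "VR.loc \<Phi> s \<in> P W" "nf lk (VR.loc \<Phi> s) = VR.loc \<Phi> s"
        using nf_homD(1)[OF \<Phi>', of r] nf_homD(1,2)[OF VR.nf_hom_loc[OF \<Phi>'], of s] r(1) s(1) by simp_all
      have "L.cls (deh v (\<Phi> r)) = L.cls (VR.loc \<Phi> s)"
        unfolding L.cls_eq_iff[OF deh_P[OF m(1)] m(2)] eq by (rule m(3)[symmetric])
      then show ?thesis by (simp only: hm2_apply[OF \<Phi> r(1)] deh_image_cls[OF v m(1)])
    qed
    have ne: "rel_emb v s \<in> ?S"
    proof -
      have s': "s \<in> carrier L.FM" using L.R_FM[OF s(1)] .
      have "deh_rel v (rel_emb v s) = s" by (rule deh_rel_rel_emb) (use L_FM[OF s'] in auto)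
      moreover have "v \<in> p" if pk: "p \<in> keys (rel_emb v s)" for p
      proof -
        obtain q where "p \<in> keys (single (insert v q) (lookup s q))"
          using pk keys_sum[of "\<lambda>q. single (insert v q) (lookup s q)" "keys s"] unfolding rel_emb_def linext_def by blast
        then show ?thesis by (auto split: if_splits)
      qed
      moreover have "rel_emb v s \<in> R" using VR.emb_mem[of s] s(1) by simp
      ultimately show ?thesis using L.rel_cls_self s(2) by simp
    qed
    have "(\<Union>r\<in>?S. deh v ` hm2 \<Phi> (rel_cls r)) = L.cls (VR.loc \<Phi> s)"
    proof (rule SUP_eq_const)
      show "?S \<noteq> {}" using ne by blast
    qed (rule *)
    then show ?thesis using True L.hm2_apply[OF L\<Phi> s(1)] s(2) by (simp add: loc2_hom_def)
  qed (simp add: loc2_hom_def to_hom_def)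
qed

lemma coset_map_T2: "coset_map (poly_ring V) HR cob_homs (poly_ring W) L.HR L.cob_homs (loc2_hom V X v)"
proof (intro coset_map.intro coset_map_axioms.intro quotient_T2 L.quotient_T2)
  fix f assume "f \<in> carrier HR"
  then obtain \<Phi> where \<Phi>: "nf_hom2 \<Phi>" "f = hm2 \<Phi>" by (rule ex_lift2)
  show "loc2_hom V X v f \<in> carrier L.HR"
    unfolding \<Phi>(2) loc2_hom_hm2[OF \<Phi>(1)] by (rule L.hm2_mem[OF nf_hom2_loc[OF \<Phi>(1)]])
next
  fix f g assume f: "f \<in> carrier HR" and g: "g \<in> carrier HR"
  obtain \<Phi> where \<Phi>: "nf_hom2 \<Phi>" "f = hm2 \<Phi>" by (rule ex_lift2[OF f])
  obtain \<Psi> where \<Psi>: "nf_hom2 \<Psi>" "g = hm2 \<Psi>" by (rule ex_lift2[OF g])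
  have "VR.loc (\<lambda>x. \<Phi> x + \<Psi> x) = (\<lambda>x. VR.loc \<Phi> x + VR.loc \<Psi> x)"
    by (simp add: VR.loc_def fun_eq_iff deh_add nf_add)
  then show "loc2_hom V X v (f \<oplus>\<^bsub>HR\<^esub> g) = loc2_hom V X v f \<oplus>\<^bsub>L.HR\<^esub> loc2_hom V X v g"
    by (simp only: \<Phi> \<Psi> hm2_add nf_hom2_add loc2_hom_hm2 L.hm2_add nf_hom2_loc)
next
  fix f assume "f \<in> cob_homs"
  then obtain \<eta> where \<eta>: "nf_hom V X FM \<eta>" "f = hm2 \<eta>" unfolding mem_cob_homs by blast
  show "loc2_hom V X v f \<in> L.cob_homs"
    unfolding \<eta>(2) loc2_hom_hm2[OF nf_hom_FM_R[OF \<eta>(1)]] L.mem_cob_homs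
    using VF.nf_hom_loc[OF \<eta>(1)] by blast
qed

lemma loc2_coset:
  assumes "nf_hom2 \<Phi>"
  shows "loc2 V X v (cob_homs +>\<^bsub>HR\<^esub> hm2 \<Phi>) = L.cob_homs +>\<^bsub>L.HR\<^esub> L.hm2 (VR.loc \<Phi>)"
proof -
  interpret C: coset_map "poly_ring V" HR cob_homs "poly_ring W" L.HR L.cob_homs "loc2_hom V X v"
    by (rule coset_map_T2)
  have "loc2 V X v t = C.cmap t" for t
    by (simp add: loc2_def C.cmap_def T2_def quot_module_def)
  then show ?thesis using C.cmap_coset[OF hm2_mem[OF assms]] by (simp only: loc2_hom_hm2[OF assms])
qed

lemma loc2_T2_ab:
  assumes "finite b" "t \<in> T2_ab V X a b"
  shows "loc2 V X v t \<in> T2_ab W lk (drop_var v a) (b - {v})"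
proof -
  obtain \<Phi> where \<Phi>: "nf_hom2 \<Phi>" "shifts a b FR rel_degs \<Phi>" "t = cob_homs +>\<^bsub>HR\<^esub> hm2 \<Phi>"
    using assms unfolding T2_ab_eq graded2_def by blast
  have "L.hm2 (VR.loc \<Phi>) \<in> L.graded2 (drop_var v a) (b - {v})"
    using nf_hom2_loc[OF \<Phi>(1)] VR.shifts_loc[OF \<Phi>(2) assms(1)] unfolding L.graded2_def by blast
  then show ?thesis unfolding \<Phi>(3) loc2_coset[OF \<Phi>(1)] L.T2_ab_eq by blast
qed

end

text \<open>Division by \<open>x\<^sub>v\<close>.\<close>

definition div_var :: "nat \<Rightarrow> mpoly \<Rightarrow> mpoly" where
  "div_var v = linext (\<lambda>m c. single (m - single v 1) c)"

lemma xv_div_var: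
  assumes "\<And>m. m \<in> keys G \<Longrightarrow> v \<in> keys m"
  shows "xv v 1 * div_var v G = G"
proof (rule additive_eqI[where f = "\<lambda>G. xv v 1 * div_var v G" and g = "\<lambda>G. G"])
  fix m assume "m \<in> keys G"
  then have "0 < lookup m v" using assms[of m] by (simp add: in_keys_iff)
  then have "single v 1 + (m - single v 1) = m"
    by (intro poly_mapping_eqI) (auto simp: lookup_add lookup_minus lookup_single when_def)
  then show "xv v 1 * div_var v (single m (lookup G m)) = single m (lookup G m)"
    by (simp add: div_var_def linext_single xv_def mult_single)
qed (auto simp: div_var_def linext_add single_add distrib_left)

lemma keys_div_var: "n \<in> keys (div_var v G) \<Longrightarrow> \<exists>m\<in>keys G. n = m - single v 1"
proof -
  assume "n \<in> keys (div_var v G)"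
  then obtain m where "m \<in> keys G" "n \<in> keys (single (m - single v 1) (lookup G m))"
    unfolding div_var_def linext_def using keys_sum by fastforce
  then show ?thesis by (auto split: if_splits)
qed

text \<open>Homomorphisms on the free module may be prescribed on the basis.\<close>

lemma (in stanley_reisner) nf_hom_present:
  assumes "\<And>p. p \<in> J \<Longrightarrow> \<eta> p \<in> P V"
  shows "nf_hom V X FM (\<lambda>r. nf X (present \<eta> r))"
proof -
  have "present \<eta> r \<in> P V" if "r \<in> carrier FM" for r
    unfolding present_def using that assms by (intro P_sum P_mult) (auto simp: carrier_FM)
  then show ?thesis
    unfolding nf_hom_def by (auto simp: present_add present_scal nf_add nf_mult_nf[OF down])
qed

context stanley_reisner_vertex begin

text \<open>Applying a homogeneous \<open>\<Phi>\<close> to the expansion of \<open>x\<^sub>v r\<close> shows that \<open>x\<^sub>v\<close> times the difference of \<open>\<Phi>\<close> and the extension of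
  its localization is \<open>\<Phi>\<close> of the defect. As \<open>x\<^sub>v\<^sup>2\<close> divides the values on the relations \<open>taylor p (insert v p)\<close>, these can be divided by \<open>x\<^sub>v\<close>
  without leaving the multiples of \<open>x\<^sub>v\<close>, and the quotients
  define the coboundary \<open>\<theta>\<close>.\<close>

lemma ext_loc2:
  assumes \<Phi>: "nf_hom2 \<Phi>" "shifts a b FR rel_degs \<Phi>" and b: "finite b" "v \<notin> b" and a: "v \<in> keys a"
  obtains \<theta> where "nf_hom V X FM \<theta>" "\<And>r. r \<in> R \<Longrightarrow> \<Phi> r = VR.ext (lookup a v) (VR.loc \<Phi>) r + \<theta> r"
proof
  have \<Phi>': "nf_hom V X FR \<Phi>" using \<Phi>(1) by (simp add: nf_hom2_def)
  define \<tau> where "\<tau> p = taylor p (insert v p)" for p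
  define \<eta> where "\<eta> p = div_var v (\<Phi> (\<tau> p))" for p
  have \<tau>R: "\<tau> p \<in> R" if "p \<in> J" for p
    unfolding \<tau>_def using that v nonface_superset[OF that, of "insert v p"] by (intro taylor_R) (auto simp: nonfaces_def)
  \<comment> \<open>the relation of \<open>p\<close> and \<open>p \<union> v\<close> has degree \<open>1\<close> in \<open>x\<^sub>v\<close>, and \<open>\<Phi>\<close> adds the entry of \<open>a\<close>\<close>
  have vk: "lookup m v = Suc (lookup a v)" if p: "p \<in> J" and m: "m \<in> keys (\<Phi> (\<tau> p))" for p m
  proof -
    obtain d where d: "d \<in> rel_degs (\<tau> p)" "m + chi b = d + a"
      using \<Phi>(2) \<tau>R[OF p] m unfolding shifts_def by auto
    have fin: "finite p" "finite (insert v p)" using nonface_finite[OF p] by auto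
    have "d = chi (insert v p)" using rel_degs_taylor[OF fin] d(1) by (simp add: \<tau>_def Un_absorb1 subset_insertI)
    moreover have "lookup m v + lookup (chi b) v = lookup d v + lookup a v" using d(2) by (metis lookup_add)
    ultimately show ?thesis using b fin by (simp add: lookup_chi)
  qed
  have xv\<eta>: "xv v 1 * \<eta> p = \<Phi> (\<tau> p)" if "p \<in> J" for p
    unfolding \<eta>_def by (rule xv_div_var) (use vk[OF that] in \<open>simp add: in_keys_iff\<close>)
  have \<eta>P: "\<eta> p \<in> P V" if p: "p \<in> J" for p
    unfolding P_iff
  proof
    fix n assume "n \<in> keys (\<eta> p)"
    then obtain m where m: "m \<in> keys (\<Phi> (\<tau> p))" "n = m - single v 1" using keys_div_var unfolding \<eta>_def by blast
    have "keys n \<subseteq> keys m" unfolding m(2) by (auto simp: in_keys_iff lookup_minus)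
    moreover have "keys m \<subseteq> V" using nf_homD(1)[OF \<Phi>', of "\<tau> p"] \<tau>R[OF p] m(1) by (auto simp: P_iff)
    ultimately show "keys n \<subseteq> V" by blast
  qed
  have \<eta>v: "v \<in> keys n" if p: "p \<in> J" and n: "n \<in> keys (\<eta> p)" for p n
  proof -
    obtain m where m: "m \<in> keys (\<Phi> (\<tau> p))" "n = m - single v 1" using keys_div_var n unfolding \<eta>_def by blast
    then show ?thesis using vk[OF p m(1)] a by (simp add: in_keys_iff lookup_minus)
  qed
  let ?\<theta> = "\<lambda>r. nf X (present \<eta> r)"
  show "nf_hom V X FM ?\<theta>" by (rule nf_hom_present[OF \<eta>P])
  fix r assume r: "r \<in> R"
  have rJ: "p \<in> J" "lookup r p \<in> P V" if "p \<in> keys r" for p using r that by (auto simp: R_iff carrier_FM)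
  have fin: "p \<in> keys r \<Longrightarrow> finite p" for p using rJ nonface_finite by blast
  let ?E = "VR.ext (lookup a v) (VR.loc \<Phi>) r"
  let ?s = "\<Sum>k | rel_coef v k r \<noteq> 0. scal (xv v k) (rel_emb v (rel_coef v k r))"
  have "nf X (xv v 1 * \<Phi> r) = \<Phi> (scal (xv v 1) r)" using nf_homD(4)[OF \<Phi>', of "xv v 1" r] r v by simp
  also have "scal (xv v 1) r = ?s + rel_defect v r" by (rule xv_smult_rel[OF fin])
  also have "\<Phi> (?s + rel_defect v r) = \<Phi> ?s + \<Phi> (rel_defect v r)"
  proof (rule FR.nf_hom_plus[OF \<Phi>'])
    have "scal (xv v k) (rel_emb v (rel_coef v k r)) \<in> R" for k
      using R_scal[OF P_xv[OF v]] VR.emb_mem VR.comp_mem r by simp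
    then show "?s \<in> carrier FR" by (intro FR.sum_carrier) simp
    show "rel_defect v r \<in> carrier FR"
      unfolding rel_defect_def linext_def using \<tau>R rJ R_scal by (intro FR.sum_carrier) (simp add: \<tau>_def)
  qed
  also have "\<Phi> ?s = nf X (xv v 1 * ?E)"
    using VR.ext_loc[OF \<Phi>' \<Phi>(2) b refl, of r] r by simp
  also have "\<Phi> (rel_defect v r) = nf X (xv v 1 * ?\<theta> r)"
  proof -
    have "\<Phi> (rel_defect v r) = (\<Sum>p\<in>keys r. \<Phi> (scal (lookup r p) (\<tau> p)))"
      unfolding rel_defect_def linext_def \<tau>_def[symmetric]
      by (rule FR.nf_hom_sum[OF \<Phi>']) (use \<tau>R rJ R_scal in simp)
    also have "\<dots> = (\<Sum>p\<in>keys r. nf X (lookup r p * \<Phi> (\<tau> p)))"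
      using nf_homD(4)[OF \<Phi>'] \<tau>R rJ by (intro sum.cong refl) simp
    also have "\<dots> = nf X (\<Sum>p\<in>keys r. lookup r p * (xv v 1 * \<eta> p))"
      using rJ by (simp add: nf_sum xv\<eta> del: One_nat_def)
    also have "(\<Sum>p\<in>keys r. lookup r p * (xv v 1 * \<eta> p)) = xv v 1 * present \<eta> r"
      by (simp add: present_def sum_distrib_left mult.left_commute)
    also have "nf X (xv v 1 * present \<eta> r) = nf X (xv v 1 * ?\<theta> r)" by (simp add: nf_mult_nf[OF down])
    finally show ?thesis .
  qed
  finally have eq: "nf X (xv v 1 * \<Phi> r) = nf X (xv v 1 * (?E + ?\<theta> r))" by (simp add: distrib_left nf_add)
  show "\<Phi> r = ?E + ?\<theta> r"
  proof (rule nf_xv_cancel[OF eq])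
    show "nf X (\<Phi> r) = \<Phi> r" using nf_homD(2)[OF \<Phi>'] r by simp
    show "nf X (?E + ?\<theta> r) = ?E + ?\<theta> r" by (simp add: VR.ext_def nf_add)
    show "v \<in> keys n" if "n \<in> keys (\<Phi> r)" for n
      using VR.shifts_v[OF \<Phi>(2) b a _ that] r by simp
    fix n assume "n \<in> keys (?E + ?\<theta> r)"
    then have "n \<in> keys ?E \<or> n \<in> keys (?\<theta> r)" using keys_add[of ?E "?\<theta> r"] by blast
    then show "v \<in> keys n"
    proof
      assume n: "n \<in> keys ?E"
      have "shifts a b FR rel_degs (VR.ext (lookup a v) (VR.loc \<Phi>))"
        using VR.shifts_ext[OF _ refl] VR.shifts_loc[OF \<Phi>(2) b(1)] b(2) by simp
      then show ?thesis using VR.shifts_v[of a b "VR.ext (lookup a v) (VR.loc \<Phi>)" r n] b a n r by simp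
    next
      assume "n \<in> keys (?\<theta> r)"
      then have "n \<in> keys (\<Sum>p\<in>keys r. lookup r p * \<eta> p)" by (simp add: keys_nf present_def)
      then obtain p where p: "p \<in> keys r" "n \<in> keys (lookup r p * \<eta> p)" using keys_sum by fastforce
      then obtain m m' where "m' \<in> keys (\<eta> p)" "n = m + m'" using keys_mult by blast
      then show ?thesis using \<eta>v[OF rJ(1)[OF p(1)]] by simp
    qed
  qed
qed

lemma loc2_hom_graded2: "finite b \<Longrightarrow> f \<in> graded2 a b \<Longrightarrow> loc2_hom V X v f \<in> L.graded2 (drop_var v a) (b - {v})"
  using nf_hom2_loc VR.shifts_loc unfolding graded2_def L.graded2_def by (auto simp: loc2_hom_hm2)

lemma loc2_iso:
  assumes b: "finite b" "v \<notin> b" and a: "v \<in> keys a"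
  shows "clinear_iso (sr_T2 V X) (sr_T2 W lk) (T2_ab V X a b)
     (T2_ab W lk (drop_var v a) b) (loc2 V X v)"
proof -
  have e: "lookup a v > 0" using a by (simp add: in_keys_iff)
  have bv: "b - {v} = b" using b by simp
  have loc2_eq: "loc2 V X v = (\<lambda>t. \<Union>y\<in>t. L.cob_homs +>\<^bsub>L.HR\<^esub> loc2_hom V X v y)"
    by (simp add: fun_eq_iff loc2_def T2_def quot_module_def)
  show ?thesis unfolding loc2_eq T2_ab_eq L.T2_ab_eq T2_def
  proof (rule clinear_iso_cosets[OF coset_map_T2])
    fix k f assume "f \<in> carrier HR"
    then obtain \<Phi> where \<Phi>: "nf_hom2 \<Phi>" "f = hm2 \<Phi>" by (rule ex_lift2)
    have "VR.loc (\<lambda>x. nf X (Const k * \<Phi> x)) = (\<lambda>x. nf lk (Const k * VR.loc \<Phi> x))"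
      by (simp add: VR.loc_def fun_eq_iff nf_deh_nf[OF down] deh_mult nf_mult_nf[OF L.down] deh_id)
    then show "loc2_hom V X v (Const k \<odot>\<^bsub>HR\<^esub> f) = Const k \<odot>\<^bsub>L.HR\<^esub> loc2_hom V X v f"
      by (simp only: \<Phi> hm2_smult P_Const nf_hom2_smult loc2_hom_hm2 L.hm2_smult nf_hom2_loc)
  next
    show "graded2 a b \<subseteq> carrier HR" by (rule graded2_sub)
    show "L.graded2 (drop_var v a) b \<subseteq> carrier L.HR" by (rule L.graded2_sub)
    show "f \<ominus>\<^bsub>HR\<^esub> g \<in> graded2 a b" if "f \<in> graded2 a b" "g \<in> graded2 a b" for f g using graded2_diff that .
    show "loc2_hom V X v f \<in> L.graded2 (drop_var v a) b" if "f \<in> graded2 a b" for f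
      using loc2_hom_graded2[OF b(1) that] by (simp only: bv)
  next
    fix f assume "f \<in> graded2 a b" and S: "loc2_hom V X v f \<in> L.cob_homs"
    then obtain \<Phi> where \<Phi>: "f = hm2 \<Phi>" "nf_hom2 \<Phi>" "shifts a b FR rel_degs \<Phi>" unfolding graded2_def by blast
    obtain \<eta>' where \<eta>': "nf_hom W lk L.FM \<eta>'" "\<forall>r\<in>L.R. VR.loc \<Phi> r = \<eta>' r"
      using S unfolding \<Phi>(1) loc2_hom_hm2[OF \<Phi>(2)] L.hm2_mem_cob_homs[OF nf_hom2_loc[OF \<Phi>(2)]] by blast
    obtain \<theta> where \<theta>: "nf_hom V X FM \<theta>" "\<And>r. r \<in> R \<Longrightarrow> \<Phi> r = VR.ext (lookup a v) (VR.loc \<Phi>) r + \<theta> r"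
      by (rule ext_loc2[OF \<Phi>(2,3) b a]) blast
    have "\<Phi> r = VF.ext (lookup a v) \<eta>' r + \<theta> r" if r: "r \<in> R" for r
    proof -
      have "rel_coef v k r \<in> L.R" for k using VR.comp_mem[of r k] r by simp
      then have "VR.ext (lookup a v) (VR.loc \<Phi>) r = VF.ext (lookup a v) \<eta>' r"
        using \<eta>'(2) by (simp add: VR.ext_def VF.ext_def)
      then show ?thesis using \<theta>(2)[OF r] by simp
    qed
    moreover have "nf_hom V X FM (\<lambda>r. VF.ext (lookup a v) \<eta>' r + \<theta> r)"
      by (rule HF.nf_hom_add[OF VF.nf_hom_ext[OF \<eta>'(1) e] \<theta>(1)])
    ultimately show "f \<in> cob_homs" unfolding \<Phi>(1) hm2_mem_cob_homs[OF \<Phi>(2)] by blast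
  next
    fix g assume "g \<in> L.graded2 (drop_var v a) b"
    then obtain \<Psi> where \<Psi>: "g = L.hm2 \<Psi>" "L.nf_hom2 \<Psi>" "shifts (drop_var v a) b L.FR rel_degs \<Psi>"
      unfolding L.graded2_def by blast
    let ?\<Phi> = "VR.ext (lookup a v) \<Psi>"
    have \<Psi>': "nf_hom W lk L.FR \<Psi>" using \<Psi>(2) by (simp add: L.nf_hom2_def)
    have 1: "nf_hom2 ?\<Phi>" by (rule nf_hom2_ext[OF \<Psi>(2) e])
    have "loc2_hom V X v (hm2 ?\<Phi>) = g"
      unfolding loc2_hom_hm2[OF 1] \<Psi>(1) L.hm2_eq_iff[OF nf_hom2_loc[OF 1] \<Psi>(2)]
      using VR.loc_ext[OF \<Psi>'] by simp
    moreover have "hm2 ?\<Phi> \<in> graded2 a b" using 1 VR.shifts_ext[OF \<Psi>(3) refl] unfolding graded2_def by blast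
    ultimately show "\<exists>f\<in>graded2 a b. loc2_hom V X v f = g" by blast
  qed
qed

text \<open>The homogenization of the relation of \<open>p\<close> and \<open>q\<close> is the relation of \<open>p \<union> v\<close> and \<open>q \<union> v\<close>. The rest is the
  computation for \<open>T\<^sup>1\<close>.\<close>

lemma represents2_loc2:
  assumes b: "b \<subseteq> V" and a: "keys a \<subseteq> V" and ab: "keys a \<inter> b = {}" and t: "t \<in> T2_ab V X a b"
    and rep: "represents2 V X a b \<mu> t"
  shows "represents2 W lk (drop_var v a) (b - {v}) (\<mu> \<circ> map_prod (psi b v) (psi b v)) (loc2 V X v t)"
proof -
  interpret Q: quotient_module "poly_ring V" HR cob_homs by (rule quotient_T2)
  interpret Q': quotient_module "poly_ring W" L.HR L.cob_homs by (rule L.quotient_T2)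
  have finb: "finite b" using b finite_V finite_subset by blast
  obtain f where f: "f \<in> t" "\<And>p q. p \<in> J \<Longrightarrow> q \<in> J \<Longrightarrow> f (rel_cls (taylor p q)) = cls (if (p \<union> q \<union> keys a) - b \<in> X
         then Const (\<mu> ((p \<union> keys a) - b, (q \<union> keys a) - b)) * xpow (multideg (chi (p \<union> q)) + multideg a - multideg (chi b)) else 0)"
    and tc: "t \<in> carrier (sr_T2 V X)"
    using rep unfolding represents2_def by blast
  obtain g where g: "g \<in> carrier HR" "t = cob_homs +>\<^bsub>HR\<^esub> g"
    using tc unfolding T2_def Q.quot_carrier by blast
  have f': "f \<in> carrier HR" "t = cob_homs +>\<^bsub>HR\<^esub> f"
    using Q.S.a_elemrcos_carrier[OF g(1)] Q.S.a_repr_independence'[OF _ g(1)] f(1) g(2) by blast+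
  obtain \<Phi> where \<Phi>: "nf_hom2 \<Phi>" "f = hm2 \<Phi>" by (rule ex_lift2[OF f'(1)])
  have \<Phi>': "nf_hom V X FR \<Phi>" using \<Phi>(1) by (simp add: nf_hom2_def)
  have loc: "loc2 V X v t = L.cob_homs +>\<^bsub>L.HR\<^esub> L.hm2 (VR.loc \<Phi>)"
    unfolding f'(2) \<Phi>(2) by (rule loc2_coset[OF \<Phi>(1)])
  have "L.hm2 (VR.loc \<Phi>) (L.rel_cls (taylor p q)) = L.cls (if (p \<union> q \<union> keys (drop_var v a)) - (b - {v}) \<in> lk
       then Const ((\<mu> \<circ> map_prod (psi b v) (psi b v)) ((p \<union> keys (drop_var v a)) - (b - {v}), (q \<union> keys (drop_var v a)) - (b - {v}))) *
         xpow (multideg (chi (p \<union> q)) + multideg (drop_var v a) - multideg (chi (b - {v}))) else 0)"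
    (is "_ = L.cls ?R") if p: "p \<in> L.J" and q: "q \<in> L.J" for p q
  proof -
    have pV: "p \<subseteq> W" "q \<subseteq> W" "p \<union> q \<subseteq> W" using p q by (auto simp: nonfaces_def)
    note fin = L.nonface_finite[OF p] L.nonface_finite[OF q]
    note ip = insert_v_nonface[OF p] and iq = insert_v_nonface[OF q]
    have un: "insert v p \<union> insert v q = insert v (p \<union> q)" by blast
    let ?T = "if (insert v (p \<union> q) \<union> keys a) - b \<in> X
         then Const (\<mu> ((insert v p \<union> keys a) - b, (insert v q \<union> keys a) - b)) * xpow (multideg (chi (insert v (p \<union> q))) + multideg a - multideg (chi b)) else 0"
    have TP: "?T \<in> P V"
      using a pV v fin by (auto simp: xpow_eq[OF ab finb] intro!: P_mult)
    have \<tau>: "taylor (insert v p) (insert v q) \<in> R" by (rule taylor_R[OF ip iq])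
    have "\<Phi> (taylor (insert v p) (insert v q)) = nf X ?T"
    proof -
      have "cls (\<Phi> (taylor (insert v p) (insert v q))) = cls ?T"
        using f(2)[OF ip iq] unfolding \<Phi>(2) hm2_apply[OF \<Phi>(1) \<tau>] un .
      then have "nf X (\<Phi> (taylor (insert v p) (insert v q))) = nf X ?T"
        using TP nf_homD(1)[OF \<Phi>', of "taylor (insert v p) (insert v q)"] \<tau> by (subst (asm) cls_eq_iff) simp_all
      then show ?thesis using nf_homD(2)[OF \<Phi>', of "taylor (insert v p) (insert v q)"] \<tau> by simp
    qed
    moreover have "rel_emb v (taylor p q) = taylor (insert v p) (insert v q)"
    proof -
      have "insert v q - insert v p = q - p" "insert v p - insert v q = p - q" using pV by auto
      then show ?thesis by (simp add: taylor_def rel_emb_diff rel_emb_single)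
    qed
    ultimately have "VR.loc \<Phi> (taylor p q) = nf lk (deh v (nf X ?T))" by (simp only: VR.loc_def)
    also have "\<dots> = nf lk (deh v ?T)" by (rule nf_deh_nf[OF down])
    also have "\<dots> = nf lk ?R"
      unfolding deh_term[OF pV(3) ab finb] by (simp only: psi_face[OF pV(1) ab] psi_face[OF pV(2) ab] o_apply map_prod_simp)
    finally have eq: "VR.loc \<Phi> (taylor p q) = nf lk ?R" .
    have RP: "?R \<in> P W"
    proof -
      have "keys (drop_var v a) \<inter> (b - {v}) = {}" "finite (b - {v})" using ab finb by auto
      then show ?thesis using a pV fin by (auto simp: xpow_eq intro!: P_mult)
    qed
    show ?thesis unfolding L.hm2_apply[OF nf_hom2_loc[OF \<Phi>(1)] L.taylor_R[OF p q]] eq by (rule L.cls_nf[OF RP])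
  qed
  moreover have "L.hm2 (VR.loc \<Phi>) \<in> loc2 V X v t" unfolding loc
    by (rule Q'.S.a_rcos_self) (rule L.hm2_mem[OF nf_hom2_loc[OF \<Phi>(1)]])
  moreover have "loc2 V X v t \<in> carrier (sr_T2 W lk)"
    using loc2_T2_ab[OF finb t] L.T2_ab_sub_carrier by blast
  moreover have "\<forall>(f, g)\<in>N_pairs (keys (drop_var v a)) (b - {v}) lk.
     (\<mu> \<circ> map_prod (psi b v) (psi b v)) (f, g) = - (\<mu> \<circ> map_prod (psi b v) (psi b v)) (g, f)"
    using psi_N_pairs[OF down ab] rep unfolding represents2_def by fastforce
  ultimately show ?thesis unfolding represents2_def by blast
qed

end

section \<open>Combinatorial description of the second cotangent module\<close>

context stanley_reisner begin

text \<open>Let \<open>\<kappa> p q\<close> be the coefficient of the value on the relation of \<open>p\<close> and \<open>q\<close>. It is an alternating cocycle as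
  long as the faces \<open>fc p = (p \<union> a) - b\<close> span a face together, but it may depend on \<open>p\<close> and \<open>q\<close>, and not only
  on \<open>fc p\<close> and \<open>fc q\<close>. A homogeneous coboundary can change it only at generators \<open>p\<close> with \<open>b \<subseteq> p\<close>, because the
  other basis elements have no nonzero image of the right degree. Fix a representative \<open>P0 f\<close> for every face \<open>f\<close>, not containing \<open>b\<close> whenever
  this is possible. Subtracting the coboundary with \<open>\<eta> p = \<kappa> p (P0 (fc p))\<close> for \<open>b \<subseteq> p\<close>
  gives a cocycle \<open>\<kappa>'\<close> that vanishes between each \<open>p\<close> and its representative. For \<open>p\<close> not containing \<open>b\<close>
  this is the claim \<open>small\<close>, which is due to the vanishing on Koszul relations. By the cocycle condition,
  \<open>\<kappa>'\<close> then depends on the faces only.\<close>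

lemma ex_represents2:
  assumes a: "keys a \<subseteq> V" and b: "b \<subseteq> V" and ab: "keys a \<inter> b = {}" and t: "t \<in> T2_ab V X a b"
  shows "\<exists>\<mu>. represents2 V X a b \<mu> t"
proof -
  interpret Q: quotient_module "poly_ring V" HR cob_homs by (rule quotient_T2)
  have finb: "finite b" using b finite_V finite_subset by blast
  obtain \<Phi> where \<Phi>: "nf_hom2 \<Phi>" "shifts a b FR rel_degs \<Phi>" "t = cob_homs +>\<^bsub>HR\<^esub> hm2 \<Phi>"
    using t unfolding T2_ab_eq graded2_def by blast
  have \<Phi>': "nf_hom V X FR \<Phi>" using \<Phi>(1) by (simp add: nf_hom2_def)
  define fc where "fc p = (p \<union> keys a) - b" for p
  define \<kappa> where "\<kappa> p q = (if b \<subseteq> p \<union> q then lookup (\<Phi> (taylor p q)) (chi (p \<union> q - b) + a) else 0)" for p q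
  have fin: "finite p" and sub: "p \<subseteq> V" if "p \<in> J" for p
    using that nonface_finite by (auto simp: nonfaces_def)
  have val: "\<Phi> (taylor p q) = single (chi (p \<union> q - b) + a) (\<kappa> p q)" if pq: "p \<in> J" "q \<in> J" for p q
  proof -
    have "\<Phi> (taylor p q) = (if b \<subseteq> p \<union> q then single (chi (p \<union> q - b) + a) (lookup (\<Phi> (taylor p q)) (chi (p \<union> q - b) + a)) else 0)"
    proof (rule shift_single[OF _ ab finb])
      fix n assume n: "n \<in> keys (\<Phi> (taylor p q))"
      have "taylor p q \<in> carrier FR" using taylor_R[OF pq] by simp
      then obtain d where "d \<in> rel_degs (taylor p q)" "n + chi b = d + a" using \<Phi>(2) n unfolding shifts_def by blast
      then show "n + chi b = chi (p \<union> q) + a" using rel_degs_taylor[OF fin[OF pq(1)] fin[OF pq(2)]] by simp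
    qed (use fin pq in auto)
    then show ?thesis by (simp add: \<kappa>_def split: if_splits)
  qed
  have keysN: "keys (chi (u - b) + a) = fc u" if "finite u" for u
    using that ab by (auto simp: fc_def)
  have anti: "\<kappa> q p = - \<kappa> p q" if pq: "p \<in> J" "q \<in> J" for p q
  proof -
    have "taylor q p = - taylor p q" by (simp add: taylor_def)
    then have "\<Phi> (taylor q p) = - \<Phi> (taylor p q)" using FR.nf_hom_uminus[OF \<Phi>', of "taylor p q"] taylor_R[OF pq] by simp
    then show ?thesis by (simp add: \<kappa>_def Un_commute)
  qed
  have cocycle: "\<kappa> p q + \<kappa> q r + \<kappa> r p = 0"
    if pqr: "p \<in> J" "q \<in> J" "r \<in> J" and X: "fc p \<union> fc q \<union> fc r \<in> X" for p q r
  proof (cases "b \<subseteq> p \<union> q \<union> r")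
    case False
    then show ?thesis by (auto simp: \<kappa>_def)
  next
    case True
    let ?u = "p \<union> q \<union> r" and ?N = "chi (p \<union> q \<union> r - b) + a"
    have finu: "finite ?u" "?u \<subseteq> V" using fin sub pqr by auto
    have NX: "keys ?N \<in> X" using X unfolding keysN[OF finu(1)] by (simp add: fc_def Un_Diff Un_ac)
    \<comment> \<open>multiplied to the common multiple of all three generators, the relations telescope\<close>
    have T: "scal (sqfree (?u - (x \<union> y))) (taylor x y) = single x (sqfree (?u - x)) - single y (sqfree (?u - y))"
      if xy: "x \<subseteq> ?u" "y \<subseteq> ?u" for x y
    proof -
      have f: "finite (?u - (x \<union> y))" "finite (y - x)" "finite (x - y)" using finu xy finite_subset by blast+
      have "sqfree (?u - (x \<union> y)) * sqfree (y - x) = sqfree (?u - x)"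
        using f xy by (subst sqfree_mult) (auto intro!: arg_cong[where f = sqfree])
      moreover have "sqfree (?u - (x \<union> y)) * sqfree (x - y) = sqfree (?u - y)"
        using f xy by (subst sqfree_mult) (auto intro!: arg_cong[where f = sqfree])
      ultimately show ?thesis by (simp add: taylor_def scal_diff scal_single del: map_single)
    qed
    have R: "scal (sqfree (?u - (x \<union> y))) (taylor x y) \<in> carrier FR" if "x \<in> J" "y \<in> J" for x y
      using R_scal[OF _ taylor_R[OF that], of "sqfree (?u - (x \<union> y))"] finu by (auto intro!: sqfree_P)
    have \<Phi>T: "\<Phi> (scal (sqfree (?u - (x \<union> y))) (taylor x y)) = single ?N (\<kappa> x y)"
      if xy: "x \<in> J" "y \<in> J" "x \<subseteq> ?u" "y \<subseteq> ?u" for x y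
    proof -
      have P: "sqfree (?u - (x \<union> y)) \<in> P V" using finu by (auto intro!: sqfree_P)
      have "\<Phi> (scal (sqfree (?u - (x \<union> y))) (taylor x y)) = nf X (sqfree (?u - (x \<union> y)) * \<Phi> (taylor x y))"
        using nf_homD(4)[OF \<Phi>' P, of "taylor x y"] taylor_R[OF xy(1,2)] by simp
      also have "sqfree (?u - (x \<union> y)) * \<Phi> (taylor x y) = single ?N (\<kappa> x y)"
      proof (cases "b \<subseteq> x \<union> y")
        case True
        have f: "finite (?u - (x \<union> y))" "finite (x \<union> y - b)" using finu(1) fin xy by auto
        have "chi (?u - (x \<union> y)) + chi (x \<union> y - b) = chi (?u - b)"
          using f xy True by (subst chi_Un_disjoint) (auto intro!: arg_cong[where f = chi])
        then show ?thesis unfolding val[OF xy(1,2)] by (simp add: sqfree_def mult_single flip: add.assoc)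
      next
        case False
        then show ?thesis unfolding val[OF xy(1,2)] by (simp add: \<kappa>_def)
      qed
      also have "nf X (single ?N (\<kappa> x y)) = single ?N (\<kappa> x y)" using NX unfolding nf_single by simp
      finally show ?thesis .
    qed
    have sub3: "p \<subseteq> ?u" "q \<subseteq> ?u" "r \<subseteq> ?u" by auto
    let ?A = "scal (sqfree (?u - (p \<union> q))) (taylor p q)" and ?B = "scal (sqfree (?u - (q \<union> r))) (taylor q r)"
      and ?C = "scal (sqfree (?u - (r \<union> p))) (taylor r p)"
    have "single ?N (\<kappa> p q) + single ?N (\<kappa> q r) + single ?N (\<kappa> r p) = \<Phi> ?A + \<Phi> ?B + \<Phi> ?C"
      by (simp only: \<Phi>T[OF pqr(1,2) sub3(1,2)] \<Phi>T[OF pqr(2,3) sub3(2,3)] \<Phi>T[OF pqr(3,1) sub3(3,1)])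
    also have "\<dots> = \<Phi> (?A + ?B + ?C)"
      by (simp only: FR.nf_hom_plus[OF \<Phi>'] R[OF pqr(1,2)] R[OF pqr(2,3)] R[OF pqr(3,1)] FR.add_mem)
    also have "scal (sqfree (?u - (p \<union> q))) (taylor p q) + scal (sqfree (?u - (q \<union> r))) (taylor q r) + scal (sqfree (?u - (r \<union> p))) (taylor r p) = 0"
      unfolding T[OF sub3(1,2)] T[OF sub3(2,3)] T[OF sub3(3,1)] by simp
    also have "\<Phi> 0 = 0" by (rule FR.nf_hom_0[OF \<Phi>'])
    finally show ?thesis by (metis single_add lookup_single_eq lookup_zero)
  qed
  have kos: "\<kappa> p q = 0" if pq: "p \<in> J" "q \<in> J" and X: "fc p \<union> fc q \<union> (p \<inter> q \<inter> b) \<in> X" for p q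
  proof (cases "b \<subseteq> p \<union> q")
    case True
    \<comment> \<open>\<open>x\<^bsup>p \<inter> q\<^esup>\<close> times the relation of \<open>p\<close> and \<open>q\<close> is a Koszul relation\<close>
    let ?N = "chi (p \<inter> q) + (chi (p \<union> q - b) + a)"
    have f: "finite p" "finite q" using fin pq by auto
    have "keys ?N = fc p \<union> fc q \<union> (p \<inter> q \<inter> b)"
      using f ab unfolding keys_mono_add by (auto simp: fc_def)
    then have NX: "keys ?N \<in> X" using X by simp
    have "sqfree (p \<inter> q) * sqfree (q - p) = sqfree q" "sqfree (p \<inter> q) * sqfree (p - q) = sqfree p"
      using f by (subst sqfree_mult; auto intro!: arg_cong[where f = sqfree])+
    then have "scal (sqfree (p \<inter> q)) (taylor p q) = koszul_rel (single p 1) (single q 1)"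
      by (simp add: taylor_def koszul_rel_def scal_diff scal_single del: map_single)
    moreover have "koszul_rel (single p 1) (single q 1) \<in> K" using pq by (intro K_props(4) single_FM) auto
    ultimately have "0 = \<Phi> (scal (sqfree (p \<inter> q)) (taylor p q))" using \<Phi>(1) by (simp add: nf_hom2_def)
    also have "\<dots> = nf X (sqfree (p \<inter> q) * \<Phi> (taylor p q))"
      using nf_homD(4)[OF \<Phi>', of "sqfree (p \<inter> q)" "taylor p q"] taylor_R[OF pq] sqfree_P[of "p \<inter> q" V] f sub[OF pq(1)] by auto
    also have "\<dots> = single ?N (\<kappa> p q)"
      using NX unfolding val[OF pq] by (simp add: sqfree_def mult_single nf_single)
    finally show ?thesis by (metis lookup_single_eq lookup_zero)
  qed (simp add: \<kappa>_def)
  \<comment> \<open>nonfaces over \<open>f\<close> that do not contain \<open>b\<close>; no homogeneous coboundary can change \<open>\<kappa>\<close> between two of them\<close>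
  define bad where "bad f p \<longleftrightarrow> p \<in> J \<and> \<not> b \<subseteq> p \<and> fc p = f" for f p
  define P0 where "P0 f = (if \<exists>p. bad f p then SOME p. bad f p else f \<union> b)" for f
  have P0: "P0 (fc p) \<in> J" "fc (P0 (fc p)) = fc p" "b \<subseteq> P0 (fc p) \<Longrightarrow> \<not> (\<exists>p'. bad (fc p) p')"
    if p: "p \<in> J" for p
  proof -
    have 1: "bad (fc p) (P0 (fc p))" if "\<exists>p'. bad (fc p) p'"
      using someI_ex[OF that] that by (simp add: P0_def)
    have "fc p \<union> b \<in> J" using p sub[OF p] a b by (intro nonface_superset[OF p]) (auto simp: fc_def)
    moreover have "fc (fc p \<union> b) = fc p" using ab by (auto simp: fc_def)
    ultimately have 2: "P0 (fc p) \<in> J \<and> fc (P0 (fc p)) = fc p" if "\<not> (\<exists>p'. bad (fc p) p')" using that by (simp add: P0_def)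
    show "P0 (fc p) \<in> J" "fc (P0 (fc p)) = fc p" using 1 2 by (auto simp: bad_def)
    show "b \<subseteq> P0 (fc p) \<Longrightarrow> \<not> (\<exists>p'. bad (fc p) p')" using 1 by (auto simp: bad_def)
  qed
  define \<eta> where "\<eta> p = (if b \<subseteq> p then \<kappa> p (P0 (fc p)) else 0)" for p
  define \<kappa>' where "\<kappa>' p q = \<kappa> p q - \<eta> p + \<eta> q" for p q
  have self: "\<kappa> p p = 0" if "p \<in> J" for p using anti[OF that that] by simp
  have small: "\<kappa> p q = 0" if pq: "p \<in> J" "q \<in> J" "\<not> b \<subseteq> p" "\<not> b \<subseteq> q" "fc p = fc q" and X: "fc p \<in> X" for p q
  proof (cases "fc p \<union> (p \<inter> q \<inter> b) \<in> X")
    case True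
    then show ?thesis using kos[OF pq(1,2)] pq(5) by simp
  next
    case False
    \<comment> \<open>\<open>r\<close> is a third nonface over the same face, such that \<open>b\<close> is not contained in \<open>p \<union> r\<close> or \<open>q \<union> r\<close>\<close>
    define r where "r = fc p \<union> (p \<inter> q \<inter> b)"
    have r: "r \<in> J" "fc r = fc p" "r \<inter> b = p \<inter> q \<inter> b"
      using False a sub[OF pq(1)] ab by (auto simp: r_def nonfaces_def fc_def)
    have "\<not> b \<subseteq> p \<union> r" "\<not> b \<subseteq> q \<union> r" using r(3) pq(3,4) by blast+
    then have "\<kappa> q r = 0" "\<kappa> r p = 0" by (simp_all add: \<kappa>_def Un_commute)
    then show ?thesis using cocycle[OF pq(1,2) r(1)] r(2) pq(5) X by simp
  qed
  have k0: "\<kappa>' p (P0 (fc p)) = 0" if p: "p \<in> J" and X: "fc p \<in> X" for p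
  proof -
    let ?q = "P0 (fc p)"
    note q = P0[OF p]
    show ?thesis
    proof (cases "b \<subseteq> ?q")
      case True
      then have "b \<subseteq> p" using q(3)[OF True] p by (auto simp: bad_def)
      moreover have "\<eta> ?q = 0" using True q(2) self[OF q(1)] by (simp add: \<eta>_def)
      ultimately show ?thesis by (simp add: \<kappa>'_def \<eta>_def)
    next
      case False
      then show ?thesis using small[OF p q(1) _ False q(2)[symmetric] X] by (simp add: \<kappa>'_def \<eta>_def)
    qed
  qed
  have anti': "\<kappa>' q p = - \<kappa>' p q" if "p \<in> J" "q \<in> J" for p q
    using anti[OF that] by (simp add: \<kappa>'_def)
  have coc': "\<kappa>' p q + \<kappa>' q r + \<kappa>' r p = 0"
    if "p \<in> J" "q \<in> J" "r \<in> J" "fc p \<union> fc q \<union> fc r \<in> X" for p q r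
    using cocycle[OF that] by (simp add: \<kappa>'_def algebra_simps)
  define \<mu> where "\<mu> = (\<lambda>(f, g). \<kappa>' (P0 f) (P0 g))"
  have \<mu>: "\<kappa>' p q = \<mu> (fc p, fc q)" if p: "p \<in> J" and q: "q \<in> J" and X: "fc p \<union> fc q \<in> X" for p q
  proof -
    have X': "fc p \<in> X" "fc q \<in> X" using X by (auto intro: down_closedD[OF down])
    note pp = P0[OF p] and qq = P0[OF q]
    have "\<kappa>' p q + \<kappa>' q (P0 (fc p)) + \<kappa>' (P0 (fc p)) p = 0"
      using coc'[OF p q pp(1)] X pp(2) by (simp add: Un_ac)
    moreover have "\<kappa>' (P0 (fc p)) p = 0" using k0[OF p X'(1)] anti'[OF p pp(1)] by simp
    moreover have "\<kappa>' q (P0 (fc p)) = - \<kappa>' (P0 (fc p)) q" by (rule anti'[OF pp(1) q])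
    moreover have "\<kappa>' (P0 (fc p)) q + \<kappa>' q (P0 (fc q)) + \<kappa>' (P0 (fc q)) (P0 (fc p)) = 0"
      using coc'[OF pp(1) q qq(1)] X pp(2) qq(2) by (simp add: Un_ac)
    moreover have "\<kappa>' (P0 (fc q)) (P0 (fc p)) = - \<kappa>' (P0 (fc p)) (P0 (fc q))" by (rule anti'[OF pp(1) qq(1)])
    ultimately show ?thesis using k0[OF q X'(2)] by (simp add: \<mu>_def algebra_simps)
  qed
  define \<eta>\<eta> where "\<eta>\<eta> p = single (chi (p - b) + a) (\<eta> p)" for p
  define \<Theta> where "\<Theta> r = nf X (present \<eta>\<eta> r)" for r
  have \<Theta>: "nf_hom V X FM \<Theta>"
    unfolding \<Theta>_def by (rule nf_hom_present) (use a sub fin in \<open>auto simp: \<eta>\<eta>_def\<close>)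
  define \<Phi>2 where "\<Phi>2 r = \<Phi> r - \<Theta> r" for r
  have \<Phi>2: "nf_hom2 \<Phi>2" unfolding \<Phi>2_def by (rule nf_hom2_diff[OF \<Phi>(1) nf_hom_FM_R[OF \<Theta>]])
  have "hm2 \<Phi> \<ominus>\<^bsub>HR\<^esub> hm2 \<Phi>2 \<in> cob_homs"
    unfolding hm2_diff[OF \<Phi>(1) \<Phi>2] hm2_mem_cob_homs[OF nf_hom2_diff[OF \<Phi>(1) \<Phi>2]] using \<Theta> by (intro exI[of _ \<Theta>]) (simp add: \<Phi>2_def)
  then have t2: "t = cob_homs +>\<^bsub>HR\<^esub> hm2 \<Phi>2"
    unfolding \<Phi>(3) Q.coset_eq_iff[OF hm2_mem[OF \<Phi>(1)] hm2_mem[OF \<Phi>2]] .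
  have "hm2 \<Phi>2 (rel_cls (taylor p q)) = cls (if (p \<union> q \<union> keys a) - b \<in> X
         then Const (\<mu> ((p \<union> keys a) - b, (q \<union> keys a) - b)) * xpow (multideg (chi (p \<union> q)) + multideg a - multideg (chi b)) else 0)"
    (is "_ = cls ?T") if p: "p \<in> J" and q: "q \<in> J" for p q
  proof -
    have f: "finite p" "finite q" "finite (p \<union> q)" using fin p q by auto
    let ?N = "chi (p \<union> q - b) + a"
    have kN: "keys ?N = (p \<union> q \<union> keys a) - b" using keysN[OF f(3)] by (simp add: fc_def)
    have fcu: "(p \<union> q \<union> keys a) - b = fc p \<union> fc q" by (auto simp: fc_def)
    have *: "sqfree (y - x) * \<eta>\<eta> x = single (chi (x \<union> y - b) + a) (\<eta> x)" if "finite x" "finite y" for x y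
    proof (cases "b \<subseteq> x")
      case True
      have "chi (y - x) + chi (x - b) = chi (x \<union> y - b)"
        using that True by (subst chi_Un_disjoint) (auto intro!: arg_cong[where f = chi])
      then show ?thesis by (simp add: \<eta>\<eta>_def sqfree_def mult_single flip: add.assoc)
    qed (simp add: \<eta>\<eta>_def \<eta>_def)
    have "present \<eta>\<eta> (taylor p q) = single ?N (\<eta> p) - single ?N (\<eta> q)"
      unfolding taylor_def present_diff present_single using *[OF f(1,2)] *[OF f(2,1)] by (simp add: Un_commute)
    then have \<Theta>\<tau>: "\<Theta> (taylor p q) = nf X (single ?N (\<eta> p - \<eta> q))" by (simp add: \<Theta>_def single_diff)
    have "\<Phi> (taylor p q) = nf X (single ?N (\<kappa> p q))"
      using nf_homD(2)[OF \<Phi>', of "taylor p q"] taylor_R[OF p q] by (simp add: val[OF p q])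
    then have eq: "\<Phi>2 (taylor p q) = nf X (single ?N (\<kappa>' p q))"
      by (simp add: \<Phi>2_def \<Theta>\<tau> nf_diff[symmetric] single_diff[symmetric] \<kappa>'_def algebra_simps)
    also have "\<dots> = nf X ?T"
    proof (cases "fc p \<union> fc q \<in> X")
      case True
      have T: "?T = (if b \<subseteq> p \<union> q then single ?N (\<kappa>' p q) else 0)"
        using True \<mu>[OF p q True] unfolding fcu xpow_eq[OF ab finb f(3)] by (simp add: fc_def Const_mult_single)
      have "\<kappa>' p q = 0" if "\<not> b \<subseteq> p \<union> q" using that by (auto simp: \<kappa>'_def \<kappa>_def \<eta>_def)
      then show ?thesis unfolding T by simp
    next
      case False
      then show ?thesis unfolding nf_single kN fcu by simp
    qed
    finally have eq: "\<Phi>2 (taylor p q) = nf X ?T" .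
    have "?T \<in> P V" using a sub[OF p] sub[OF q] f by (auto simp: xpow_eq[OF ab finb f(3)] intro!: P_mult)
    then show ?thesis unfolding hm2_apply[OF \<Phi>2 taylor_R[OF p q]] eq by (rule cls_nf)
  qed
  moreover have "\<forall>(f, g)\<in>N_pairs (keys a) b X. \<mu> (f, g) = - \<mu> (g, f)"
  proof -
    have N: "f \<union> b \<in> J \<and> fc (f \<union> b) = f" if "f \<in> N (keys a) b X" for f
      using that b X_sub ab by (auto simp: N_def nonfaces_def fc_def)
    have "P0 f \<in> J" if "f \<in> N (keys a) b X" for f
      using P0(1)[of "f \<union> b"] N[OF that] by simp
    then have neg: "\<mu> (f, g) = - \<mu> (g, f)" if "f \<in> N (keys a) b X" "g \<in> N (keys a) b X" for f g
      using anti'[of "P0 g" "P0 f"] that by (simp add: \<mu>_def)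
    show ?thesis
    proof (intro ballI case_prodI2)
      fix fg f g assume "fg \<in> N_pairs (keys a) b X" "fg = (f, g)"
      then have "f \<in> N (keys a) b X" "g \<in> N (keys a) b X" by (simp_all add: N_pairs_def)
      then show "\<mu> (f, g) = - \<mu> (g, f)" by (rule neg)
    qed
  qed
  moreover have "hm2 \<Phi>2 \<in> t" unfolding t2 by (rule Q.S.a_rcos_self[OF hm2_mem[OF \<Phi>2]])
  moreover have "t \<in> carrier (sr_T2 V X)" using t T2_ab_sub_carrier by blast
  ultimately show ?thesis unfolding represents2_def by (intro exI[of _ \<mu>]) blast
qed

end

section \<open>Localization of graded cotangent modules\<close>

theorem lemma14:
  fixes n v :: nat and X :: "nat set set" and a :: "nat \<Rightarrow>\<^sub>0 nat" and b :: "nat set"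
  assumes "simplicial_complex {0..n} X"
    and "Poly_Mapping.keys a \<subseteq> {0..n}" and "b \<subseteq> {0..n}" and "Poly_Mapping.keys a \<inter> b = {}"
    and "total_degree a = card b"
    and "v \<in> {0..n}"
  shows
    "(T1_ab {0..n} X a b \<subseteq> T1_0 {0..n} X \<and>
     T2_ab {0..n} X a b \<subseteq> T2_0 {0..n} X \<and>
     T1_ab ({0..n} - {v}) (link v X) (drop_var v a) (b - {v}) \<subseteq> carrier (sr_T1 ({0..n} - {v}) (link v X)) \<and>
     T2_ab ({0..n} - {v}) (link v X) (drop_var v a) (b - {v}) \<subseteq> carrier (sr_T2 ({0..n} - {v}) (link v X)) \<and>
     loc1 {0..n} X v \<in> T1_ab {0..n} X a b \<rightarrow> T1_ab ({0..n} - {v}) (link v X) (drop_var v a) (b - {v}) \<and>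
     loc2 {0..n} X v \<in> T2_ab {0..n} X a b \<rightarrow> T2_ab ({0..n} - {v}) (link v X) (drop_var v a) (b - {v})) \<and>
     (psi b v \<in> N (Poly_Mapping.keys a - {v}) (b - {v}) (link v X) \<rightarrow> N (Poly_Mapping.keys a) b X \<and>
     psi b v \<in> N_tilde (Poly_Mapping.keys a - {v}) (b - {v}) (link v X) \<rightarrow> N_tilde (Poly_Mapping.keys a) b X \<and>
     map_prod (psi b v) (psi b v) \<in>
       N_pairs (Poly_Mapping.keys a - {v}) (b - {v}) (link v X) \<rightarrow> N_pairs (Poly_Mapping.keys a) b X \<and>
     (\<forall>t \<in> T1_ab {0..n} X a b.
        (\<exists>\<mu>. represents1 {0..n} X a b \<mu> t) \<and>
        (\<forall>\<mu>. represents1 {0..n} X a b \<mu> t \<longrightarrow>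
           represents1 ({0..n} - {v}) (link v X) (drop_var v a) (b - {v})
             (\<mu> \<circ> psi b v) (loc1 {0..n} X v t))) \<and>
     (\<forall>t \<in> T2_ab {0..n} X a b.
        (\<exists>\<mu>. represents2 {0..n} X a b \<mu> t) \<and>
        (\<forall>\<mu>. represents2 {0..n} X a b \<mu> t \<longrightarrow>
           represents2 ({0..n} - {v}) (link v X) (drop_var v a) (b - {v})
             (\<mu> \<circ> map_prod (psi b v) (psi b v)) (loc2 {0..n} X v t)))) \<and>
     (v \<in> Poly_Mapping.keys a \<longrightarrow>
       clinear_iso (sr_T1 {0..n} X) (sr_T1 ({0..n} - {v}) (link v X))
         (T1_ab {0..n} X a b) (T1_ab ({0..n} - {v}) (link v X) (drop_var v a) b) (loc1 {0..n} X v) \<and>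
       clinear_iso (sr_T2 {0..n} X) (sr_T2 ({0..n} - {v}) (link v X))
         (T2_ab {0..n} X a b) (T2_ab ({0..n} - {v}) (link v X) (drop_var v a) b) (loc2 {0..n} X v))"
proof -
  interpret stanley_reisner_vertex "{0..n}" X v
    using assms(1,6) by unfold_locales (auto simp: simplicial_complex_def down_closed_def)
  have finb: "finite b" using assms(3) finite_subset by blast
  note ab = assms(4)
  show ?thesis
  proof (intro conjI ballI impI allI funcsetI)
    show "T1_ab {0..n} X a b \<subseteq> T1_0 {0..n} X" by (rule T1_ab_sub_T1_0[OF finb assms(5)])
    show "T2_ab {0..n} X a b \<subseteq> T2_0 {0..n} X" by (rule T2_ab_sub_T2_0[OF finb assms(5)])
    show "T1_ab ({0..n} - {v}) (link v X) (drop_var v a) (b - {v}) \<subseteq> carrier (sr_T1 ({0..n} - {v}) (link v X))"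
      by (rule L.T1_ab_sub_carrier)
    show "T2_ab ({0..n} - {v}) (link v X) (drop_var v a) (b - {v}) \<subseteq> carrier (sr_T2 ({0..n} - {v}) (link v X))"
      by (rule L.T2_ab_sub_carrier)
  next
    fix t assume t: "t \<in> T1_ab {0..n} X a b"
    show "loc1 {0..n} X v t \<in> T1_ab ({0..n} - {v}) (link v X) (drop_var v a) (b - {v})"
      by (rule loc1_T1_ab[OF finb t])
    show "\<exists>\<mu>. represents1 {0..n} X a b \<mu> t" by (rule ex_represents1[OF assms(2,3) ab t])
    show "represents1 ({0..n} - {v}) (link v X) (drop_var v a) (b - {v}) (\<mu> \<circ> psi b v) (loc1 {0..n} X v t)"
      if "represents1 {0..n} X a b \<mu> t" for \<mu>
      by (rule represents1_loc1[OF assms(3,2) ab t that])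
  next
    fix t assume t: "t \<in> T2_ab {0..n} X a b"
    show "loc2 {0..n} X v t \<in> T2_ab ({0..n} - {v}) (link v X) (drop_var v a) (b - {v})"
      by (rule loc2_T2_ab[OF finb t])
    show "\<exists>\<mu>. represents2 {0..n} X a b \<mu> t" by (rule ex_represents2[OF assms(2,3) ab t])
    show "represents2 ({0..n} - {v}) (link v X) (drop_var v a) (b - {v}) (\<mu> \<circ> map_prod (psi b v) (psi b v)) (loc2 {0..n} X v t)"
      if "represents2 {0..n} X a b \<mu> t" for \<mu>
      by (rule represents2_loc2[OF assms(3,2) ab t that])
  next
    show "psi b v g \<in> N (keys a) b X" if "g \<in> N (keys a - {v}) (b - {v}) (link v X)" for g
      by (rule psi_N[OF down ab that])
    show "psi b v g \<in> N_tilde (keys a) b X" if "g \<in> N_tilde (keys a - {v}) (b - {v}) (link v X)" for g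
      by (rule psi_N_tilde[OF down ab that])
    show "map_prod (psi b v) (psi b v) fg \<in> N_pairs (keys a) b X" if "fg \<in> N_pairs (keys a - {v}) (b - {v}) (link v X)" for fg
      by (rule psi_N_pairs[OF down ab that])
  next
    assume va: "v \<in> keys a"
    then have vb: "v \<notin> b" using ab by blast
    show "clinear_iso (sr_T1 {0..n} X) (sr_T1 ({0..n} - {v}) (link v X))
         (T1_ab {0..n} X a b) (T1_ab ({0..n} - {v}) (link v X) (drop_var v a) b) (loc1 {0..n} X v)"
      by (rule loc1_iso[OF finb vb va])
    show "clinear_iso (sr_T2 {0..n} X) (sr_T2 ({0..n} - {v}) (link v X))
         (T2_ab {0..n} X a b) (T2_ab ({0..n} - {v}) (link v X) (drop_var v a) b) (loc2 {0..n} X v)"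
      by (rule loc2_iso[OF finb vb va])
  qed
qed

end
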